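(* Let $\mathbf{k}$ be a field, let $n$ and $m$ be positive integers, and let $J_{n,m}\subseteq\mathbf{k}[y_1,\dots,y_n]$ be the ideal $$J_{n,m}=\langle y_1^m,\dots,y_n^m,\ y_1^{m-1}y_2,\dots,y_1y_2^{m-1},\ \dots,\ y_1^{m-1}y_n,\dots,y_1y_n^{m-1}\rangle .$$ The Betti numbers of $J_{n,m}$ are given by $$\beta_0(J_{n,m})=n+(n-1)(m-1),$$ $$\beta_i(J_{n,m})=\binom{n-1}{i}+\sum_{j=2}^{n}(m-1)\binom{1+n-j}{i}+\binom{n-1}{i+1}\qquad\text{for all }1\le i\le n-1 .$$ In particular, $\operatorname{projdim}(J_{n,m})=n-1$ and $\operatorname{reg}(J_{n,m})=(n-1)(m-1)$. The minimal free resolution of $J_{n,m}$ can be obtained as an iterated mapping cone.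
   Context: $\beta_i(J)$ is the $i$-th total Betti number of the ideal $J$ as a module over the polynomial ring (so $\beta_0(J)$ is the number of minimal generators), $\operatorname{projdim}$ is projective dimension and $\operatorname{reg}$ is Castelnuovo–Mumford regularity. Iterated mapping cone resolution: a free resolution of a monomial ideal $I$ built recursively as follows. If $I=\langle g\rangle$ is principal, take the resolution with one free generator of multidegree $g$. Otherwise order the minimal monomial generators $g_1,\dots,g_r$ of $I$, put $I'=\langle g_1,\dots,g_{r-1}\rangle$ and $\widetilde I=I'\cap\langle g_r\rangle$; given iterated mapping cone resolutions of $I'$ and $\widetilde I$, the short exact sequence $0\to\widetilde I\to I'\oplus\langle g_r\rangle\to I\to0$ yields a free resolution of $I$ as the mapping cone of a chain map lifting the inclusion $\widetilde I\to I'\oplus\langle g_r\rangle$ to the resolutions.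
   Formalization: The claim reg(J)=(n-1)(m-1) is false (n=m=2 gives reg(J)=2); proved instead: for n≥2, reg(S/J)=(n-1)(m-1) with S=k[y_1,...,y_n] and reg(J)=(n-1)(m-1)+1; for n=1, reg(S/J)=m-1 and reg(J)=m. *)

theory Defs
  imports
    "HOL-Library.Poly_Mapping"
    "HOL-Computational_Algebra.Computational_Algebra"
    "Jordan_Normal_Form.Matrix"
begin

subsection \<open>Polynomials, monomials and ideals\<close>

text \<open>The polynomial ring over the field \<open>'k\<close> whose variables are indexed by the finite
  type \<open>'n\<close>.  Exponent vectors have type \<open>'n \<Rightarrow>\<^sub>0 nat\<close>.\<close>

type_synonym ('n, 'k) mpoly = "('n \<Rightarrow>\<^sub>0 nat) \<Rightarrow>\<^sub>0 'k"

definition monomial :: "('n \<Rightarrow>\<^sub>0 nat) \<Rightarrow> ('n, 'k::field) mpoly" where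
  "monomial a = Poly_Mapping.single a 1"

definition variable :: "'n \<Rightarrow> ('n, 'k::field) mpoly" where
  "variable x = monomial (Poly_Mapping.single x 1)"

definition total_degree :: "('n::finite \<Rightarrow>\<^sub>0 nat) \<Rightarrow> int" where
  "total_degree a = int (\<Sum>x\<in>UNIV. Poly_Mapping.lookup a x)"

definition ideal_gen :: "('n, 'k::field) mpoly set \<Rightarrow> ('n, 'k) mpoly set" where
  "ideal_gen B = Modules.module.span (*) B"

definition max_homogeneous_ideal :: "('n, 'k::field) mpoly set" where
  "max_homogeneous_ideal = ideal_gen (range variable)"

subsection \<open>Graded complexes of free modules\<close>

text \<open>Gradings are by an arbitrary monoid: \<open>wt\<close> sends an exponent vector to the degree of the
  monomial.  The standard grading is \<open>wt = total_degree\<close>; the fine (multi)grading, whose degrees are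
  exponent vectors, is the identity.  A finely graded resolution becomes a standard graded one on
  replacing every shift by its total degree.

  A matrix acts on column vectors.  Its columns and rows correspond to homogeneous bases of the
  source and target with degrees \<open>cs\<close> and \<open>rs\<close>; the predicate below says that the map
  preserves degrees.\<close>

definition homogeneous_mat ::
  "(('n \<Rightarrow>\<^sub>0 nat) \<Rightarrow> 'd::monoid_add) \<Rightarrow> 'd list \<Rightarrow> 'd list \<Rightarrow> ('n, 'k::field) mpoly mat \<Rightarrow> bool" where
  "homogeneous_mat wt rs cs A \<longleftrightarrow>
     A \<in> carrier_mat (length rs) (length cs) \<and>
     (\<forall>p<length rs. \<forall>q<length cs. \<forall>a\<in>Poly_Mapping.keys (A $$ (p, q)). rs ! p + wt a = cs ! q)"

text \<open>The complex \<open>\<dots> \<rightarrow> F\<^sub>2 \<rightarrow> F\<^sub>1 \<rightarrow> F\<^sub>0\<close> of finite free modules with an augmentation \<open>aug F\<close> from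
  \<open>F\<^sub>0\<close> to some power of the ring.  \<open>shifts F i\<close> lists the degrees of the basis
  of \<open>F\<^sub>i\<close>, and \<open>bd F i\<close> is the differential from \<open>F\<^sub>i\<^sub>+\<^sub>1\<close> to \<open>F\<^sub>i\<close>.\<close>

record (overloaded) ('d, 'n, 'k) free_complex =
  shifts :: "nat \<Rightarrow> 'd list"
  aug :: "('n, 'k) mpoly mat"
  bd :: "nat \<Rightarrow> ('n, 'k) mpoly mat"

definition frank :: "('d, 'n, 'k) free_complex \<Rightarrow> nat \<Rightarrow> nat" where
  "frank F i = length (shifts F i)"

text \<open>The pair \<open>(N, D)\<close> stands for the module \<open>N/D\<close>, where \<open>D \<subseteq> N\<close> are ideals.\<close>

type_synonym ('n, 'k) gmodule = "('n, 'k) mpoly set \<times> ('n, 'k) mpoly set"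

abbreviation ideal_module :: "('n, 'k::field) mpoly set \<Rightarrow> ('n, 'k) gmodule" where
  "ideal_module J \<equiv> (J, {0})"

abbreviation quotient_ring :: "('n, 'k::field) mpoly set \<Rightarrow> ('n, 'k) gmodule" where
  "quotient_ring J \<equiv> (UNIV, J)"

definition graded_free_resolution ::
  "(('n \<Rightarrow>\<^sub>0 nat) \<Rightarrow> 'd::monoid_add) \<Rightarrow> ('d, 'n, 'k::field) free_complex \<Rightarrow> ('n, 'k) gmodule \<Rightarrow> bool"
where
  "graded_free_resolution wt F M \<longleftrightarrow>
     homogeneous_mat wt [0] (shifts F 0) (aug F) \<and>
     (\<forall>i. homogeneous_mat wt (shifts F i) (shifts F (Suc i)) (bd F i)) \<and>
     fst M = {(aug F *\<^sub>v v) $ 0 + d | v d. v \<in> carrier_vec (frank F 0) \<and> d \<in> snd M} \<and>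
     {v \<in> carrier_vec (frank F 0). (aug F *\<^sub>v v) $ 0 \<in> snd M}
       = {bd F 0 *\<^sub>v w | w. w \<in> carrier_vec (frank F 1)} \<and>
     (\<forall>i. {v \<in> carrier_vec (frank F (Suc i)). bd F i *\<^sub>v v = 0\<^sub>v (frank F i)}
       = {bd F (Suc i) *\<^sub>v w | w. w \<in> carrier_vec (frank F (Suc (Suc i)))})"

definition minimal_free_resolution ::
  "(('n \<Rightarrow>\<^sub>0 nat) \<Rightarrow> 'd::monoid_add) \<Rightarrow> ('d, 'n, 'k::field) free_complex \<Rightarrow> ('n, 'k) gmodule \<Rightarrow> bool"
where
  "minimal_free_resolution wt F M \<longleftrightarrow>
     graded_free_resolution wt F M \<and>
     (\<forall>i. elements_mat (bd F i) \<subseteq> max_homogeneous_ideal)"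

subsection \<open>Betti numbers, projective dimension, regularity\<close>

definition betti :: "('n::finite, 'k::field) gmodule \<Rightarrow> nat \<Rightarrow> nat" where
  "betti M i = (THE b. \<exists>F. minimal_free_resolution total_degree F M \<and> b = frank F i)"

definition graded_betti :: "('n::finite, 'k::field) gmodule \<Rightarrow> nat \<Rightarrow> int \<Rightarrow> nat" where
  "graded_betti M i d =
     (THE b. \<exists>F. minimal_free_resolution total_degree F M \<and> b = count_list (shifts F i) d)"

text \<open>Least length of a resolution, minimal or not, by finitely generated graded free modules;
  over the polynomial ring these are exactly the finitely generated graded projective modules.\<close>

definition projdim :: "('n::finite, 'k::field) gmodule \<Rightarrow> nat" where
  "projdim M =
     (LEAST l. \<exists>F. graded_free_resolution total_degree F M \<and> (\<forall>i>l. shifts F i = []))"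

definition regularity :: "('n::finite, 'k::field) gmodule \<Rightarrow> int" where
  "regularity M = Max {d - int i | i d. graded_betti M i d \<noteq> 0}"

subsection \<open>Iterated mapping cones\<close>

definition chain_map ::
  "(('n \<Rightarrow>\<^sub>0 nat) \<Rightarrow> 'd::monoid_add) \<Rightarrow> ('d, 'n, 'k::field) free_complex \<Rightarrow> ('d, 'n, 'k) free_complex \<Rightarrow>
    (nat \<Rightarrow> ('n, 'k) mpoly mat) \<Rightarrow> bool"
where
  "chain_map wt G A \<phi> \<longleftrightarrow>
     (\<forall>i. homogeneous_mat wt (shifts A i) (shifts G i) (\<phi> i)) \<and>
     (\<forall>i. bd A i * \<phi> (Suc i) = \<phi> i * bd G i)"

definition direct_sum ::
  "('d, 'n, 'k::field) free_complex \<Rightarrow> ('d, 'n, 'k) free_complex \<Rightarrow> ('d, 'n, 'k) free_complex"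
where
  "direct_sum F H =
     \<lparr>shifts = \<lambda>i. shifts F i @ shifts H i,
      aug = diag_block_mat [aug F, aug H],
      bd = \<lambda>i. diag_block_mat [bd F i, bd H i]\<rparr>"

text \<open>The mapping cone of \<open>\<phi> : G \<rightarrow> A\<close>, with \<open>A\<^sub>i \<oplus> G\<^sub>i\<^sub>-\<^sub>1\<close> in homological degree \<open>i\<close>, differential
  \<open>(x, y) \<mapsto> (bd x + \<phi> y, - bd y)\<close> and augmentation \<open>\<epsilon>\<close>.\<close>

definition mapping_cone ::
  "('n, 'k::field) mpoly mat \<Rightarrow> ('d, 'n, 'k) free_complex \<Rightarrow> ('d, 'n, 'k) free_complex \<Rightarrow>
    (nat \<Rightarrow> ('n, 'k) mpoly mat) \<Rightarrow> ('d, 'n, 'k) free_complex"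
where
  "mapping_cone \<epsilon> G A \<phi> =
     \<lparr>shifts = \<lambda>i. shifts A i @ (case i of 0 \<Rightarrow> [] | Suc j \<Rightarrow> shifts G j),
      aug = \<epsilon>,
      bd = \<lambda>i. case i of
          0 \<Rightarrow> four_block_mat (bd A 0) (\<phi> 0) (0\<^sub>m 0 (frank A 1)) (0\<^sub>m 0 (frank G 0))
        | Suc j \<Rightarrow> four_block_mat (bd A i) (\<phi> i) (0\<^sub>m (frank G j) (frank A (Suc i))) (- bd G j)\<rparr>"

definition principal_resolution ::
  "('n \<Rightarrow>\<^sub>0 nat) \<Rightarrow> ('n \<Rightarrow>\<^sub>0 nat, 'n, 'k::field) free_complex"
where
  "principal_resolution g =
     \<lparr>shifts = \<lambda>i. if i = 0 then [g] else [],
      aug = mat 1 1 (\<lambda>_. monomial g),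
      bd = \<lambda>i. 0\<^sub>m (if i = 0 then 1 else 0) 0\<rparr>"

definition minimal_monomial_generators ::
  "('n, 'k::field) mpoly set \<Rightarrow> ('n \<Rightarrow>\<^sub>0 nat) list \<Rightarrow> bool"
where
  "minimal_monomial_generators I gs \<longleftrightarrow>
     distinct gs \<and> ideal_gen (monomial ` set gs) = I \<and>
     (\<forall>g\<in>set gs. (monomial g :: ('n, 'k) mpoly) \<notin> ideal_gen (monomial ` (set gs - {g})))"

text \<open>In the exact sequence \<open>0 \<rightarrow> I' \<inter> \<langle>g\<rangle> \<rightarrow> I' \<oplus> \<langle>g\<rangle> \<rightarrow> I \<rightarrow> 0\<close> the maps are \<open>x \<mapsto> (x, -x)\<close> and
  \<open>(x, y) \<mapsto> x + y\<close>, given on the augmentations by the column \<open>(1, -1)\<close> and the row \<open>(1, 1)\<close>.\<close>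

inductive iterated_mapping_cone ::
  "('n, 'k::field) mpoly set \<Rightarrow> ('n \<Rightarrow>\<^sub>0 nat, 'n, 'k) free_complex \<Rightarrow> bool"
where
  principal: "iterated_mapping_cone (ideal_gen {monomial g}) (principal_resolution g)"
| cone: "iterated_mapping_cone I (mapping_cone (mat_of_rows_list 2 [[1, 1]] * aug A) G A \<phi>)"
  if "gs \<noteq> []" and "minimal_monomial_generators I (gs @ [g])"
    and "I' = ideal_gen (monomial ` set gs)"
    and "iterated_mapping_cone I' F"
    and "iterated_mapping_cone (I' \<inter> ideal_gen {monomial g}) G"
    and "A = direct_sum F (principal_resolution g)"
    and "chain_map (\<lambda>a. a) G A \<phi>"
    and "aug A * \<phi> 0 = mat_of_rows_list 1 [[1], [- 1]] * aug G"

subsection \<open>The ideals \<open>J\<^sub>n\<^sub>,\<^sub>m\<close>\<close>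

text \<open>\<open>v\<close> enumerates the variables, so that \<open>y\<^sub>i\<close> is \<open>variable (v i)\<close> for \<open>1 \<le> i \<le> n\<close>.\<close>

definition J :: "(nat \<Rightarrow> 'n) \<Rightarrow> nat \<Rightarrow> nat \<Rightarrow> ('n, 'k::field) mpoly set" where
  "J v n m = ideal_gen
     ({variable (v i) ^ m | i. i \<in> {1..n}} \<union>
      {variable (v 1) ^ (m - a) * variable (v j) ^ a | a j. a \<in> {1..m - 1} \<and> j \<in> {2..n}})"

end

theory Submission
  imports Defs "Jordan_Normal_Form.Determinant"
begin

text \<open>Write \<open>y\<^sub>1, \<dots>, y\<^sub>n\<close> for the variables and add the generators \<open>y\<^sub>1\<^sup>m\<close> and then
  \<open>g = y\<^sub>1\<^sup>m\<^sup>-\<^sup>a y\<^sub>t\<^sup>a\<close> for \<open>a = 1, \<dots>, m\<close> and, within each \<open>a\<close>, for \<open>t = 2, \<dots>, n\<close>.  The colon ideal of the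
  preceding generators by \<open>g\<close> is the complete intersection of \<open>y\<^sub>1\<close> and the \<open>y\<^sub>j\<^sup>a\<close> with \<open>2 \<le> j < t\<close>, which
  has a Koszul resolution, itself an iterated mapping cone.  All multidegrees obtained before \<open>g\<close> have
  \<open>y\<^sub>t\<close>-exponent less than \<open>a\<close>, those of the resolution of \<open>I' \<inter> \<langle>g\<rangle>\<close> have exponent exactly \<open>a\<close>, so the
  comparison map has no constant entries and the cone is minimal.  Hence
  \<open>\<beta>\<^sub>i\<close> is \<open>m\<close> times the sum of the \<open>(t - 1) choose i\<close> over \<open>2 \<le> t \<le> n\<close>, with \<open>1\<close> added for \<open>i = 0\<close>.
  Betti numbers do not depend on the minimal resolution, and no resolution is shorter: the composite of
  comparison maps \<open>F \<rightarrow> F' \<rightarrow> F\<close> is homotopic to the identity, hence is the identity modulo the maximal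
  ideal if \<open>F\<close> is minimal.\<close>

text \<open>The colon ideals have this shape because an earlier generator with smaller exponent
  \<open>a\<close>, or y_1^m, contains more y_1 than \<open>g\<close> does, so it contributes a
  multiple of y_1; the element y_1 itself comes from y_1^(m-a+1) y_t^(a-1), and y_j^a comes from the
  generator with y_j in the same layer. Since these are powers of distinct variables, the
  multidegrees added by a cone are \<open>g\<close> times products over subsets of the colon
  generators, so ranks are binomial coefficients and regularity is the maximum of an explicit sum.
  Exhibiting one minimal resolution does not yet evaluate the invariants: \<open>betti\<close> and
  \<open>graded_betti\<close> are definite descriptions over all minimal resolutions, and
  \<open>projdim\<close> is a minimum over all resolutions. The comparison theorem is therefore an
  inequality between multiplicities of degrees, against an arbitrary resolution, and is proved for
  modules N/D so as to cover both the ideal and its quotient ring. Disjointness of degrees is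
  checked in the fine grading, on the exponent of one variable; only the finished resolution is
  passed to total degree.\<close>

subsection \<open>Monomials and monomial ideals\<close>

text \<open>\<open>ideal_gen\<close> unfolds to a span in the ring as a module over itself; this
  instance supplies the span and subspace facts for ideals.\<close>

interpretation ring_as_module: Modules.module "(*) :: 'a::comm_ring_1 \<Rightarrow> 'a \<Rightarrow> 'a"
  by standard (simp_all add: algebra_simps)

definition mdvd :: "('n \<Rightarrow>\<^sub>0 nat) \<Rightarrow> ('n \<Rightarrow>\<^sub>0 nat) \<Rightarrow> bool" where
  "mdvd s a \<longleftrightarrow> (\<forall>x. Poly_Mapping.lookup s x \<le> Poly_Mapping.lookup a x)"

lemma mdvd_iff: "mdvd s a \<longleftrightarrow> (\<exists>t. a = s + t)"
proof
  assume "mdvd s a"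
  then have "a = s + (a - s)"
    by (intro poly_mapping_eqI) (simp add: mdvd_def lookup_add lookup_minus)
  then show "\<exists>t. a = s + t" by blast
qed (auto simp: mdvd_def lookup_add)

lemma mdvd_refl [simp]: "mdvd a a"
  by (simp add: mdvd_def)

lemma keys_monomial [simp]: "Poly_Mapping.keys (monomial a :: ('n, 'k::field) mpoly) = {a}"
  by (simp add: monomial_def)

lemma mpoly_sum_terms:
  "p = (\<Sum>a\<in>Poly_Mapping.keys p. Poly_Mapping.single a (Poly_Mapping.lookup p a))"
  by (rule poly_mapping_eqI)
    (auto simp: lookup_sum lookup_single when_def in_keys_iff if_distrib cong: if_cong)

text \<open>Multiples of a monomial only have terms divisible by it, and this condition passes to
  sums; conversely p is the sum of its terms. Intersections, minimality of generators and closure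
  under taking parts thereby become statements about exponents.\<close>

lemma ideal_gen_monomials:
  "p \<in> ideal_gen (monomial ` S) \<longleftrightarrow> (\<forall>a\<in>Poly_Mapping.keys p. \<exists>s\<in>S. mdvd s a)"
  (is "_ \<longleftrightarrow> ?P p")
proof
  assume "p \<in> ideal_gen (monomial ` S)"
  then show "?P p"
    unfolding ideal_gen_def
  proof (induction rule: ring_as_module.span_induct_alt)
    case base
    show ?case by simp
  next
    case (step c x y)
    then obtain s where s: "s \<in> S" and x: "x = monomial s" by auto
    have "\<exists>s\<in>S. mdvd s a" if "a \<in> Poly_Mapping.keys (c * x + y)" for a
    proof -
      from that consider "a \<in> Poly_Mapping.keys (c * x)" | "a \<in> Poly_Mapping.keys y"
        using Poly_Mapping.keys_add[of "c * x" y] by blast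
      then show ?thesis
      proof cases
        case 1
        then obtain b d where "a = b + d" "d \<in> Poly_Mapping.keys x"
          using keys_mult by blast
        then show ?thesis
          using s x mdvd_iff by (metis add.commute keys_monomial singletonD)
      qed (use step.IH in blast)
    qed
    then show ?case by blast
  qed
next
  assume P: "?P p"
  have "(\<Sum>a\<in>Poly_Mapping.keys p. Poly_Mapping.single a (Poly_Mapping.lookup p a))
      \<in> ideal_gen (monomial ` S)"
    unfolding ideal_gen_def
  proof (rule ring_as_module.span_sum)
    fix a assume "a \<in> Poly_Mapping.keys p"
    then obtain s t where s: "s \<in> S" "a = s + t" using P mdvd_iff by blast
    have "Poly_Mapping.single t (Poly_Mapping.lookup p a) * monomial s
        \<in> ring_as_module.span (monomial ` S)"
      using s by (intro ring_as_module.span_scale ring_as_module.span_base) auto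
    then show "Poly_Mapping.single a (Poly_Mapping.lookup p a) \<in> ring_as_module.span (monomial ` S)"
      using s by (simp add: monomial_def mult_single add.commute)
  qed
  then show "p \<in> ideal_gen (monomial ` S)"
    using mpoly_sum_terms[of p] by simp
qed

lemma ideal_gen_mult: "q \<in> ideal_gen B \<Longrightarrow> p * q \<in> ideal_gen B"
  unfolding ideal_gen_def by (rule ring_as_module.span_scale)

lemma ideal_gen_zero: "0 \<in> ideal_gen B"
  unfolding ideal_gen_def by (rule ring_as_module.span_zero)

text \<open>The hypothesis is a colon computation on exponents: later \<open>T\<close> is
  \<open>g\<close> times a generating set of the colon ideal by \<open>g\<close>.\<close>

lemma ideal_gen_monomial_Int:
  assumes "\<And>a. (\<exists>s\<in>S. mdvd s a) \<and> mdvd g a \<longleftrightarrow> (\<exists>s\<in>T. mdvd s a)"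
  shows "ideal_gen (monomial ` S) \<inter> ideal_gen {monomial g}
    = (ideal_gen (monomial ` T) :: ('n, 'k::field) mpoly set)"
proof -
  have "p \<in> ideal_gen (monomial ` S) \<inter> ideal_gen {monomial g} \<longleftrightarrow> p \<in> ideal_gen (monomial ` T)"
    for p :: "('n, 'k) mpoly"
    using assms by (simp add: ideal_gen_monomials ideal_gen_monomials[of p "{g}", simplified]) blast
  then show ?thesis by blast
qed

section \<open>Constant terms, multiplication by monomials, and the maximal ideal\<close>

lemma add_eq_0_iff_exponent: "a + b = 0 \<longleftrightarrow> a = 0 \<and> b = (0 :: 'n \<Rightarrow>\<^sub>0 nat)"
  by (auto simp: poly_mapping_eq_iff fun_eq_iff lookup_add)

text \<open>Taking constant terms is reduction modulo the maximal ideal; it is multiplicative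
  because 0 splits only as 0 + 0 among exponent vectors.\<close>

lemma lookup_mult_0:
  fixes p q :: "('n, 'k::field) mpoly"
  shows "Poly_Mapping.lookup (p * q) 0 = Poly_Mapping.lookup p 0 * Poly_Mapping.lookup q 0"
proof -
  have "(Poly_Mapping.lookup q r when 0 = l + r) = ((Poly_Mapping.lookup q r when r = 0) when l = 0)"
    for l r :: "'n \<Rightarrow>\<^sub>0 nat"
    using add_eq_0_iff_exponent[of l r] by (auto simp: when_def)
  then have "Poly_Mapping.lookup (p * q) 0
      = (\<Sum>l. Poly_Mapping.lookup p l * (\<Sum>r. (Poly_Mapping.lookup q r when r = 0) when l = 0))"
    by (simp only: lookup_mult)
  also have "\<dots> = (\<Sum>l. (Poly_Mapping.lookup p l * Poly_Mapping.lookup q 0) when l = 0)"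
    by (rule Sum_any.cong) (simp add: when_def)
  finally show ?thesis by simp
qed

lemma lookup_monomial_mult:
  fixes p :: "('n, 'k::field) mpoly"
  shows "Poly_Mapping.lookup (monomial g * p) (g + a) = Poly_Mapping.lookup p a"
proof -
  have "Poly_Mapping.lookup (monomial g * p) (g + a)
      = (\<Sum>l. (\<Sum>r. Poly_Mapping.lookup p r when g + a = l + r) when l = g)"
    unfolding lookup_mult
    by (rule Sum_any.cong) (auto simp: monomial_def lookup_single when_def)
  then show ?thesis by simp
qed

text \<open>Multiplication by a monomial merely translates exponents. This injectivity is the
  exactness of the resolution of a principal ideal.\<close>

lemma monomial_mult_eq_0_iff:
  "monomial g * p = 0 \<longleftrightarrow> p = (0 :: ('n, 'k::field) mpoly)"
  by (metis lookup_monomial_mult lookup_zero mult_zero_right poly_mapping_eqI)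

text \<open>A monomial is divisible by some variable exactly when its exponent vector is
  nonzero.\<close>

lemma max_homogeneous_ideal_iff:
  fixes p :: "('n, 'k::field) mpoly"
  shows "p \<in> max_homogeneous_ideal \<longleftrightarrow> Poly_Mapping.lookup p 0 = 0"
proof -
  have *: "(\<exists>s\<in>range (\<lambda>x. Poly_Mapping.single x (1::nat)). mdvd s a) \<longleftrightarrow> a \<noteq> 0"
    for a :: "'n \<Rightarrow>\<^sub>0 nat"
  proof -
    have "(\<exists>s\<in>range (\<lambda>x. Poly_Mapping.single x (1::nat)). mdvd s a)
        \<longleftrightarrow> (\<exists>x. Poly_Mapping.lookup a x \<ge> 1)"
      by (auto simp: mdvd_def lookup_single when_def Ball_def split: if_splits)
    also have "\<dots> \<longleftrightarrow> a \<noteq> 0"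
      by (auto simp: poly_mapping_eq_iff fun_eq_iff Suc_le_eq)
    finally show ?thesis .
  qed
  have "p \<in> max_homogeneous_ideal
      \<longleftrightarrow> p \<in> ideal_gen (monomial ` range (\<lambda>x. Poly_Mapping.single x 1))"
    unfolding max_homogeneous_ideal_def variable_def image_image ..
  also have "\<dots> \<longleftrightarrow> (\<forall>a\<in>Poly_Mapping.keys p. a \<noteq> 0)"
    unfolding ideal_gen_monomials * ..
  finally show ?thesis
    by (auto simp: in_keys_iff)
qed

subsection \<open>Homogeneous parts\<close>

text \<open>With \<open>P\<close> the condition of having a prescribed degree this is a homogeneous
  component. An arbitrary \<open>P\<close> serves both gradings and degrees shifted by a basis
  element.\<close>

definition restrict_keys :: "('a \<Rightarrow> bool) \<Rightarrow> ('a \<Rightarrow>\<^sub>0 'b::zero) \<Rightarrow> ('a \<Rightarrow>\<^sub>0 'b)" where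
  "restrict_keys P p = Abs_poly_mapping (\<lambda>a. Poly_Mapping.lookup p a when P a)"

lemma lookup_restrict_keys:
  "Poly_Mapping.lookup (restrict_keys P p) a = (Poly_Mapping.lookup p a when P a)"
proof -
  have "finite {a. (Poly_Mapping.lookup p a when P a) \<noteq> 0}"
    by (rule finite_subset[OF _ finite_lookup[of p]]) auto
  then show ?thesis
    unfolding restrict_keys_def by simp
qed

lemma keys_restrict_keys: "Poly_Mapping.keys (restrict_keys P p) = {a \<in> Poly_Mapping.keys p. P a}"
  by (auto simp: in_keys_iff lookup_restrict_keys)

lemma restrict_keys_id: "(\<And>a. a \<in> Poly_Mapping.keys p \<Longrightarrow> P a) \<Longrightarrow> restrict_keys P p = p"
  by (rule poly_mapping_eqI) (auto simp: lookup_restrict_keys when_def in_keys_iff)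

lemma restrict_keys_add: "restrict_keys P (p + q) = restrict_keys P p + restrict_keys P q"
  by (rule poly_mapping_eqI) (simp add: lookup_restrict_keys lookup_add when_def)

lemma restrict_keys_sum: "restrict_keys P (sum f A) = (\<Sum>i\<in>A. restrict_keys P (f i))"
  by (rule poly_mapping_eqI) (simp add: lookup_restrict_keys lookup_sum when_def)

text \<open>For homogeneous p, cutting the product to one degree cuts q to the difference of
  degrees. Degrees live in a monoid without subtraction, so the difference is expressed by the pair
  of predicates \<open>P\<close> and \<open>Q\<close>.\<close>

lemma restrict_keys_mult:
  fixes p q :: "('n, 'k::field) mpoly"
  assumes "\<And>a b. a \<in> Poly_Mapping.keys p \<Longrightarrow> P (a + b) \<longleftrightarrow> Q b"
  shows "restrict_keys P (p * q) = p * restrict_keys Q q"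
proof (rule poly_mapping_eqI)
  fix k
  have "Poly_Mapping.lookup (p * restrict_keys Q q) k
      = (\<Sum>l. (Poly_Mapping.lookup p l * (\<Sum>r. Poly_Mapping.lookup q r when k = l + r)) when P k)"
    unfolding lookup_mult
  proof (rule Sum_any.cong)
    fix l
    show "Poly_Mapping.lookup p l * (\<Sum>r. Poly_Mapping.lookup (restrict_keys Q q) r when k = l + r)
      = (Poly_Mapping.lookup p l * (\<Sum>r. Poly_Mapping.lookup q r when k = l + r) when P k)"
    proof (cases "l \<in> Poly_Mapping.keys p")
      case True
      then have *: "(Poly_Mapping.lookup (restrict_keys Q q) r when k = l + r)
          = ((Poly_Mapping.lookup q r when k = l + r) when P k)" for r
        using assms[OF True] by (auto simp: lookup_restrict_keys when_def)
      show ?thesis by (cases "P k") (simp_all add: *)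
    qed (simp add: in_keys_iff)
  qed
  also have "\<dots> = (Poly_Mapping.lookup (p * q) k when P k)"
    unfolding lookup_mult by (cases "P k") simp_all
  finally show "Poly_Mapping.lookup (restrict_keys P (p * q)) k
      = Poly_Mapping.lookup (p * restrict_keys Q q) k"
    by (simp add: lookup_restrict_keys)
qed

lemma restrict_keys_zero [simp]: "restrict_keys P 0 = 0"
  by (rule restrict_keys_id) simp

subsection \<open>Lifting along homogeneous maps\<close>

text \<open>The degree-preserving component of a map of graded free modules.\<close>

definition hom_mat ::
  "(('n \<Rightarrow>\<^sub>0 nat) \<Rightarrow> 'd::monoid_add) \<Rightarrow> 'd list \<Rightarrow> 'd list \<Rightarrow> ('n, 'k::field) mpoly mat \<Rightarrow> ('n, 'k) mpoly mat"
where
  "hom_mat wt rs cs X =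
     mat (length rs) (length cs) (\<lambda>(p, q). restrict_keys (\<lambda>a. rs ! p + wt a = cs ! q) (X $$ (p, q)))"

lemma homogeneous_hom_mat: "homogeneous_mat wt rs cs (hom_mat wt rs cs X)"
  by (auto simp: homogeneous_mat_def hom_mat_def keys_restrict_keys)

lemma hom_mat_id: "homogeneous_mat wt rs cs X \<Longrightarrow> hom_mat wt rs cs X = X"
  by (rule eq_matI) (auto simp: homogeneous_mat_def hom_mat_def intro!: restrict_keys_id)

lemma homogeneous_mat_carrier:
  "homogeneous_mat wt rs cs A \<Longrightarrow> A \<in> carrier_mat (length rs) (length cs)"
  by (simp add: homogeneous_mat_def)

lemma index_mat_mult_sum:
  "A \<in> carrier_mat r s \<Longrightarrow> X \<in> carrier_mat s t \<Longrightarrow> p < r \<Longrightarrow> q < t \<Longrightarrow>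
    (A * X) $$ (p, q) = (\<Sum>k<s. A $$ (p, k) * X $$ (k, q))"
  by (simp add: scalar_prod_def lessThan_atLeast0)

lemma index_mat_vec_sum:
  "A \<in> carrier_mat r s \<Longrightarrow> w \<in> carrier_vec s \<Longrightarrow> p < r \<Longrightarrow>
    (A *\<^sub>v w) $ p = (\<Sum>k<s. A $$ (p, k) * w $ k)"
  by (simp add: scalar_prod_def lessThan_atLeast0)

lemma mult_mat_vec_unit_vec:
  fixes A :: "'a::comm_ring_1 mat"
  assumes "A \<in> carrier_mat r s" and "q < s"
  shows "A *\<^sub>v unit_vec s q = col A q"
proof (rule eq_vecI)
  fix i assume "i < dim_vec (col A q)"
  then have "(\<Sum>k<s. A $$ (i, k) * unit_vec s q $ k) = (\<Sum>k<s. if k = q then A $$ (i, k) else 0)"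
    using assms by (intro sum.cong) auto
  then show "(A *\<^sub>v unit_vec s q) $ i = col A q $ i"
    using assms \<open>i < _\<close> by (simp add: index_mat_vec_sum[of A "dim_row A" s] del: index_mult_mat_vec)
qed (use assms in auto)

lemma mult_mat_vec_zero [simp]:
  "(A :: 'a::comm_ring_1 mat) \<in> carrier_mat r s \<Longrightarrow> A *\<^sub>v 0\<^sub>v s = 0\<^sub>v r"
  by (intro eq_vecI) auto

lemma minus_zero_mat [simp]:
  "(A :: 'a::comm_ring_1 mat) \<in> carrier_mat r s \<Longrightarrow> A - 0\<^sub>m r s = A"
  by (intro eq_matI) auto

text \<open>Consequently a solution X of A X = B with A and B homogeneous may be replaced by its
  degree-preserving component.\<close>

lemma hom_mat_mult:
  fixes A X :: "('n, 'k::field) mpoly mat"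
  assumes wt: "\<And>a b. wt (a + b) = wt a + wt b"
    and A: "homogeneous_mat wt rs ms A" and X: "X \<in> carrier_mat (length ms) (length cs)"
  shows "hom_mat wt rs cs (A * X) = A * hom_mat wt ms cs X"
proof (rule eq_matI)
  have cA: "A \<in> carrier_mat (length rs) (length ms)" using A by (rule homogeneous_mat_carrier)
  have cX: "hom_mat wt ms cs X \<in> carrier_mat (length ms) (length cs)"
    by (simp add: hom_mat_def)
  fix p q assume "p < dim_row (A * hom_mat wt ms cs X)" "q < dim_col (A * hom_mat wt ms cs X)"
  then have p: "p < length rs" and q: "q < length cs" using cA cX by auto
  have "restrict_keys (\<lambda>a. rs ! p + wt a = cs ! q) (A $$ (p, k) * X $$ (k, q))
      = A $$ (p, k) * hom_mat wt ms cs X $$ (k, q)" if k: "k < length ms" for k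
  proof -
    have "rs ! p + wt (a + b) = cs ! q \<longleftrightarrow> ms ! k + wt b = cs ! q"
      if "a \<in> Poly_Mapping.keys (A $$ (p, k))" for a b
      using A p k that by (simp add: homogeneous_mat_def wt add.assoc[symmetric])
    then show ?thesis
      using q k by (simp add: hom_mat_def restrict_keys_mult)
  qed
  then show "hom_mat wt rs cs (A * X) $$ (p, q) = (A * hom_mat wt ms cs X) $$ (p, q)"
    using p q by (simp add: index_mat_mult_sum[OF cA cX] index_mat_mult_sum[OF cA X]
        hom_mat_def[of wt rs] restrict_keys_sum del: index_mult_mat)
qed (use A in \<open>auto simp: hom_mat_def homogeneous_mat_def\<close>)

lemma homogeneous_mat_mult:
  assumes "\<And>a b. wt (a + b) = wt a + wt b"
    and "homogeneous_mat wt rs ms A" and "homogeneous_mat wt ms cs X"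
  shows "homogeneous_mat wt rs cs (A * X)"
  using hom_mat_mult[OF assms(1,2) homogeneous_mat_carrier[OF assms(3)]]
    homogeneous_hom_mat[of wt rs cs "A * X"] by (simp add: hom_mat_id[OF assms(3)])

text \<open>\<open>D\<close> is \<open>{0}\<close> or the ideal of relations of a quotient ring.\<close>

lemma mat_lift:
  fixes A B :: "('n, 'k::field) mpoly mat"
  assumes A: "A \<in> carrier_mat r s"
    and w: "\<And>q. q < t \<Longrightarrow> \<exists>w\<in>carrier_vec s. \<forall>p<r. B $$ (p, q) - (A *\<^sub>v w) $ p \<in> D"
  shows "\<exists>X\<in>carrier_mat s t. \<forall>p<r. \<forall>q<t. B $$ (p, q) - (A * X) $$ (p, q) \<in> D"
proof -
  obtain w where w: "\<And>q. q < t \<Longrightarrow> w q \<in> carrier_vec s \<and> (\<forall>p<r. B $$ (p, q) - (A *\<^sub>v w q) $ p \<in> D)"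
    using choice[of "\<lambda>q w. q < t \<longrightarrow> w \<in> carrier_vec s \<and> (\<forall>p<r. B $$ (p, q) - (A *\<^sub>v w) $ p \<in> D)"] w
    by blast
  define X where "X = mat s t (\<lambda>(k, q). w q $ k)"
  have X: "X \<in> carrier_mat s t" by (simp add: X_def)
  have "(A * X) $$ (p, q) = (A *\<^sub>v w q) $ p" if "p < r" "q < t" for p q
  proof -
    have "(A * X) $$ (p, q) = (\<Sum>k<s. A $$ (p, k) * w q $ k)"
      unfolding index_mat_mult_sum[OF A X that] using that by (simp add: X_def)
    then show ?thesis
      using that w[of q] by (simp add: index_mat_vec_sum[OF A] del: index_mult_mat_vec)
  qed
  then show ?thesis using w by (intro bexI[OF _ X]) (simp del: index_mult_mat(1))
qed

text \<open>Lifting column by column ignores degrees. Cutting the resulting matrix down to its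
  degree-preserving component afterwards keeps the congruence, since \<open>D\<close> is closed
  under taking parts.\<close>

lemma homogeneous_lift:
  fixes A B :: "('n, 'k::field) mpoly mat"
  assumes wt: "\<And>a b. wt (a + b) = wt a + wt b"
    and A: "homogeneous_mat wt rs ms A" and B: "homogeneous_mat wt rs cs B"
    and D: "\<And>P d. d \<in> D \<Longrightarrow> restrict_keys P d \<in> D"
    and w: "\<And>q. q < length cs \<Longrightarrow>
      \<exists>w\<in>carrier_vec (length ms). \<forall>p<length rs. B $$ (p, q) - (A *\<^sub>v w) $ p \<in> D"
  shows "\<exists>X. homogeneous_mat wt ms cs X \<and>
    (\<forall>p<length rs. \<forall>q<length cs. B $$ (p, q) - (A * X) $$ (p, q) \<in> D)"
proof -
  have cA: "A \<in> carrier_mat (length rs) (length ms)" using A by (rule homogeneous_mat_carrier)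
  obtain X where X: "X \<in> carrier_mat (length ms) (length cs)"
    and D': "\<forall>p<length rs. \<forall>q<length cs. B $$ (p, q) - (A * X) $$ (p, q) \<in> D"
    using mat_lift[OF cA w] by blast
  have "B $$ (p, q) - (A * hom_mat wt ms cs X) $$ (p, q) \<in> D"
    if p: "p < length rs" and q: "q < length cs" for p q
  proof -
    define P where "P = (\<lambda>a. rs ! p + wt a = cs ! q)"
    have "restrict_keys P (B $$ (p, q) - (A * X) $$ (p, q)) + restrict_keys P ((A * X) $$ (p, q))
        = restrict_keys P (B $$ (p, q))"
      by (simp add: restrict_keys_add[symmetric])
    moreover have "restrict_keys P (B $$ (p, q)) = B $$ (p, q)"
      using B p q by (intro restrict_keys_id) (auto simp: homogeneous_mat_def P_def)
    moreover have "restrict_keys P ((A * X) $$ (p, q)) = (A * hom_mat wt ms cs X) $$ (p, q)"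
      unfolding hom_mat_mult[OF wt A X, symmetric] using p q by (simp add: hom_mat_def P_def)
    ultimately have "B $$ (p, q) - (A * hom_mat wt ms cs X) $$ (p, q)
        = restrict_keys P (B $$ (p, q) - (A * X) $$ (p, q))"
      by (metis add_diff_cancel_right')
    then show ?thesis using D D' p q by simp
  qed
  then show ?thesis using homogeneous_hom_mat by blast
qed

lemma homogeneous_lift_eq:
  fixes A B :: "('n, 'k::field) mpoly mat"
  assumes wt: "\<And>a b. wt (a + b) = wt a + wt b"
    and A: "homogeneous_mat wt rs ms A" and B: "homogeneous_mat wt rs cs B"
    and w: "\<And>q. q < length cs \<Longrightarrow> \<exists>w\<in>carrier_vec (length ms). col B q = A *\<^sub>v w"
  shows "\<exists>X. homogeneous_mat wt ms cs X \<and> A * X = B"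
proof -
  have cA: "A \<in> carrier_mat (length rs) (length ms)" and cB: "B \<in> carrier_mat (length rs) (length cs)"
    using A B by (auto simp: homogeneous_mat_carrier)
  have "\<exists>w\<in>carrier_vec (length ms). \<forall>p<length rs. B $$ (p, q) - (A *\<^sub>v w) $ p \<in> {0}"
    if "q < length cs" for q
  proof -
    obtain w where w: "w \<in> carrier_vec (length ms)" "col B q = A *\<^sub>v w" using w \<open>q < _\<close> by blast
    have "B $$ (p, q) = (A *\<^sub>v w) $ p" if "p < length rs" for p
      unfolding w(2)[symmetric] using cB that \<open>q < _\<close> by simp
    then show ?thesis using w(1) by force
  qed
  then have "\<exists>X. homogeneous_mat wt ms cs X \<and>
      (\<forall>p<length rs. \<forall>q<length cs. B $$ (p, q) - (A * X) $$ (p, q) \<in> {0})"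
    by (intro homogeneous_lift[OF wt A B]) simp_all
  then obtain X where X: "homogeneous_mat wt ms cs X"
    and eq: "\<And>p q. p < length rs \<Longrightarrow> q < length cs \<Longrightarrow> B $$ (p, q) = (A * X) $$ (p, q)"
    by (metis (no_types, lifting) right_minus_eq singletonD)
  have "A * X = B"
    by (rule eq_matI)
      (use eq cA cB homogeneous_mat_carrier[OF X] in \<open>auto simp del: index_mult_mat(1)\<close>)
  with X show ?thesis by blast
qed

subsection \<open>Exact complexes and chain maps\<close>

text \<open>These are the clauses of \<open>graded_free_resolution\<close> that do not mention the
  augmentation. The direct sum inside a cone has an augmentation with two rows, so what happens
  there in degree 0 has to be stated separately.\<close>

definition exact_complex ::
  "(('n \<Rightarrow>\<^sub>0 nat) \<Rightarrow> 'd::monoid_add) \<Rightarrow> ('d, 'n, 'k::field) free_complex \<Rightarrow> bool"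
where
  "exact_complex wt F \<longleftrightarrow>
     (\<forall>i. homogeneous_mat wt (shifts F i) (shifts F (Suc i)) (bd F i)) \<and>
     (\<forall>i. {v \<in> carrier_vec (frank F (Suc i)). bd F i *\<^sub>v v = 0\<^sub>v (frank F i)}
       = {bd F (Suc i) *\<^sub>v w | w. w \<in> carrier_vec (frank F (Suc (Suc i)))})"

lemma exact_complexD:
  assumes "exact_complex wt F"
  shows "homogeneous_mat wt (shifts F i) (shifts F (Suc i)) (bd F i)"
    and "bd F i \<in> carrier_mat (frank F i) (frank F (Suc i))"
    and "w \<in> carrier_vec (frank F (Suc (Suc i))) \<Longrightarrow> bd F i *\<^sub>v (bd F (Suc i) *\<^sub>v w) = 0\<^sub>v (frank F i)"
    and "v \<in> carrier_vec (frank F (Suc i)) \<Longrightarrow> bd F i *\<^sub>v v = 0\<^sub>v (frank F i) \<Longrightarrow>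
      \<exists>w\<in>carrier_vec (frank F (Suc (Suc i))). v = bd F (Suc i) *\<^sub>v w"
    and "bd F i * bd F (Suc i) = 0\<^sub>m (frank F i) (frank F (Suc (Suc i)))"
proof -
  show 1: "homogeneous_mat wt (shifts F i) (shifts F (Suc i)) (bd F i)" for i
    using assms by (simp add: exact_complex_def)
  show 2: "bd F i \<in> carrier_mat (frank F i) (frank F (Suc i))" for i
    unfolding frank_def using 1 by (rule homogeneous_mat_carrier)
  show 3: "bd F i *\<^sub>v (bd F (Suc i) *\<^sub>v w) = 0\<^sub>v (frank F i)"
    if "w \<in> carrier_vec (frank F (Suc (Suc i)))" for w
    using assms that unfolding exact_complex_def by blast
  show "\<exists>w\<in>carrier_vec (frank F (Suc (Suc i))). v = bd F (Suc i) *\<^sub>v w"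
    if "v \<in> carrier_vec (frank F (Suc i))" "bd F i *\<^sub>v v = 0\<^sub>v (frank F i)"
    using assms that unfolding exact_complex_def by blast
  show "bd F i * bd F (Suc i) = 0\<^sub>m (frank F i) (frank F (Suc (Suc i)))"
  proof (rule eq_matI)
    fix p q assume "p < dim_row (0\<^sub>m (frank F i) (frank F (Suc (Suc i))) :: ('a, 'c) mpoly mat)"
      and "q < dim_col (0\<^sub>m (frank F i) (frank F (Suc (Suc i))) :: ('a, 'c) mpoly mat)"
    then have pq: "p < frank F i" "q < frank F (Suc (Suc i))" by auto
    have "bd F (Suc i) *\<^sub>v unit_vec (frank F (Suc (Suc i))) q = col (bd F (Suc i)) q"
      using 2[of "Suc i"] pq by (intro eq_vecI) auto
    then have "(bd F i *\<^sub>v col (bd F (Suc i)) q) $ p = 0"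
      using 3[of "unit_vec (frank F (Suc (Suc i))) q"] pq by simp
    then show "(bd F i * bd F (Suc i)) $$ (p, q) = 0\<^sub>m (frank F i) (frank F (Suc (Suc i))) $$ (p, q)"
      using 2[of i] 2[of "Suc i"] pq by simp
  qed (use 2[of i] 2[of "Suc i"] in auto)
qed

text \<open>The inductive half of the comparison theorem: once boundaries go to boundaries in degree
  0, freeness of \<open>G\<close> and exactness of \<open>A\<close> produce each further
  component.\<close>

lemma chain_map_extend:
  fixes G A :: "('d::monoid_add, 'n, 'k::field) free_complex"
  assumes wt: "\<And>a b. wt (a + b) = wt a + wt b"
    and G: "exact_complex wt G" and A: "exact_complex wt A"
    and \<phi>0: "homogeneous_mat wt (shifts A 0) (shifts G 0) \<phi>0"
    and im: "\<And>w. w \<in> carrier_vec (frank G 1) \<Longrightarrow>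
      \<exists>u\<in>carrier_vec (frank A 1). \<phi>0 *\<^sub>v (bd G 0 *\<^sub>v w) = bd A 0 *\<^sub>v u"
  shows "\<exists>\<phi>. \<phi> 0 = \<phi>0 \<and> chain_map wt G A \<phi>"
proof -
  \<comment> \<open>The invariant records that \<open>f\<close> sends boundaries to boundaries,
    which is what the next lift needs; its first clause pins the starting map.\<close>
  define P where "P i f \<longleftrightarrow> (i = 0 \<longrightarrow> f = \<phi>0) \<and> homogeneous_mat wt (shifts A i) (shifts G i) f \<and>
    (\<forall>w\<in>carrier_vec (frank G (Suc i)). \<exists>u\<in>carrier_vec (frank A (Suc i)).
      f *\<^sub>v (bd G i *\<^sub>v w) = bd A i *\<^sub>v u)" for i f
  have "\<exists>\<phi>. \<forall>i. P i (\<phi> i) \<and> bd A i * \<phi> (Suc i) = \<phi> i * bd G i"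
  proof (rule dependent_nat_choice)
    show "\<exists>f. P 0 f" using \<phi>0 im by (auto simp: P_def)
  next
    fix f i assume f: "P i f"
    have hf: "homogeneous_mat wt (shifts A i) (shifts G i) f" using f by (simp add: P_def)
    have cf: "f \<in> carrier_mat (frank A i) (frank G i)"
      using homogeneous_mat_carrier[OF hf] by (simp add: frank_def)
    note cG = exact_complexD(2)[OF G] and cA = exact_complexD(2)[OF A]
    have "\<exists>w\<in>carrier_vec (length (shifts A (Suc i))). col (f * bd G i) q = bd A i *\<^sub>v w"
      if "q < length (shifts G (Suc i))" for q
    proof -
      let ?u = "unit_vec (frank G (Suc i)) q"
      have q: "q < frank G (Suc i)" using that by (simp add: frank_def)
      have "col (f * bd G i) q = f *\<^sub>v (bd G i *\<^sub>v ?u)"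
        unfolding mult_mat_vec_unit_vec[OF cG q] by (rule col_mult2[OF cf cG q])
      then show ?thesis using f unfolding P_def frank_def by simp
    qed
    from homogeneous_lift_eq[OF wt exact_complexD(1)[OF A]
        homogeneous_mat_mult[OF wt hf exact_complexD(1)[OF G]] this]
    obtain f' where f': "homogeneous_mat wt (shifts A (Suc i)) (shifts G (Suc i)) f'"
      and eq: "bd A i * f' = f * bd G i" by blast
    have cf': "f' \<in> carrier_mat (frank A (Suc i)) (frank G (Suc i))"
      using homogeneous_mat_carrier[OF f'] by (simp add: frank_def)
    have "\<exists>u\<in>carrier_vec (frank A (Suc (Suc i))). f' *\<^sub>v (bd G (Suc i) *\<^sub>v w) = bd A (Suc i) *\<^sub>v u"
      if w: "w \<in> carrier_vec (frank G (Suc (Suc i)))" for w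
    proof (rule exact_complexD(4)[OF A])
      have v: "bd G (Suc i) *\<^sub>v w \<in> carrier_vec (frank G (Suc i))"
        using cG w by (rule mult_mat_vec_carrier)
      then show "f' *\<^sub>v (bd G (Suc i) *\<^sub>v w) \<in> carrier_vec (frank A (Suc i))"
        using cf' by (rule mult_mat_vec_carrier[rotated])
      have "bd A i *\<^sub>v (f' *\<^sub>v (bd G (Suc i) *\<^sub>v w)) = f *\<^sub>v (bd G i *\<^sub>v (bd G (Suc i) *\<^sub>v w))"
        using assoc_mult_mat_vec[OF cA cf' v] assoc_mult_mat_vec[OF cf cG v] eq by simp
      then show "bd A i *\<^sub>v (f' *\<^sub>v (bd G (Suc i) *\<^sub>v w)) = 0\<^sub>v (frank A i)"
        using exact_complexD(3)[OF G w] cf by simp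
    qed
    then show "\<exists>f'. P (Suc i) f' \<and> bd A i * f' = f * bd G i"
      using f' eq by (auto simp: P_def)
  qed
  then obtain \<phi> where "\<And>i. P i (\<phi> i) \<and> bd A i * \<phi> (Suc i) = \<phi> i * bd G i" by blast
  then show ?thesis unfolding chain_map_def P_def by metis
qed

text \<open>The homotopy is asked only to be a family of matrices of the right sizes: it will be
  used through its products with differentials, modulo the maximal ideal.\<close>

lemma null_homotopy:
  fixes F :: "('d::monoid_add, 'n, 'k::field) free_complex"
  assumes F: "exact_complex wt F"
    and e: "\<And>i. e i \<in> carrier_mat (frank F i) (frank F i)"
    and comm: "\<And>i. bd F i * e (Suc i) = e i * bd F i"
    and e0: "\<And>q. q < frank F 0 \<Longrightarrow> \<exists>u\<in>carrier_vec (frank F 1). col (e 0) q = bd F 0 *\<^sub>v u"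
  shows "\<exists>h. (\<forall>i. h i \<in> carrier_mat (frank F (Suc i)) (frank F i)) \<and> e 0 = bd F 0 * h 0 \<and>
    (\<forall>i. e (Suc i) = bd F (Suc i) * h (Suc i) + h i * bd F i)"
proof -
  note cF = exact_complexD(2)[OF F]
  have lift: "\<exists>X\<in>carrier_mat s t. B = A * X"
    if A: "A \<in> carrier_mat r s" and B: "B \<in> carrier_mat r t"
      and w: "\<And>q. q < t \<Longrightarrow> \<exists>w\<in>carrier_vec s. col B q = A *\<^sub>v w"
    for r s t and A B :: "('n, 'k) mpoly mat"
  proof -
    have "\<exists>w\<in>carrier_vec s. \<forall>p<r. B $$ (p, q) - (A *\<^sub>v w) $ p \<in> {0}" if q: "q < t" for q
    proof -
      obtain w where w: "w \<in> carrier_vec s" "col B q = A *\<^sub>v w" using w q by blast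
      have "B $$ (p, q) = (A *\<^sub>v w) $ p" if "p < r" for p
        unfolding w(2)[symmetric] using B that q by simp
      then show ?thesis using w(1) by force
    qed
    from mat_lift[OF A this] obtain X where "X \<in> carrier_mat s t"
      "\<forall>p<r. \<forall>q<t. B $$ (p, q) - (A * X) $$ (p, q) \<in> {0}" by blast
    then show ?thesis
      by (intro bexI[of _ X] eq_matI) (use A B in \<open>auto simp del: index_mult_mat(1)\<close>)
  qed
  \<comment> \<open>The last clause makes the columns of \<open>e (Suc i) - h * bd F i\<close>
    cycles, so that they lift along \<open>bd F (Suc i)\<close>.\<close>
  define P where "P i h \<longleftrightarrow> (i = 0 \<longrightarrow> e 0 = bd F 0 * h) \<and> h \<in> carrier_mat (frank F (Suc i)) (frank F i) \<and>
    bd F i * h * bd F i = e i * bd F i" for i h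
  have "\<exists>h. \<forall>i. P i (h i) \<and> e (Suc i) = bd F (Suc i) * h (Suc i) + h i * bd F i"
  proof (rule dependent_nat_choice)
    obtain h where "h \<in> carrier_mat (frank F 1) (frank F 0)" "e 0 = bd F 0 * h"
      using lift[OF cF[of 0] e[of 0]] e0 by auto
    then show "\<exists>h. P 0 h" by (auto simp: P_def)
  next
    fix h i assume h: "P i h"
    have ch: "h \<in> carrier_mat (frank F (Suc i)) (frank F i)" using h by (simp add: P_def)
    let ?B = "e (Suc i) - h * bd F i"
    have chb: "h * bd F i \<in> carrier_mat (frank F (Suc i)) (frank F (Suc i))"
      using ch cF by (rule mult_carrier_mat)
    have cB: "?B \<in> carrier_mat (frank F (Suc i)) (frank F (Suc i))"
      using chb by (rule minus_carrier_mat)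
    have "bd F i * ?B = bd F i * e (Suc i) - bd F i * (h * bd F i)"
      using cF e chb by (rule mult_minus_distrib_mat)
    also have "bd F i * (h * bd F i) = bd F i * h * bd F i"
      using assoc_mult_mat[OF cF ch cF] by simp
    finally have 0: "bd F i * ?B = 0\<^sub>m (frank F i) (frank F (Suc i))"
      using h e[of i] cF[of i] by (simp add: P_def comm)
    have "\<exists>w\<in>carrier_vec (frank F (Suc (Suc i))). col ?B q = bd F (Suc i) *\<^sub>v w"
      if q: "q < frank F (Suc i)" for q
    proof (rule exact_complexD(4)[OF F])
      show "col ?B q \<in> carrier_vec (frank F (Suc i))" using q cB by (rule col_carrier_vec)
      have "bd F i *\<^sub>v col ?B q = col (bd F i * ?B) q"
        by (rule col_mult2[OF cF cB q, symmetric])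
      then show "bd F i *\<^sub>v col ?B q = 0\<^sub>v (frank F i)" using 0 q by simp
    qed
    from lift[OF cF cB this] obtain h' where
      ch': "h' \<in> carrier_mat (frank F (Suc (Suc i))) (frank F (Suc i))"
      and h': "?B = bd F (Suc i) * h'" by blast
    have "e (Suc i) = ?B + h * bd F i"
      by (rule eq_matI) (use e[of "Suc i"] chb in \<open>auto simp del: index_mult_mat(1)\<close>)
    moreover have "?B * bd F (Suc i) = e (Suc i) * bd F (Suc i) - h * bd F i * bd F (Suc i)"
      using e chb cF by (rule minus_mult_distrib_mat)
    moreover have "h * bd F i * bd F (Suc i) = 0\<^sub>m (frank F (Suc i)) (frank F (Suc (Suc i)))"
      using assoc_mult_mat[OF ch cF cF] exact_complexD(5)[OF F] ch by simp
    moreover have "e (Suc i) * bd F (Suc i) \<in> carrier_mat (frank F (Suc i)) (frank F (Suc (Suc i)))"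
      using e cF by (rule mult_carrier_mat)
    ultimately have "e (Suc i) = bd F (Suc i) * h' + h * bd F i"
      and "bd F (Suc i) * h' * bd F (Suc i) = e (Suc i) * bd F (Suc i)"
      unfolding h' by (simp_all add: minus_r_inv_mat)
    with ch' show "\<exists>h'. P (Suc i) h' \<and> e (Suc i) = bd F (Suc i) * h' + h * bd F i"
      unfolding P_def by blast
  qed
  then obtain h where "\<And>i. P i (h i) \<and> e (Suc i) = bd F (Suc i) * h (Suc i) + h i * bd F i" by blast
  then show ?thesis unfolding P_def by metis
qed

subsection \<open>Uniqueness of minimal resolutions\<close>

text \<open>If s < r, pad both matrices with zeros to size r. The padded product is still the
  identity, so it is the identity in the other order too, although row s of the padded
  \<open>B\<close> vanishes.\<close>

lemma retract_dim_le:
  fixes A B :: "'k::field mat"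
  assumes A: "A \<in> carrier_mat r s" and B: "B \<in> carrier_mat s r" and AB: "A * B = 1\<^sub>m r"
  shows "r \<le> s"
proof (rule ccontr)
  assume "\<not> r \<le> s"
  then have sr: "s < r" by simp
  define A' where "A' = mat r r (\<lambda>(i, j). if j < s then A $$ (i, j) else 0)"
  define B' where "B' = mat r r (\<lambda>(i, j). if i < s then B $$ (i, j) else 0)"
  have c: "A' \<in> carrier_mat r r" "B' \<in> carrier_mat r r" by (auto simp: A'_def B'_def)
  have "A' * B' = 1\<^sub>m r"
  proof (rule eq_matI)
    fix i j assume "i < dim_row (1\<^sub>m r :: 'k mat)" "j < dim_col (1\<^sub>m r :: 'k mat)"
    then have ij: "i < r" "j < r" by auto
    have "(A' * B') $$ (i, j) = (\<Sum>k<r. A' $$ (i, k) * B' $$ (k, j))"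
      by (rule index_mat_mult_sum[OF c ij])
    also have "\<dots> = (\<Sum>k<s. A $$ (i, k) * B $$ (k, j))"
      using ij sr by (intro sum.mono_neutral_cong_right) (auto simp: A'_def B'_def)
    also have "\<dots> = 1\<^sub>m r $$ (i, j)"
      unfolding index_mat_mult_sum[OF A B ij, symmetric] AB ..
    finally show "(A' * B') $$ (i, j) = 1\<^sub>m r $$ (i, j)" .
  qed (auto simp: A'_def B'_def)
  then have "B' * A' = 1\<^sub>m r" using mat_mult_left_right_inverse[OF c] by blast
  moreover have "(B' * A') $$ (s, s) = 0"
    using sr by (subst index_mat_mult_sum[OF c(2,1)]) (auto simp: B'_def)
  ultimately show False using sr by simp
qed

lemma index_filter_sum:
  fixes f :: "nat \<Rightarrow> 'a::comm_monoid_add"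
  assumes "\<And>k. k < length xs \<Longrightarrow> xs ! k \<noteq> d \<Longrightarrow> f k = 0"
  defines "L \<equiv> filter (\<lambda>k. xs ! k = d) [0..<length xs]"
  shows "(\<Sum>k<length L. f (L ! k)) = (\<Sum>k<length xs. f k)"
proof -
  have "(\<Sum>k<length L. f (L ! k)) = sum f (set L)"
    by (rule sum.reindex_bij_betw) (simp add: L_def bij_betw_nth)
  also have "\<dots> = (\<Sum>k<length xs. f k)"
    using assms(1) by (intro sum.mono_neutral_left) (auto simp: L_def)
  finally show ?thesis .
qed

lemma length_index_filter:
  "length (filter (\<lambda>k. xs ! k = d) [0..<length xs]) = count_list xs d"
proof -
  have "filter ((=) d) xs = filter ((=) d) (map ((!) xs) [0..<length xs])"
    by (simp only: map_nth)
  then show ?thesis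
    unfolding count_list_eq_length_filter by (simp add: filter_map o_def eq_commute[of d])
qed

text \<open>As \<open>B\<close> vanishes between different degrees, the block of
  \<open>A * B\<close> at the positions of degree d factors through the positions of degree d in
  \<open>ys\<close> alone. This reduces the claim to \<open>retract_dim_le\<close> for
  submatrices.\<close>

lemma graded_retract_count_le:
  fixes A B :: "'k::field mat"
  assumes A: "A \<in> carrier_mat (length xs) (length ys)" and B: "B \<in> carrier_mat (length ys) (length xs)"
    and AB: "A * B = 1\<^sub>m (length xs)"
    and B0: "\<And>p q. p < length ys \<Longrightarrow> q < length xs \<Longrightarrow> ys ! p \<noteq> xs ! q \<Longrightarrow> B $$ (p, q) = 0"
  shows "count_list xs d \<le> count_list ys d"
proof -
  define L where "L zs = filter (\<lambda>k. zs ! k = d) [0..<length zs]" for zs :: "'a list"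
  define r s where "r = length (L xs)" and "s = length (L ys)"
  have L: "L zs ! i < length zs" "zs ! (L zs ! i) = d" if "i < length (L zs)" for zs i
    using nth_mem[OF that] by (auto simp: L_def)
  define A' where "A' = mat r s (\<lambda>(i, j). A $$ (L xs ! i, L ys ! j))"
  define B' where "B' = mat s r (\<lambda>(i, j). B $$ (L ys ! i, L xs ! j))"
  have c: "A' \<in> carrier_mat r s" "B' \<in> carrier_mat s r" by (auto simp: A'_def B'_def)
  have "A' * B' = 1\<^sub>m r"
  proof (rule eq_matI)
    fix i j assume "i < dim_row (1\<^sub>m r :: 'k mat)" "j < dim_col (1\<^sub>m r :: 'k mat)"
    then have ij: "i < r" "j < r" by auto
    note Li = L[of i xs] L[of j xs]
    have "(A' * B') $$ (i, j) = (\<Sum>k<s. A $$ (L xs ! i, L ys ! k) * B $$ (L ys ! k, L xs ! j))"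
      using ij by (subst index_mat_mult_sum[OF c ij]) (simp add: A'_def B'_def)
    also have "\<dots> = (\<Sum>k<length ys. A $$ (L xs ! i, k) * B $$ (k, L xs ! j))"
      unfolding s_def L_def[of ys]
      by (rule index_filter_sum) (use ij Li B0 in \<open>auto simp: r_def\<close>)
    also have "\<dots> = (A * B) $$ (L xs ! i, L xs ! j)"
      using ij Li by (subst index_mat_mult_sum[OF A B]) (auto simp: r_def)
    also have "\<dots> = (if L xs ! i = L xs ! j then 1 else 0)"
      unfolding AB using ij Li by (auto simp: r_def)
    also have "\<dots> = 1\<^sub>m r $$ (i, j)"
      using ij by (auto simp: r_def L_def nth_eq_iff_index_eq)
    finally show "(A' * B') $$ (i, j) = 1\<^sub>m r $$ (i, j)" .
  qed (auto simp: A'_def B'_def)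
  from retract_dim_le[OF c this] show ?thesis
    by (simp add: r_def s_def L_def length_index_filter)
qed

section \<open>Comparison of two resolutions of N/D\<close>

lemma resolutionD:
  fixes F :: "('d::monoid_add, 'n, 'k::field) free_complex"
  assumes "graded_free_resolution wt F (N, D)"
  shows "exact_complex wt F"
    and "homogeneous_mat wt [0] (shifts F 0) (aug F)"
    and "aug F \<in> carrier_mat 1 (frank F 0)"
    and "a \<in> N \<Longrightarrow> \<exists>x\<in>carrier_vec (frank F 0). \<exists>d\<in>D. a = (aug F *\<^sub>v x) $ 0 + d"
    and "x \<in> carrier_vec (frank F 0) \<Longrightarrow> d \<in> D \<Longrightarrow> (aug F *\<^sub>v x) $ 0 + d \<in> N"
    and "x \<in> carrier_vec (frank F 0) \<Longrightarrow> (aug F *\<^sub>v x) $ 0 \<in> D \<Longrightarrow>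
      \<exists>w\<in>carrier_vec (frank F 1). x = bd F 0 *\<^sub>v w"
    and "w \<in> carrier_vec (frank F 1) \<Longrightarrow> (aug F *\<^sub>v (bd F 0 *\<^sub>v w)) $ 0 \<in> D"
proof -
  note * = assms[unfolded graded_free_resolution_def fst_conv snd_conv]
  from * show "exact_complex wt F" by (simp add: exact_complex_def)
  from * show h: "homogeneous_mat wt [0] (shifts F 0) (aug F)" by blast
  show "aug F \<in> carrier_mat 1 (frank F 0)"
    using homogeneous_mat_carrier[OF h] by (simp add: frank_def)
  show "a \<in> N \<Longrightarrow> \<exists>x\<in>carrier_vec (frank F 0). \<exists>d\<in>D. a = (aug F *\<^sub>v x) $ 0 + d"
    using * by blast
  show "x \<in> carrier_vec (frank F 0) \<Longrightarrow> d \<in> D \<Longrightarrow> (aug F *\<^sub>v x) $ 0 + d \<in> N"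
    using * by blast
  show "x \<in> carrier_vec (frank F 0) \<Longrightarrow> (aug F *\<^sub>v x) $ 0 \<in> D \<Longrightarrow>
      \<exists>w\<in>carrier_vec (frank F 1). x = bd F 0 *\<^sub>v w"
    using * by blast
  show "w \<in> carrier_vec (frank F 1) \<Longrightarrow> (aug F *\<^sub>v (bd F 0 *\<^sub>v w)) $ 0 \<in> D"
    using * by blast
qed

lemma row_mult_diff_mem:
  fixes A B :: "('n, 'k::field) mpoly mat"
  assumes A: "A \<in> carrier_mat 1 r" and B: "B \<in> carrier_mat 1 r" and x: "x \<in> carrier_vec r"
    and D: "ring_as_module.subspace D" and d: "\<And>q. q < r \<Longrightarrow> A $$ (0, q) - B $$ (0, q) \<in> D"
  shows "(A *\<^sub>v x) $ 0 - (B *\<^sub>v x) $ 0 \<in> D"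
proof -
  have "(A *\<^sub>v x) $ 0 - (B *\<^sub>v x) $ 0 = (\<Sum>q<r. x $ q * (A $$ (0, q) - B $$ (0, q)))"
    using index_mat_vec_sum[OF A x, of 0] index_mat_vec_sum[OF B x, of 0]
    by (simp add: sum_subtractf algebra_simps del: index_mult_mat_vec)
  also have "\<dots> \<in> D"
    using d by (intro ring_as_module.subspace_sum[OF D] ring_as_module.subspace_scale[OF D]) auto
  finally show ?thesis .
qed

text \<open>This lifts the identity of N/D. Augmentations take values in N itself, so compatibility
  with them can only be demanded modulo \<open>D\<close>.\<close>

lemma comparison_map:
  fixes F F' :: "('d::monoid_add, 'n, 'k::field) free_complex"
  assumes wt: "\<And>a b. wt (a + b) = wt a + wt b"
    and D: "ring_as_module.subspace D" and D_restrict: "\<And>P d. d \<in> D \<Longrightarrow> restrict_keys P d \<in> D"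
    and F: "graded_free_resolution wt F (N, D)" and F': "graded_free_resolution wt F' (N, D)"
  shows "\<exists>\<phi>. chain_map wt F F' \<phi> \<and>
    (\<forall>x\<in>carrier_vec (frank F 0). (aug F *\<^sub>v x) $ 0 - (aug F' *\<^sub>v (\<phi> 0 *\<^sub>v x)) $ 0 \<in> D)"
proof -
  note FD = resolutionD[OF F] and FD' = resolutionD[OF F']
  note D0 = ring_as_module.subspace_0[OF D]
  have "\<exists>w\<in>carrier_vec (length (shifts F' 0)).
      \<forall>p<length [0::'d]. aug F $$ (p, q) - (aug F' *\<^sub>v w) $ p \<in> D" if "q < length (shifts F 0)" for q
  proof -
    have q: "q < frank F 0" using that by (simp add: frank_def)
    have "(aug F *\<^sub>v unit_vec (frank F 0) q) $ 0 = aug F $$ (0, q)"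
      unfolding mult_mat_vec_unit_vec[OF FD(3) q] using FD(3) q by simp
    then have "aug F $$ (0, q) \<in> N"
      using FD(5)[OF unit_vec_carrier D0, of q] by simp
    then obtain w d where "w \<in> carrier_vec (frank F' 0)" "d \<in> D" "aug F $$ (0, q) = (aug F' *\<^sub>v w) $ 0 + d"
      using FD'(4) by blast
    then show ?thesis by (intro bexI[of _ w]) (simp_all add: frank_def)
  qed
  from homogeneous_lift[OF wt FD'(2) FD(2) D_restrict this]
  obtain \<phi>0 where \<phi>0: "homogeneous_mat wt (shifts F' 0) (shifts F 0) \<phi>0"
    and diff: "\<And>q. q < frank F 0 \<Longrightarrow> aug F $$ (0, q) - (aug F' * \<phi>0) $$ (0, q) \<in> D"
    unfolding frank_def by auto
  have c: "\<phi>0 \<in> carrier_mat (frank F' 0) (frank F 0)"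
    using homogeneous_mat_carrier[OF \<phi>0] by (simp add: frank_def)
  have diff': "(aug F *\<^sub>v x) $ 0 - (aug F' *\<^sub>v (\<phi>0 *\<^sub>v x)) $ 0 \<in> D"
    if x: "x \<in> carrier_vec (frank F 0)" for x
    using row_mult_diff_mem[OF FD(3) mult_carrier_mat[OF FD'(3) c] x D diff]
    unfolding assoc_mult_mat_vec[OF FD'(3) c x] .
  have "\<exists>u\<in>carrier_vec (frank F' 1). \<phi>0 *\<^sub>v (bd F 0 *\<^sub>v w) = bd F' 0 *\<^sub>v u"
    if w: "w \<in> carrier_vec (frank F 1)" for w
  proof (rule FD'(6))
    have x: "bd F 0 *\<^sub>v w \<in> carrier_vec (frank F 0)"
      using exact_complexD(2)[OF FD(1), of 0] w by simp
    then show "\<phi>0 *\<^sub>v (bd F 0 *\<^sub>v w) \<in> carrier_vec (frank F' 0)"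
      by (rule mult_mat_vec_carrier[OF c])
    have "(aug F *\<^sub>v (bd F 0 *\<^sub>v w)) $ 0 - ((aug F *\<^sub>v (bd F 0 *\<^sub>v w)) $ 0
        - (aug F' *\<^sub>v (\<phi>0 *\<^sub>v (bd F 0 *\<^sub>v w))) $ 0) \<in> D"
      by (rule ring_as_module.subspace_diff[OF D FD(7)[OF w] diff'[OF x]])
    then show "(aug F' *\<^sub>v (\<phi>0 *\<^sub>v (bd F 0 *\<^sub>v w))) $ 0 \<in> D" by simp
  qed
  from chain_map_extend[OF wt FD(1) FD'(1) \<phi>0 this] diff' show ?thesis by blast
qed

text \<open>Tensoring with the residue field is functorial on maps of free modules.\<close>

lemma const_mat_mult:
  fixes A B :: "('n, 'k::field) mpoly mat"
  assumes "A \<in> carrier_mat r s" and "B \<in> carrier_mat s t"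
  shows "map_mat (\<lambda>p. Poly_Mapping.lookup p 0) (A * B)
    = map_mat (\<lambda>p. Poly_Mapping.lookup p 0) A * map_mat (\<lambda>p. Poly_Mapping.lookup p 0) B"
proof (rule eq_matI)
  let ?c = "map_mat (\<lambda>p::('n, 'k) mpoly. Poly_Mapping.lookup p 0)"
  fix i j assume "i < dim_row (?c A * ?c B)" "j < dim_col (?c A * ?c B)"
  then have ij: "i < r" "j < t" using assms by auto
  have "(?c A * ?c B) $$ (i, j) = (\<Sum>k<s. ?c A $$ (i, k) * ?c B $$ (k, j))"
    using ij assms by (intro index_mat_mult_sum) auto
  also have "\<dots> = (\<Sum>k<s. Poly_Mapping.lookup (A $$ (i, k) * B $$ (k, j)) 0)"
    using ij assms by (intro sum.cong) (auto simp: lookup_mult_0)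
  also have "\<dots> = Poly_Mapping.lookup ((A * B) $$ (i, j)) 0"
    unfolding index_mat_mult_sum[OF assms ij] by (simp add: lookup_sum)
  finally show "?c (A * B) $$ (i, j) = (?c A * ?c B) $$ (i, j)"
    using ij assms by simp
qed (use assms in auto)

lemma const_mat_eq_0:
  fixes A :: "('n, 'k::field) mpoly mat"
  assumes "A \<in> carrier_mat r s"
  shows "elements_mat A \<subseteq> max_homogeneous_ideal \<longleftrightarrow>
    map_mat (\<lambda>p. Poly_Mapping.lookup p 0) A = 0\<^sub>m r s"
proof -
  have "elements_mat A \<subseteq> max_homogeneous_ideal
      \<longleftrightarrow> (\<forall>i<r. \<forall>j<s. Poly_Mapping.lookup (A $$ (i, j)) 0 = 0)"
    using assms by (force simp: elements_mat_def max_homogeneous_ideal_iff[symmetric])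
  then show ?thesis
    using assms by (auto simp: mat_eq_iff)
qed

text \<open>A comparison \<open>F \<rightarrow> F' \<rightarrow> F\<close> is homotopic to the identity, and by minimality
  the homotopy has no constant terms.\<close>

lemma minimal_resolution_count_le:
  fixes F F' :: "('d::monoid_add, 'n, 'k::field) free_complex"
  assumes wt: "\<And>a b. wt (a + b) = wt a + wt b" and wt0: "wt 0 = 0"
    and D: "ring_as_module.subspace D" and D_restrict: "\<And>P d. d \<in> D \<Longrightarrow> restrict_keys P d \<in> D"
    and F: "minimal_free_resolution wt F (N, D)" and F': "graded_free_resolution wt F' (N, D)"
  shows "count_list (shifts F i) d \<le> count_list (shifts F' i) d"
proof -
  let ?c = "map_mat (\<lambda>p::('n, 'k) mpoly. Poly_Mapping.lookup p 0)"
  have F0: "graded_free_resolution wt F (N, D)" using F by (simp add: minimal_free_resolution_def)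
  note FD = resolutionD[OF F0] and FD' = resolutionD[OF F']
  obtain \<phi> where \<phi>: "chain_map wt F F' \<phi>"
    and \<phi>a: "\<And>x. x \<in> carrier_vec (frank F 0) \<Longrightarrow> (aug F *\<^sub>v x) $ 0 - (aug F' *\<^sub>v (\<phi> 0 *\<^sub>v x)) $ 0 \<in> D"
    using comparison_map[OF wt D D_restrict F0 F'] by blast
  obtain \<psi> where \<psi>: "chain_map wt F' F \<psi>"
    and \<psi>a: "\<And>x. x \<in> carrier_vec (frank F' 0) \<Longrightarrow> (aug F' *\<^sub>v x) $ 0 - (aug F *\<^sub>v (\<psi> 0 *\<^sub>v x)) $ 0 \<in> D"
    using comparison_map[OF wt D D_restrict F' F0] by blast
  have h\<phi>: "homogeneous_mat wt (shifts F' i) (shifts F i) (\<phi> i)" for i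
    using \<phi> by (simp add: chain_map_def)
  have c\<phi>: "\<phi> i \<in> carrier_mat (frank F' i) (frank F i)" for i
    using homogeneous_mat_carrier[OF h\<phi>] by (simp add: frank_def)
  have c\<psi>: "\<psi> i \<in> carrier_mat (frank F i) (frank F' i)" for i
    using \<psi> unfolding chain_map_def frank_def by (blast intro: homogeneous_mat_carrier)
  note cF = exact_complexD(2)[OF FD(1)] and cF' = exact_complexD(2)[OF FD'(1)]
  have c\<psi>\<phi>: "\<psi> i * \<phi> i \<in> carrier_mat (frank F i) (frank F i)" for i
    using c\<psi> c\<phi> by (rule mult_carrier_mat)
  \<comment> \<open>This chain endomorphism induces zero on N/D, hence is null-homotopic; every term
    of the homotopy formula contains a differential of \<open>F\<close>, so \<open>e\<close> has no
    constant terms.\<close>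
  define e where "e i = 1\<^sub>m (frank F i) - \<psi> i * \<phi> i" for i
  have ce: "e i \<in> carrier_mat (frank F i) (frank F i)" for i
    unfolding e_def using c\<psi>\<phi> by (rule minus_carrier_mat)
  have "bd F i * e (Suc i) = e i * bd F i" for i
  proof -
    have "bd F i * (\<psi> (Suc i) * \<phi> (Suc i)) = bd F i * \<psi> (Suc i) * \<phi> (Suc i)"
      by (rule assoc_mult_mat[OF cF c\<psi> c\<phi>, symmetric])
    also have "\<dots> = \<psi> i * bd F' i * \<phi> (Suc i)" using \<psi> by (simp add: chain_map_def)
    also have "\<dots> = \<psi> i * (bd F' i * \<phi> (Suc i))" by (rule assoc_mult_mat[OF c\<psi> cF' c\<phi>])
    also have "\<dots> = \<psi> i * (\<phi> i * bd F i)" using \<phi> by (simp add: chain_map_def)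
    also have "\<dots> = \<psi> i * \<phi> i * bd F i" by (rule assoc_mult_mat[OF c\<psi> c\<phi> cF, symmetric])
    finally show ?thesis
      unfolding e_def mult_minus_distrib_mat[OF cF one_carrier_mat c\<psi>\<phi>]
        minus_mult_distrib_mat[OF one_carrier_mat c\<psi>\<phi> cF]
      using cF[of i] by simp
  qed
  moreover have "\<exists>u\<in>carrier_vec (frank F 1). col (e 0) q = bd F 0 *\<^sub>v u" if q: "q < frank F 0" for q
  proof (rule FD(6))
    let ?u = "unit_vec (frank F 0) q"
    show "col (e 0) q \<in> carrier_vec (frank F 0)" using q ce by (rule col_carrier_vec)
    have \<phi>u: "\<phi> 0 *\<^sub>v ?u \<in> carrier_vec (frank F' 0)"
      by (rule mult_mat_vec_carrier[OF c\<phi> unit_vec_carrier])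
    have \<psi>u: "\<psi> 0 *\<^sub>v (\<phi> 0 *\<^sub>v ?u) \<in> carrier_vec (frank F 0)"
      by (rule mult_mat_vec_carrier[OF c\<psi> \<phi>u])
    have "col (e 0) q = ?u - \<psi> 0 *\<^sub>v (\<phi> 0 *\<^sub>v ?u)"
      using mult_mat_vec_unit_vec[OF ce q]
        minus_mult_distrib_mat_vec[OF one_carrier_mat c\<psi>\<phi> unit_vec_carrier, of 0 q]
        assoc_mult_mat_vec[OF c\<psi> c\<phi> unit_vec_carrier, of 0 q] by (simp add: e_def)
    then have "aug F *\<^sub>v col (e 0) q = aug F *\<^sub>v ?u - aug F *\<^sub>v (\<psi> 0 *\<^sub>v (\<phi> 0 *\<^sub>v ?u))"
      by (simp only: mult_minus_distrib_mat_vec[OF FD(3) unit_vec_carrier \<psi>u])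
    then have "(aug F *\<^sub>v col (e 0) q) $ 0
        = ((aug F *\<^sub>v ?u) $ 0 - (aug F' *\<^sub>v (\<phi> 0 *\<^sub>v ?u)) $ 0)
          + ((aug F' *\<^sub>v (\<phi> 0 *\<^sub>v ?u)) $ 0 - (aug F *\<^sub>v (\<psi> 0 *\<^sub>v (\<phi> 0 *\<^sub>v ?u))) $ 0)"
      using FD(3) by (simp del: index_mult_mat_vec)
    also have "\<dots> \<in> D"
      by (rule ring_as_module.subspace_add[OF D \<phi>a[OF unit_vec_carrier] \<psi>a[OF \<phi>u]])
    finally show "(aug F *\<^sub>v col (e 0) q) $ 0 \<in> D" .
  qed
  ultimately obtain h where ch: "\<And>i. h i \<in> carrier_mat (frank F (Suc i)) (frank F i)"
    and e0: "e 0 = bd F 0 * h 0" and eS: "\<And>i. e (Suc i) = bd F (Suc i) * h (Suc i) + h i * bd F i"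
    using null_homotopy[of wt F e, OF FD(1) ce] by metis
  have bd0: "?c (bd F i) = 0\<^sub>m (frank F i) (frank F (Suc i))" for i
    using F const_mat_eq_0[OF cF] by (simp add: minimal_free_resolution_def)
  have c1: "?c (bd F i * h i) = 0\<^sub>m (frank F i) (frank F i)" for i
    unfolding const_mat_mult[OF cF ch] bd0 using ch[of i] by simp
  have c2: "?c (h i * bd F i) = 0\<^sub>m (frank F (Suc i)) (frank F (Suc i))" for i
    unfolding const_mat_mult[OF ch cF] bd0 using ch[of i] by simp
  have ec: "?c (e i) = 0\<^sub>m (frank F i) (frank F i)" for i
  proof (cases i)
    case 0
    then show ?thesis using c1[of 0] e0 by simp
  next
    case (Suc j)
    have "?c (A + B) = 0\<^sub>m r r" if "?c A = 0\<^sub>m r r" "?c B = 0\<^sub>m r r" for A B r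
      using that by (auto simp: mat_eq_iff lookup_add)
    then show ?thesis unfolding Suc eS using c1 c2 by blast
  qed
  have "?c (\<psi> i) * ?c (\<phi> i) = 1\<^sub>m (frank F i)"
    unfolding const_mat_mult[OF c\<psi> c\<phi>, symmetric]
  proof (rule eq_matI)
    fix p q assume "p < dim_row (1\<^sub>m (frank F i) :: 'k mat)" "q < dim_col (1\<^sub>m (frank F i) :: 'k mat)"
    then have pq: "p < frank F i" "q < frank F i" by auto
    have "Poly_Mapping.lookup (e i $$ (p, q)) 0 = ?c (e i) $$ (p, q)"
      using pq ce[of i] by simp
    also have "\<dots> = 0" using pq unfolding ec by simp
    finally have "Poly_Mapping.lookup ((1\<^sub>m (frank F i) :: ('n, 'k) mpoly mat) $$ (p, q)) 0
        = Poly_Mapping.lookup ((\<psi> i * \<phi> i) $$ (p, q)) 0"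
      using pq c\<psi>[of i] c\<phi>[of i] unfolding e_def
      by (simp add: lookup_minus del: index_mult_mat(1) index_one_mat(1))
    then show "?c (\<psi> i * \<phi> i) $$ (p, q) = 1\<^sub>m (frank F i) $$ (p, q)"
      using pq c\<psi>[of i] c\<phi>[of i] by (auto simp: lookup_one simp del: index_mult_mat(1) split: if_splits)
  qed (use c\<psi>[of i] c\<phi>[of i] in auto)
  \<comment> \<open>A nonzero constant term has the exponent 0 as a key, and since
    \<open>wt 0 = 0\<close> homogeneity would force the two shifts to agree.\<close>
  moreover have "?c (\<phi> i) $$ (p, q) = 0"
    if "p < length (shifts F' i)" "q < length (shifts F i)" "shifts F' i ! p \<noteq> shifts F i ! q" for p q
    using h\<phi>[of i] that c\<phi>[of i] wt0
    by (force simp: homogeneous_mat_def in_keys_iff)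
  ultimately show ?thesis
    using c\<phi>[of i] c\<psi>[of i]
    by (intro graded_retract_count_le[of "?c (\<psi> i)" _ _ "?c (\<phi> i)"]) (auto simp: frank_def)
qed

subsection \<open>Mapping cones\<close>

lemma carrier_vec_append_cases:
  assumes "v \<in> carrier_vec (r + s)"
  obtains x y where "x \<in> carrier_vec r" "y \<in> carrier_vec s" "v = x @\<^sub>v y"
  using that[of "vec_first v r" "vec_last v s"] assms by simp

lemma mult_mat_vec_uminus:
  fixes M :: "'a::comm_ring_1 mat"
  assumes "M \<in> carrier_mat r s" and "z \<in> carrier_vec s"
  shows "M *\<^sub>v (- z) = - (M *\<^sub>v z)"
  using assms by (intro eq_vecI) auto

lemma zero_vec_append: "0\<^sub>v (r + s) = 0\<^sub>v r @\<^sub>v (0\<^sub>v s :: 'a::zero vec)"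
  by (intro eq_vecI) auto

lemma homogeneous_mat_zero: "homogeneous_mat wt rs cs (0\<^sub>m (length rs) (length cs))"
  by (simp add: homogeneous_mat_def)

lemma homogeneous_mat_uminus:
  "homogeneous_mat wt rs cs A \<Longrightarrow> homogeneous_mat wt rs cs (- A)"
  by (auto simp: homogeneous_mat_def in_keys_iff)

lemma homogeneous_four_block_mat:
  assumes "homogeneous_mat wt rs1 cs1 A" "homogeneous_mat wt rs1 cs2 B"
    and "homogeneous_mat wt rs2 cs1 C" "homogeneous_mat wt rs2 cs2 D"
  shows "homogeneous_mat wt (rs1 @ rs2) (cs1 @ cs2) (four_block_mat A B C D)"
  using assms unfolding homogeneous_mat_def
  by (auto simp: nth_append not_less less_diff_conv2 split: if_splits)

lemma diag_block_mat_pair: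
  "diag_block_mat [A, B] =
    four_block_mat A (0\<^sub>m (dim_row A) (dim_col B)) (0\<^sub>m (dim_row B) (dim_col A)) B"
  by (simp only: diag_block_mat.simps(2)[of A] Let_def diag_block_mat_singleton)

lemma homogeneous_diag_block_mat:
  assumes "homogeneous_mat wt rs1 cs1 A" and "homogeneous_mat wt rs2 cs2 B"
  shows "homogeneous_mat wt (rs1 @ rs2) (cs1 @ cs2) (diag_block_mat [A, B])"
  using homogeneous_mat_carrier[OF assms(1)] homogeneous_mat_carrier[OF assms(2)]
    homogeneous_four_block_mat[OF assms(1) homogeneous_mat_zero homogeneous_mat_zero assms(2)]
  by (simp only: diag_block_mat_pair carrier_matD)

lemma diag_block_mat_mult_vec:
  fixes A B :: "'a::comm_ring_1 mat"
  assumes A: "A \<in> carrier_mat r1 s1" and B: "B \<in> carrier_mat r2 s2"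
    and x: "x \<in> carrier_vec s1" and y: "y \<in> carrier_vec s2"
  shows "diag_block_mat [A, B] *\<^sub>v (x @\<^sub>v y) = (A *\<^sub>v x) @\<^sub>v (B *\<^sub>v y)"
proof -
  have "0\<^sub>m r1 s2 *\<^sub>v y = 0\<^sub>v r1" "0\<^sub>m r2 s1 *\<^sub>v x = 0\<^sub>v r2"
    using x y by (auto intro!: eq_vecI)
  then show ?thesis
    using four_block_mat_mult_vec[OF A zero_carrier_mat zero_carrier_mat B x y]
      mult_mat_vec_carrier[OF A x] mult_mat_vec_carrier[OF B y] A B
    by (simp add: diag_block_mat_pair del: diag_block_mat.simps)
qed

lemma frank_direct_sum [simp]: "frank (direct_sum F H) i = frank F i + frank H i"
  by (simp add: frank_def direct_sum_def)

lemma exact_direct_sum: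
  assumes F: "exact_complex wt F" and H: "exact_complex wt H"
  shows "exact_complex wt (direct_sum F H)"
proof -
  note cF = exact_complexD(2)[OF F] and cH = exact_complexD(2)[OF H]
  let ?S = "direct_sum F H"
  have bd: "bd ?S i *\<^sub>v (x @\<^sub>v y) = (bd F i *\<^sub>v x) @\<^sub>v (bd H i *\<^sub>v y)"
    if "x \<in> carrier_vec (frank F (Suc i))" "y \<in> carrier_vec (frank H (Suc i))" for i x y
    using diag_block_mat_mult_vec[OF cF cH that] by (simp add: direct_sum_def del: diag_block_mat.simps)
  have "{v \<in> carrier_vec (frank ?S (Suc i)). bd ?S i *\<^sub>v v = 0\<^sub>v (frank ?S i)}
      = {bd ?S (Suc i) *\<^sub>v w | w. w \<in> carrier_vec (frank ?S (Suc (Suc i)))}" (is "?K = ?B") for i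
  proof (intro subset_antisym subsetI)
    fix v assume "v \<in> ?K"
    then have v: "v \<in> carrier_vec (frank F (Suc i) + frank H (Suc i))"
      and v0: "bd ?S i *\<^sub>v v = 0\<^sub>v (frank F i + frank H i)" by auto
    obtain x y where xy: "x \<in> carrier_vec (frank F (Suc i))" "y \<in> carrier_vec (frank H (Suc i))" "v = x @\<^sub>v y"
      using carrier_vec_append_cases[OF v] .
    have "(bd F i *\<^sub>v x) @\<^sub>v (bd H i *\<^sub>v y) = 0\<^sub>v (frank F i) @\<^sub>v 0\<^sub>v (frank H i)"
      using v0 unfolding xy(3) bd[OF xy(1,2)] zero_vec_append .
    then have "bd F i *\<^sub>v x = 0\<^sub>v (frank F i)" "bd H i *\<^sub>v y = 0\<^sub>v (frank H i)"
      using append_vec_eq[OF mult_mat_vec_carrier[OF cF xy(1)] zero_carrier_vec] by blast+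
    then obtain z w where "z \<in> carrier_vec (frank F (Suc (Suc i)))" "x = bd F (Suc i) *\<^sub>v z"
      "w \<in> carrier_vec (frank H (Suc (Suc i)))" "y = bd H (Suc i) *\<^sub>v w"
      using exact_complexD(4)[OF F xy(1)] exact_complexD(4)[OF H xy(2)] by blast
    then have "v = bd ?S (Suc i) *\<^sub>v (z @\<^sub>v w)" "z @\<^sub>v w \<in> carrier_vec (frank ?S (Suc (Suc i)))"
      using bd xy(3) by simp_all
    then show "v \<in> ?B" by blast
  next
    fix v assume "v \<in> ?B"
    then obtain u where "u \<in> carrier_vec (frank F (Suc (Suc i)) + frank H (Suc (Suc i)))"
      and v: "v = bd ?S (Suc i) *\<^sub>v u" by auto
    then obtain z w where zw: "z \<in> carrier_vec (frank F (Suc (Suc i)))"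
      "w \<in> carrier_vec (frank H (Suc (Suc i)))" "u = z @\<^sub>v w"
      using carrier_vec_append_cases by blast
    have c: "bd F (Suc i) *\<^sub>v z \<in> carrier_vec (frank F (Suc i))"
      "bd H (Suc i) *\<^sub>v w \<in> carrier_vec (frank H (Suc i))"
      using mult_mat_vec_carrier[OF cF zw(1)] mult_mat_vec_carrier[OF cH zw(2)] .
    show "v \<in> ?K"
      using c unfolding v zw(3) bd[OF zw(1,2)]
      by (simp add: bd[OF c] exact_complexD(3)[OF F zw(1)] exact_complexD(3)[OF H zw(2)] zero_vec_append)
  qed
  moreover have "homogeneous_mat wt (shifts ?S i) (shifts ?S (Suc i)) (bd ?S i)" for i
    using homogeneous_diag_block_mat[OF exact_complexD(1)[OF F] exact_complexD(1)[OF H]]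
    by (simp add: direct_sum_def del: diag_block_mat.simps)
  ultimately show ?thesis unfolding exact_complex_def by blast
qed

section \<open>Principal ideals and the maps of the short exact sequence\<close>

lemma ideal_gen_singleton: "ideal_gen {b} = {b * c | c. True}"
  unfolding ideal_gen_def ring_as_module.span_singleton by (auto simp: mult.commute)

lemma ideal_gen_Un: "ideal_gen (B \<union> C) = {x + y | x y. x \<in> ideal_gen B \<and> y \<in> ideal_gen C}"
  unfolding ideal_gen_def by (rule ring_as_module.span_Un)

lemma frank_principal [simp]: "frank (principal_resolution g) i = (if i = 0 then 1 else 0)"
  by (simp add: frank_def principal_resolution_def)

lemma aug_principal_mult:
  assumes "y \<in> carrier_vec 1"
  shows "(aug (principal_resolution g) *\<^sub>v y) $ 0 = monomial g * y $ 0"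
  using assms by (simp add: principal_resolution_def scalar_prod_def)

lemma principal_resolution_minimal:
  "minimal_free_resolution (\<lambda>a. a) (principal_resolution g)
    (ideal_module (ideal_gen {monomial g} :: ('n, 'k::field) mpoly set))"
proof -
  let ?P = "principal_resolution g :: (_, 'n, 'k) free_complex"
  have "homogeneous_mat (\<lambda>a. a) [0] (shifts ?P 0) (aug ?P)"
    by (auto simp: homogeneous_mat_def principal_resolution_def)
  moreover have "homogeneous_mat (\<lambda>a. a) (shifts ?P i) (shifts ?P (Suc i)) (bd ?P i)" for i
    by (auto simp: homogeneous_mat_def principal_resolution_def)
  moreover have "ideal_gen {monomial g} = {(aug ?P *\<^sub>v v) $ 0 + d | v d. v \<in> carrier_vec (frank ?P 0) \<and> d \<in> {0}}"
  proof -
    have 1: "(aug ?P *\<^sub>v vec 1 (\<lambda>_. c)) $ 0 = monomial g * c" for c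
      using aug_principal_mult[of "vec 1 (\<lambda>_. c)" g] by simp
    have 2: "(aug ?P *\<^sub>v v) $ 0 = monomial g * v $ 0" if "v \<in> carrier_vec (frank ?P 0)" for v
      using that by (simp add: aug_principal_mult del: index_mult_mat_vec)
    show ?thesis
      unfolding ideal_gen_singleton
    proof (intro subset_antisym subsetI)
      fix a :: "('n, 'k) mpoly" assume "a \<in> {monomial g * c | c. True}"
      then obtain c where "a = (aug ?P *\<^sub>v vec 1 (\<lambda>_. c)) $ 0 + 0"
        using 1 by force
      moreover have "vec 1 (\<lambda>_. c) \<in> carrier_vec (frank ?P 0)" by simp
      ultimately show "a \<in> {(aug ?P *\<^sub>v v) $ 0 + d | v d. v \<in> carrier_vec (frank ?P 0) \<and> d \<in> {0}}"
        by blast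
    qed (use 2 in force)
  qed
  moreover have "{v \<in> carrier_vec (frank ?P 0). (aug ?P *\<^sub>v v) $ 0 \<in> {0}}
       = {bd ?P 0 *\<^sub>v w | w. w \<in> carrier_vec (frank ?P 1)}"
  proof -
    have "{v \<in> carrier_vec (frank ?P 0). (aug ?P *\<^sub>v v) $ 0 \<in> {0}} = {0\<^sub>v 1}"
      by (auto simp: aug_principal_mult monomial_mult_eq_0_iff simp del: index_mult_mat_vec intro!: eq_vecI)
    moreover have "{bd ?P 0 *\<^sub>v w | w. w \<in> carrier_vec (frank ?P 1)} = {0\<^sub>v 1}"
    proof -
      have b: "bd ?P 0 \<in> carrier_mat 1 0" and f: "frank ?P 1 = 0"
        by (simp_all add: principal_resolution_def frank_def)
      have "bd ?P 0 *\<^sub>v w = 0\<^sub>v 1" if "w \<in> carrier_vec 0" for w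
        using that b by (intro eq_vecI) (auto simp: scalar_prod_def)
      then show ?thesis unfolding f by (auto intro!: exI[of _ "0\<^sub>v 0"])
    qed
    ultimately show ?thesis by simp
  qed
  moreover have "{v \<in> carrier_vec (frank ?P (Suc i)). bd ?P i *\<^sub>v v = 0\<^sub>v (frank ?P i)}
       = {bd ?P (Suc i) *\<^sub>v w | w. w \<in> carrier_vec (frank ?P (Suc (Suc i)))}" for i
  proof -
    have b: "bd ?P j \<in> carrier_mat (frank ?P j) 0" for j
      by (simp add: principal_resolution_def frank_def)
    have 0: "bd ?P j *\<^sub>v w = 0\<^sub>v (frank ?P j)" if "w \<in> carrier_vec 0" for w j
      using that b[of j] by (intro eq_vecI) (auto simp: scalar_prod_def)
    have "carrier_vec 0 = {0\<^sub>v 0 :: ('n, 'k) mpoly vec}" by auto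
    then show ?thesis using 0[OF zero_carrier_vec] by auto
  qed
  moreover have "elements_mat (bd ?P i) \<subseteq> max_homogeneous_ideal" for i
    by (simp add: principal_resolution_def elements_mat_def)
  ultimately show ?thesis
    unfolding minimal_free_resolution_def graded_free_resolution_def fst_conv snd_conv by blast
qed

lemma sum_row:
  fixes A :: "('n, 'k::field) mpoly mat"
  assumes A: "A \<in> carrier_mat 2 r" and v: "v \<in> carrier_vec r"
  shows "mat_of_rows_list 2 [[1, 1]] * A \<in> carrier_mat 1 r"
    and "((mat_of_rows_list 2 [[1, 1]] * A) *\<^sub>v v) $ 0 = (A *\<^sub>v v) $ 0 + (A *\<^sub>v v) $ 1"
proof -
  have R: "mat_of_rows_list 2 [[1, 1]] \<in> (carrier_mat 1 2 :: ('n, 'k) mpoly mat set)"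
    by (simp add: mat_of_rows_list_def)
  then show "mat_of_rows_list 2 [[1, 1]] * A \<in> carrier_mat 1 r"
    using A by (rule mult_carrier_mat)
  show "((mat_of_rows_list 2 [[1, 1]] * A) *\<^sub>v v) $ 0 = (A *\<^sub>v v) $ 0 + (A *\<^sub>v v) $ 1"
    unfolding assoc_mult_mat_vec[OF R A v]
    using index_mat_vec_sum[OF R mult_mat_vec_carrier[OF A v], of 0]
    by (simp add: mat_of_rows_list_def numeral_2_eq_2 del: index_mult_mat_vec)
qed

lemma antidiagonal_column:
  fixes A :: "('n, 'k::field) mpoly mat"
  assumes A: "A \<in> carrier_mat 1 r" and v: "v \<in> carrier_vec r"
  shows "mat_of_rows_list 1 [[1], [- 1]] * A \<in> carrier_mat 2 r"
    and "(mat_of_rows_list 1 [[1], [- 1]] * A) *\<^sub>v v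
      = vec_of_list [(A *\<^sub>v v) $ 0, - ((A *\<^sub>v v) $ 0)]"
proof -
  have R: "mat_of_rows_list 1 [[1], [- 1]] \<in> (carrier_mat 2 1 :: ('n, 'k) mpoly mat set)"
    by (simp add: mat_of_rows_list_def numeral_2_eq_2)
  then show "mat_of_rows_list 1 [[1], [- 1]] * A \<in> carrier_mat 2 r"
    using A by (rule mult_carrier_mat)
  show "(mat_of_rows_list 1 [[1], [- 1]] * A) *\<^sub>v v
      = vec_of_list [(A *\<^sub>v v) $ 0, - ((A *\<^sub>v v) $ 0)]"
    unfolding assoc_mult_mat_vec[OF R A v]
  proof (rule eq_vecI)
    fix i assume "i < dim_vec (vec_of_list [(A *\<^sub>v v) $ 0, - ((A *\<^sub>v v) $ 0)])"
    then have i: "i = 0 \<or> i = 1" by auto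
    then show "(mat_of_rows_list 1 [[1], [- 1]] *\<^sub>v (A *\<^sub>v v)) $ i
        = vec_of_list [(A *\<^sub>v v) $ 0, - ((A *\<^sub>v v) $ 0)] $ i"
      using index_mat_vec_sum[OF R mult_mat_vec_carrier[OF A v], of i]
      by (auto simp: mat_of_rows_list_def simp del: index_mult_mat_vec)
  qed (use R in simp)
qed

text \<open>The complex \<open>A\<close> with the two-row augmentation \<open>aug A\<close> resolves \<open>U \<oplus> V\<close>.\<close>

lemma cone_chain_map:
  fixes A G :: "('d::monoid_add, 'n, 'k::field) free_complex"
  assumes wt: "\<And>a b. wt (a + b) = wt a + wt b" and wt0: "wt 0 = 0"
    and A: "exact_complex wt A" and augA: "homogeneous_mat wt [0, 0] (shifts A 0) (aug A)"
    and kerA: "\<And>v. v \<in> carrier_vec (frank A 0) \<Longrightarrow> aug A *\<^sub>v v = 0\<^sub>v 2 \<Longrightarrow>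
      \<exists>w\<in>carrier_vec (frank A 1). v = bd A 0 *\<^sub>v w"
    and imA: "\<And>a b. a \<in> U \<Longrightarrow> b \<in> V \<Longrightarrow>
      \<exists>v\<in>carrier_vec (frank A 0). aug A *\<^sub>v v = vec_of_list [a, b]"
    and V: "\<And>a. a \<in> V \<Longrightarrow> - a \<in> V"
    and G: "graded_free_resolution wt G (ideal_module (U \<inter> V))"
  shows "\<exists>\<phi>. chain_map wt G A \<phi> \<and> aug A * \<phi> 0 = mat_of_rows_list 1 [[1], [- 1]] * aug G"
proof -
  note GD = resolutionD[OF G]
  let ?B = "mat_of_rows_list 1 [[1], [- 1]] * aug G"
  have "homogeneous_mat wt [0, 0] [0] (mat_of_rows_list 1 [[1], [- 1]] :: ('n, 'k) mpoly mat)"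
    by (auto simp: homogeneous_mat_def mat_of_rows_list_def less_Suc_eq wt0 in_keys_iff lookup_one when_def
        split: if_splits)
  then have hB: "homogeneous_mat wt [0, 0] (shifts G 0) ?B"
    by (rule homogeneous_mat_mult[OF wt _ GD(2)])
  have cA: "aug A \<in> carrier_mat 2 (frank A 0)"
    using homogeneous_mat_carrier[OF augA] by (simp add: frank_def numeral_2_eq_2)
  note cB = antidiagonal_column(1)[OF GD(3) zero_carrier_vec]
  have "\<exists>w\<in>carrier_vec (length (shifts A 0)). col ?B q = aug A *\<^sub>v w" if "q < length (shifts G 0)" for q
  proof -
    have q: "q < frank G 0" using that by (simp add: frank_def)
    let ?a = "(aug G *\<^sub>v unit_vec (frank G 0) q) $ 0"
    have "col ?B q = vec_of_list [?a, - ?a]"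
      unfolding mult_mat_vec_unit_vec[OF cB q, symmetric]
      by (rule antidiagonal_column(2)[OF GD(3) unit_vec_carrier])
    moreover have "?a \<in> U \<inter> V" using GD(5)[OF unit_vec_carrier, of 0 q] by simp
    ultimately show ?thesis using imA[of ?a "- ?a"] V by (metis IntD1 IntD2 frank_def)
  qed
  from homogeneous_lift_eq[OF wt augA hB this]
  obtain \<phi>0 where \<phi>0: "homogeneous_mat wt (shifts A 0) (shifts G 0) \<phi>0" and eq: "aug A * \<phi>0 = ?B"
    by blast
  have c\<phi>: "\<phi>0 \<in> carrier_mat (frank A 0) (frank G 0)"
    using homogeneous_mat_carrier[OF \<phi>0] by (simp add: frank_def)
  have "\<exists>u\<in>carrier_vec (frank A 1). \<phi>0 *\<^sub>v (bd G 0 *\<^sub>v w) = bd A 0 *\<^sub>v u"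
    if w: "w \<in> carrier_vec (frank G 1)" for w
  proof (rule kerA)
    have x: "bd G 0 *\<^sub>v w \<in> carrier_vec (frank G 0)"
      using exact_complexD(2)[OF GD(1), of 0] w by simp
    then show "\<phi>0 *\<^sub>v (bd G 0 *\<^sub>v w) \<in> carrier_vec (frank A 0)"
      by (rule mult_mat_vec_carrier[OF c\<phi>])
    show "aug A *\<^sub>v (\<phi>0 *\<^sub>v (bd G 0 *\<^sub>v w)) = 0\<^sub>v 2"
      using assoc_mult_mat_vec[OF cA c\<phi> x] antidiagonal_column(2)[OF GD(3) x] GD(7)[OF w]
      by (auto simp: eq numeral_2_eq_2 zero_vec_Suc)
  qed
  from chain_map_extend[OF wt GD(1) A \<phi>0 this] show ?thesis using eq by blast
qed

lemma frank_cone: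
  "frank (mapping_cone \<epsilon> G A \<phi>) 0 = frank A 0"
  "frank (mapping_cone \<epsilon> G A \<phi>) (Suc i) = frank A (Suc i) + frank G i"
  by (simp_all add: frank_def mapping_cone_def)

text \<open>The long exact sequence made explicit: in a cycle (x, y) the part y is a boundary bd z
  of \<open>G\<close>; then x + \<phi> z is a cycle of \<open>A\<close>, hence bd w, and (x, y) is
  the boundary of (w, -z). At the augmentation, a + b = 0 puts a into the intersection of U and V,
  where \<open>G\<close> supplies a preimage.\<close>

lemma cone_resolution:
  fixes A G :: "('d::monoid_add, 'n, 'k::field) free_complex"
  assumes wt: "\<And>a b. wt (a + b) = wt a + wt b" and wt0: "wt 0 = 0"
    and A: "exact_complex wt A" and augA: "homogeneous_mat wt [0, 0] (shifts A 0) (aug A)"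
    and kerA: "\<And>v. v \<in> carrier_vec (frank A 0) \<Longrightarrow> aug A *\<^sub>v v = 0\<^sub>v 2 \<Longrightarrow>
      \<exists>w\<in>carrier_vec (frank A 1). v = bd A 0 *\<^sub>v w"
    and compA: "\<And>w. w \<in> carrier_vec (frank A 1) \<Longrightarrow> aug A *\<^sub>v (bd A 0 *\<^sub>v w) = 0\<^sub>v 2"
    and imA: "\<And>a b. a \<in> U \<Longrightarrow> b \<in> V \<Longrightarrow>
      \<exists>v\<in>carrier_vec (frank A 0). aug A *\<^sub>v v = vec_of_list [a, b]"
    and imA': "\<And>v. v \<in> carrier_vec (frank A 0) \<Longrightarrow>
      \<exists>a\<in>U. \<exists>b\<in>V. aug A *\<^sub>v v = vec_of_list [a, b]"
    and V: "\<And>a. a \<in> V \<Longrightarrow> - a \<in> V"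
    and G: "graded_free_resolution wt G (ideal_module (U \<inter> V))"
    and \<phi>: "chain_map wt G A \<phi>" and \<phi>0: "aug A * \<phi> 0 = mat_of_rows_list 1 [[1], [- 1]] * aug G"
  shows "graded_free_resolution wt (mapping_cone (mat_of_rows_list 2 [[1, 1]] * aug A) G A \<phi>)
    (ideal_module {a + b | a b. a \<in> U \<and> b \<in> V})"
proof -
  let ?C = "mapping_cone (mat_of_rows_list 2 [[1, 1]] * aug A) G A \<phi>"
  note GD = resolutionD[OF G]
  note cA = exact_complexD(2)[OF A] and cG = exact_complexD(2)[OF GD(1)]
  have h\<phi>: "homogeneous_mat wt (shifts A i) (shifts G i) (\<phi> i)" for i
    using \<phi> by (simp add: chain_map_def)
  have c\<phi>: "\<phi> i \<in> carrier_mat (frank A i) (frank G i)" for i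
    using homogeneous_mat_carrier[OF h\<phi>] by (simp add: frank_def)
  have comm: "bd A i *\<^sub>v (\<phi> (Suc i) *\<^sub>v y) = \<phi> i *\<^sub>v (bd G i *\<^sub>v y)"
    if "y \<in> carrier_vec (frank G (Suc i))" for i y
    using assoc_mult_mat_vec[OF cA c\<phi> that] assoc_mult_mat_vec[OF c\<phi> cG that] \<phi>
    by (simp add: chain_map_def)
  have caug: "aug A \<in> carrier_mat 2 (frank A 0)"
    using homogeneous_mat_carrier[OF augA] by (simp add: frank_def numeral_2_eq_2)
  have aug\<phi>: "aug A *\<^sub>v (\<phi> 0 *\<^sub>v y) = vec_of_list [(aug G *\<^sub>v y) $ 0, - ((aug G *\<^sub>v y) $ 0)]"
    if "y \<in> carrier_vec (frank G 0)" for y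
    using assoc_mult_mat_vec[OF caug c\<phi> that] antidiagonal_column(2)[OF GD(3) that] \<phi>0 by simp
  have augC: "(aug ?C *\<^sub>v v) $ 0 = (aug A *\<^sub>v v) $ 0 + (aug A *\<^sub>v v) $ 1"
    if "v \<in> carrier_vec (frank A 0)" for v
    using sum_row(2)[OF caug that] by (simp add: mapping_cone_def)
  have bd0: "bd ?C 0 *\<^sub>v (x @\<^sub>v y) = bd A 0 *\<^sub>v x + \<phi> 0 *\<^sub>v y"
    if xy: "x \<in> carrier_vec (frank A 1)" "y \<in> carrier_vec (frank G 0)" for x y
  proof -
    have "four_block_mat (bd A 0) (\<phi> 0) (0\<^sub>m 0 (frank A 1)) (0\<^sub>m 0 (frank G 0)) *\<^sub>v (x @\<^sub>v y)
        = (bd A 0 *\<^sub>v x + \<phi> 0 *\<^sub>v y) @\<^sub>v (0\<^sub>m 0 (frank A 1) *\<^sub>v x + 0\<^sub>m 0 (frank G 0) *\<^sub>v y)"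
      using cA[of 0] xy by (intro four_block_mat_mult_vec[OF _ c\<phi> zero_carrier_mat zero_carrier_mat]) auto
    also have "\<dots> = bd A 0 *\<^sub>v x + \<phi> 0 *\<^sub>v y" by (intro eq_vecI) auto
    finally show ?thesis by (simp add: mapping_cone_def)
  qed
  have bdS: "bd ?C (Suc i) *\<^sub>v (x @\<^sub>v y) = (bd A (Suc i) *\<^sub>v x + \<phi> (Suc i) *\<^sub>v y) @\<^sub>v - (bd G i *\<^sub>v y)"
    if xy: "x \<in> carrier_vec (frank A (Suc (Suc i)))" "y \<in> carrier_vec (frank G (Suc i))" for i x y
  proof -
    have "four_block_mat (bd A (Suc i)) (\<phi> (Suc i)) (0\<^sub>m (frank G i) (frank A (Suc (Suc i)))) (- bd G i) *\<^sub>v (x @\<^sub>v y)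
        = (bd A (Suc i) *\<^sub>v x + \<phi> (Suc i) *\<^sub>v y)
          @\<^sub>v (0\<^sub>m (frank G i) (frank A (Suc (Suc i))) *\<^sub>v x + - bd G i *\<^sub>v y)"
      using cG[of i] xy by (intro four_block_mat_mult_vec[OF cA c\<phi> zero_carrier_mat]) auto
    also have "0\<^sub>m (frank G i) (frank A (Suc (Suc i))) *\<^sub>v x + - bd G i *\<^sub>v y = - (bd G i *\<^sub>v y)"
      using xy cG[of i] by (intro eq_vecI) auto
    finally show ?thesis by (simp add: mapping_cone_def)
  qed
  have exact: "\<exists>z\<in>carrier_vec (frank ?C (Suc (Suc i))). x @\<^sub>v y = bd ?C (Suc i) *\<^sub>v z"
    if xy: "x \<in> carrier_vec (frank A (Suc i))" "y \<in> carrier_vec (frank G i)"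
      and 0: "bd A i *\<^sub>v x + \<phi> i *\<^sub>v y = 0\<^sub>v (frank A i)"
      and z: "z \<in> carrier_vec (frank G (Suc i))" "y = bd G i *\<^sub>v z" for i x y z
  proof -
    have c: "\<phi> (Suc i) *\<^sub>v z \<in> carrier_vec (frank A (Suc i))"
      by (rule mult_mat_vec_carrier[OF c\<phi> z(1)])
    have "bd A i *\<^sub>v (x + \<phi> (Suc i) *\<^sub>v z) = 0\<^sub>v (frank A i)"
      using 0 comm[OF z(1)] z(2) by (simp add: mult_add_distrib_mat_vec[OF cA xy(1) c])
    then obtain w where w: "w \<in> carrier_vec (frank A (Suc (Suc i)))"
      and eq: "x + \<phi> (Suc i) *\<^sub>v z = bd A (Suc i) *\<^sub>v w"
      using exact_complexD(4)[OF A] add_carrier_vec[OF xy(1) c] by blast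
    have cw: "bd A (Suc i) *\<^sub>v w \<in> carrier_vec (frank A (Suc i))"
      by (rule mult_mat_vec_carrier[OF cA w])
    have "bd ?C (Suc i) *\<^sub>v (w @\<^sub>v - z) = x @\<^sub>v y"
    proof -
      have "bd A (Suc i) *\<^sub>v w + \<phi> (Suc i) *\<^sub>v (- z) = x"
        unfolding eq[symmetric] mult_mat_vec_uminus[OF c\<phi> z(1)] using xy(1) c by (intro eq_vecI) (auto simp del: index_mult_mat_vec)
      moreover have "- (bd G i *\<^sub>v (- z)) = y"
        unfolding mult_mat_vec_uminus[OF cG z(1)] using z(2) by simp
      ultimately show ?thesis using bdS[OF w, of "- z"] z(1) by simp
    qed
    then show ?thesis
      using w z(1) by (intro bexI[of _ "w @\<^sub>v - z"]) (simp_all add: frank_cone)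
  qed
  have "homogeneous_mat wt [0] [0, 0] (mat_of_rows_list 2 [[1, 1]] :: ('n, 'k) mpoly mat)"
    by (auto simp: homogeneous_mat_def mat_of_rows_list_def less_Suc_eq wt0 in_keys_iff lookup_one when_def
        split: if_splits)
  then have haug: "homogeneous_mat wt [0] (shifts ?C 0) (aug ?C)"
    using homogeneous_mat_mult[OF wt _ augA] by (simp add: mapping_cone_def)
  have hbd: "homogeneous_mat wt (shifts ?C i) (shifts ?C (Suc i)) (bd ?C i)" for i
  proof (cases i)
    case 0
    have "homogeneous_mat wt (shifts A 0 @ []) (shifts A (Suc 0) @ shifts G 0)
        (four_block_mat (bd A 0) (\<phi> 0) (0\<^sub>m 0 (frank A 1)) (0\<^sub>m 0 (frank G 0)))"
      by (rule homogeneous_four_block_mat[OF exact_complexD(1)[OF A] h\<phi>])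
        (simp_all add: homogeneous_mat_def frank_def)
    then show ?thesis by (simp add: 0 mapping_cone_def)
  next
    case (Suc j)
    have "homogeneous_mat wt (shifts A i @ shifts G j) (shifts A (Suc i) @ shifts G (Suc j))
        (four_block_mat (bd A i) (\<phi> i) (0\<^sub>m (frank G j) (frank A (Suc i))) (- bd G j))"
      unfolding Suc frank_def
      by (rule homogeneous_four_block_mat[OF exact_complexD(1)[OF A] h\<phi> homogeneous_mat_zero
            homogeneous_mat_uminus[OF exact_complexD(1)[OF GD(1)]]])
    then show ?thesis by (simp add: Suc mapping_cone_def)
  qed
  have im: "{a + b | a b. a \<in> U \<and> b \<in> V}
      = {(aug ?C *\<^sub>v v) $ 0 + d | v d. v \<in> carrier_vec (frank ?C 0) \<and> d \<in> {0}}" (is "?L = ?R")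
  proof (intro subset_antisym subsetI)
    fix c assume "c \<in> ?L"
    then obtain a b where ab: "c = a + b" "a \<in> U" "b \<in> V" by blast
    then obtain v where v: "v \<in> carrier_vec (frank A 0)" "aug A *\<^sub>v v = vec_of_list [a, b]"
      using imA[OF ab(2,3)] by blast
    then have "c = (aug ?C *\<^sub>v v) $ 0 + 0"
      using ab(1) by (simp add: augC del: index_mult_mat_vec)
    then show "c \<in> ?R" using v(1) unfolding frank_cone by blast
  next
    fix c assume "c \<in> ?R"
    then obtain v where v: "v \<in> carrier_vec (frank A 0)" and c: "c = (aug ?C *\<^sub>v v) $ 0"
      by (auto simp: frank_cone simp del: index_mult_mat_vec)
    obtain a b where "aug A *\<^sub>v v = vec_of_list [a, b]" "a \<in> U" "b \<in> V"
      using imA'[OF v] by blast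
    then show "c \<in> ?L" unfolding c augC[OF v] by auto
  qed
  have ker0: "{v \<in> carrier_vec (frank ?C 0). (aug ?C *\<^sub>v v) $ 0 \<in> {0}}
      = {bd ?C 0 *\<^sub>v w | w. w \<in> carrier_vec (frank ?C 1)}" (is "?L = ?R")
  proof (intro subset_antisym subsetI)
    fix v assume "v \<in> ?L"
    then have v: "v \<in> carrier_vec (frank A 0)" and v0: "(aug ?C *\<^sub>v v) $ 0 = 0"
      by (auto simp: frank_cone simp del: index_mult_mat_vec)
    obtain a b where ab: "aug A *\<^sub>v v = vec_of_list [a, b]" "a \<in> U" "b \<in> V"
      using imA'[OF v] by blast
    have "b = - a" using v0 unfolding augC[OF v] ab by (simp add: eq_neg_iff_add_eq_0 add.commute)
    then have "a \<in> U \<inter> V" using V[OF ab(3)] ab(2) by simp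
    then obtain y where y: "y \<in> carrier_vec (frank G 0)" "a = (aug G *\<^sub>v y) $ 0"
      using GD(4) by auto
    have cy: "\<phi> 0 *\<^sub>v y \<in> carrier_vec (frank A 0)" by (rule mult_mat_vec_carrier[OF c\<phi> y(1)])
    have "aug A *\<^sub>v (v - \<phi> 0 *\<^sub>v y) = aug A *\<^sub>v v - aug A *\<^sub>v (\<phi> 0 *\<^sub>v y)"
      by (rule mult_minus_distrib_mat_vec[OF caug v cy])
    also have "aug A *\<^sub>v (\<phi> 0 *\<^sub>v y) = aug A *\<^sub>v v"
      unfolding aug\<phi>[OF y(1)] ab(1) y(2)[symmetric] \<open>b = - a\<close> ..
    finally have "aug A *\<^sub>v (v - \<phi> 0 *\<^sub>v y) = 0\<^sub>v 2"
      using mult_mat_vec_carrier[OF caug v] by simp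
    then obtain x where x: "x \<in> carrier_vec (frank A 1)" "v - \<phi> 0 *\<^sub>v y = bd A 0 *\<^sub>v x"
      using kerA minus_carrier_vec[OF v cy] by blast
    have "v = bd ?C 0 *\<^sub>v (x @\<^sub>v y)"
      unfolding bd0[OF x(1) y(1)] x(2)[symmetric]
      by (rule eq_vecI) (use v cy c\<phi>[of 0] in \<open>auto simp del: index_mult_mat_vec\<close>)
    then show "v \<in> ?R" using x(1) y(1) by (auto simp: frank_cone)
  next
    fix v assume "v \<in> ?R"
    then obtain u where u: "u \<in> carrier_vec (frank A 1 + frank G 0)" and v: "v = bd ?C 0 *\<^sub>v u"
      by (auto simp: frank_cone)
    obtain x y where xy: "x \<in> carrier_vec (frank A 1)" "y \<in> carrier_vec (frank G 0)" "u = x @\<^sub>v y"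
      using carrier_vec_append_cases[OF u] .
    have cx: "bd A 0 *\<^sub>v x \<in> carrier_vec (frank A 0)" using cA[of 0] xy(1) by simp
    have cy: "\<phi> 0 *\<^sub>v y \<in> carrier_vec (frank A 0)" by (rule mult_mat_vec_carrier[OF c\<phi> xy(2)])
    have cv: "v \<in> carrier_vec (frank A 0)" unfolding v xy(3) bd0[OF xy(1,2)] using cx cy by simp
    have "aug A *\<^sub>v v = aug A *\<^sub>v (bd A 0 *\<^sub>v x) + aug A *\<^sub>v (\<phi> 0 *\<^sub>v y)"
      unfolding v xy(3) bd0[OF xy(1,2)] by (rule mult_add_distrib_mat_vec[OF caug cx cy])
    then have "(aug ?C *\<^sub>v v) $ 0 = 0"
      unfolding augC[OF cv] compA[OF xy(1)] aug\<phi>[OF xy(2)]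
      by (simp del: index_mult_mat_vec)
    then show "v \<in> ?L" using cv by (simp add: frank_cone del: index_mult_mat_vec)
  qed
  have kerS: "{v \<in> carrier_vec (frank ?C (Suc i)). bd ?C i *\<^sub>v v = 0\<^sub>v (frank ?C i)}
      = {bd ?C (Suc i) *\<^sub>v w | w. w \<in> carrier_vec (frank ?C (Suc (Suc i)))}" (is "?L = ?R") for i
  proof (intro subset_antisym subsetI)
    fix v assume "v \<in> ?L"
    then have v: "v \<in> carrier_vec (frank A (Suc i) + frank G i)"
      and v0: "bd ?C i *\<^sub>v v = 0\<^sub>v (frank ?C i)" by (auto simp: frank_cone)
    obtain x y where xy: "x \<in> carrier_vec (frank A (Suc i))" "y \<in> carrier_vec (frank G i)" "v = x @\<^sub>v y"
      using carrier_vec_append_cases[OF v] .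
    have "bd A i *\<^sub>v x + \<phi> i *\<^sub>v y = 0\<^sub>v (frank A i) \<and>
      (\<exists>z\<in>carrier_vec (frank G (Suc i)). y = bd G i *\<^sub>v z)"
    proof (cases i)
      case 0
      have x0: "x \<in> carrier_vec (frank A 1)" and y0: "y \<in> carrier_vec (frank G 0)"
        using xy 0 by simp_all
      have cx: "bd A 0 *\<^sub>v x \<in> carrier_vec (frank A 0)" using cA[of 0] x0 by simp
      have cy: "\<phi> 0 *\<^sub>v y \<in> carrier_vec (frank A 0)" by (rule mult_mat_vec_carrier[OF c\<phi> y0])
      have eq: "bd A 0 *\<^sub>v x + \<phi> 0 *\<^sub>v y = 0\<^sub>v (frank A 0)"
        using v0 bd0[OF x0 y0] by (simp add: 0 xy(3) frank_cone)
      \<comment> \<open>In degree 1 the differential of the cone has no component in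
        \<open>G\<close>, so it does not say directly that y is a syzygy. This is read off from the
        first coordinate after applying \<open>aug A\<close>.\<close>
      have "aug A *\<^sub>v (bd A 0 *\<^sub>v x) + aug A *\<^sub>v (\<phi> 0 *\<^sub>v y) = 0\<^sub>v 2"
        unfolding mult_add_distrib_mat_vec[OF caug cx cy, symmetric] eq using caug by simp
      then have "(0\<^sub>v 2 + vec_of_list [(aug G *\<^sub>v y) $ 0, - ((aug G *\<^sub>v y) $ 0)]) $ 0 = (0\<^sub>v 2 :: ('n, 'k) mpoly vec) $ 0"
        unfolding compA[OF x0] aug\<phi>[OF y0] by simp
      then have "(aug G *\<^sub>v y) $ 0 \<in> {0}"
        by (simp del: index_mult_mat_vec)
      from GD(6)[OF y0 this] eq show ?thesis by (simp add: 0)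
    next
      case (Suc j)
      have x0: "x \<in> carrier_vec (frank A (Suc (Suc j)))" and y0: "y \<in> carrier_vec (frank G (Suc j))"
        using xy Suc by simp_all
      have cx: "bd A (Suc j) *\<^sub>v x + \<phi> (Suc j) *\<^sub>v y \<in> carrier_vec (frank A (Suc j))"
        using mult_mat_vec_carrier[OF cA x0] mult_mat_vec_carrier[OF c\<phi> y0] by (rule add_carrier_vec)
      have "(bd A (Suc j) *\<^sub>v x + \<phi> (Suc j) *\<^sub>v y) @\<^sub>v - (bd G j *\<^sub>v y)
          = 0\<^sub>v (frank A (Suc j)) @\<^sub>v 0\<^sub>v (frank G j)"
        using v0 bdS[OF x0 y0] by (simp add: Suc xy(3) frank_cone zero_vec_append)
      then have *: "bd A (Suc j) *\<^sub>v x + \<phi> (Suc j) *\<^sub>v y = 0\<^sub>v (frank A (Suc j))"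
        "- (bd G j *\<^sub>v y) = 0\<^sub>v (frank G j)"
        using append_vec_eq[OF cx zero_carrier_vec] by blast+
      have "bd G j *\<^sub>v y = 0\<^sub>v (frank G j)"
        using *(2) uminus_zero_vec_eq[OF mult_mat_vec_carrier[OF cG y0]] by blast
      from exact_complexD(4)[OF GD(1) y0 this] *(1) show ?thesis by (simp add: Suc)
    qed
    then show "v \<in> ?R" using exact[OF xy(1,2)] xy(3) by blast
  next
    fix v assume "v \<in> ?R"
    then obtain u where u: "u \<in> carrier_vec (frank A (Suc (Suc i)) + frank G (Suc i))"
      and v: "v = bd ?C (Suc i) *\<^sub>v u" by (auto simp: frank_cone)
    obtain x y where xy: "x \<in> carrier_vec (frank A (Suc (Suc i)))" "y \<in> carrier_vec (frank G (Suc i))" "u = x @\<^sub>v y"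
      using carrier_vec_append_cases[OF u] .
    have c1: "bd A (Suc i) *\<^sub>v x \<in> carrier_vec (frank A (Suc i))" by (rule mult_mat_vec_carrier[OF cA xy(1)])
    have c2: "\<phi> (Suc i) *\<^sub>v y \<in> carrier_vec (frank A (Suc i))" by (rule mult_mat_vec_carrier[OF c\<phi> xy(2)])
    have c3: "bd G i *\<^sub>v y \<in> carrier_vec (frank G i)" by (rule mult_mat_vec_carrier[OF cG xy(2)])
    have v': "v = (bd A (Suc i) *\<^sub>v x + \<phi> (Suc i) *\<^sub>v y) @\<^sub>v - (bd G i *\<^sub>v y)"
      unfolding v xy(3) by (rule bdS[OF xy(1,2)])
    have "bd A i *\<^sub>v (bd A (Suc i) *\<^sub>v x + \<phi> (Suc i) *\<^sub>v y) = \<phi> i *\<^sub>v (bd G i *\<^sub>v y)"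
      unfolding mult_add_distrib_mat_vec[OF cA c1 c2] comm[OF xy(2)] exact_complexD(3)[OF A xy(1)]
      using mult_mat_vec_carrier[OF c\<phi> c3] by simp
    \<comment> \<open>The sign in the differential of the cone makes the two occurrences of \<phi>
      (bd y) cancel.\<close>
    then have cycle: "bd A i *\<^sub>v (bd A (Suc i) *\<^sub>v x + \<phi> (Suc i) *\<^sub>v y) + \<phi> i *\<^sub>v (- (bd G i *\<^sub>v y)) = 0\<^sub>v (frank A i)"
      unfolding mult_mat_vec_uminus[OF c\<phi> c3] using mult_mat_vec_carrier[OF c\<phi> c3] by simp
    have "bd ?C i *\<^sub>v v = 0\<^sub>v (frank ?C i)"
    proof (cases i)
      case 0
      show ?thesis
        using bd0[of "bd A 1 *\<^sub>v x + \<phi> 1 *\<^sub>v y" "- (bd G 0 *\<^sub>v y)"] c1 c2 c3 cycle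
        by (simp add: 0 v' frank_cone)
    next
      case (Suc j)
      show ?thesis
        using bdS[of "bd A (Suc i) *\<^sub>v x + \<phi> (Suc i) *\<^sub>v y" j "- (bd G i *\<^sub>v y)"] c1 c2 c3 cycle
          mult_mat_vec_uminus[OF cG[of j] c3[unfolded Suc]] exact_complexD(3)[OF GD(1), of y j] xy(2)
        by (simp add: v' frank_cone zero_vec_append Suc)
    qed
    then show "v \<in> ?L" using c1 c2 c3 by (simp add: v' frank_cone)
  qed
  show ?thesis
    unfolding graded_free_resolution_def fst_conv snd_conv
    using haug hbd im ker0 kerS by blast
qed

section \<open>Minimality of cones\<close>

lemma elements_mat_iff:
  "elements_mat A \<subseteq> S \<longleftrightarrow> (\<forall>p<dim_row A. \<forall>q<dim_col A. A $$ (p, q) \<in> S)"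
  by (force simp: elements_mat_def)

lemma zero_in_max_homogeneous_ideal [simp]: "0 \<in> max_homogeneous_ideal"
  unfolding max_homogeneous_ideal_def by (rule ideal_gen_zero)

lemma elements_zero_mat: "elements_mat (0\<^sub>m r s) \<subseteq> max_homogeneous_ideal"
  by (simp add: elements_mat_iff)

lemma elements_uminus_mat:
  fixes A :: "('n, 'k::field) mpoly mat"
  assumes "elements_mat A \<subseteq> max_homogeneous_ideal"
  shows "elements_mat (- A) \<subseteq> max_homogeneous_ideal"
  using assms by (simp add: elements_mat_iff max_homogeneous_ideal_iff)

lemma elements_homogeneous_mat:
  assumes "homogeneous_mat (\<lambda>a. a) rs cs A" and "set rs \<inter> set cs = {}"
  shows "elements_mat A \<subseteq> max_homogeneous_ideal"
  unfolding elements_mat_iff max_homogeneous_ideal_iff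
proof (intro allI impI)
  fix p q assume "p < dim_row A" "q < dim_col A"
  then have pq: "p < length rs" "q < length cs" using homogeneous_mat_carrier[OF assms(1)] by auto
  then have "rs ! p \<noteq> cs ! q" using assms(2) nth_mem by fastforce
  then have "0 \<notin> Poly_Mapping.keys (A $$ (p, q))"
    using assms(1) pq by (force simp: homogeneous_mat_def)
  then show "Poly_Mapping.lookup (A $$ (p, q)) 0 = 0" by (simp add: in_keys_iff)
qed

lemma cone_minimal:
  assumes A: "\<And>i. elements_mat (bd A i) \<subseteq> max_homogeneous_ideal"
    and G: "\<And>i. elements_mat (bd G i) \<subseteq> max_homogeneous_ideal"
    and \<phi>: "\<And>i. elements_mat (\<phi> i) \<subseteq> max_homogeneous_ideal"
    and c: "\<And>i. bd A i \<in> carrier_mat (frank A i) (frank A (Suc i))"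
      "\<And>i. bd G i \<in> carrier_mat (frank G i) (frank G (Suc i))"
      "\<And>i. \<phi> i \<in> carrier_mat (frank A i) (frank G i)"
  shows "elements_mat (bd (mapping_cone \<epsilon> G A \<phi>) i) \<subseteq> max_homogeneous_ideal"
proof (cases i)
  case 0
  have "elements_mat (four_block_mat (bd A 0) (\<phi> 0) (0\<^sub>m 0 (frank A 1)) (0\<^sub>m 0 (frank G 0))) \<subseteq>
    elements_mat (bd A 0) \<union> elements_mat (\<phi> 0) \<union> elements_mat (0\<^sub>m 0 (frank A 1)) \<union> elements_mat (0\<^sub>m 0 (frank G 0))"
    using c(1)[of 0] c(3)[of 0] by (intro elements_four_block_mat) auto
  also have "\<dots> \<subseteq> max_homogeneous_ideal"
    by (intro Un_least A \<phi> elements_zero_mat)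
  finally show ?thesis by (simp add: 0 mapping_cone_def)
next
  case (Suc j)
  have "elements_mat (four_block_mat (bd A i) (\<phi> i) (0\<^sub>m (frank G j) (frank A (Suc i))) (- bd G j)) \<subseteq>
    elements_mat (bd A i) \<union> elements_mat (\<phi> i) \<union> elements_mat (0\<^sub>m (frank G j) (frank A (Suc i))) \<union> elements_mat (- bd G j)"
    using c(1)[of i] c(2)[of j] c(3)[of i] by (intro elements_four_block_mat) (auto simp: Suc)
  also have "\<dots> \<subseteq> max_homogeneous_ideal"
    by (intro Un_least A \<phi> elements_zero_mat elements_uminus_mat G)
  finally show ?thesis by (simp add: Suc mapping_cone_def)
qed

text \<open>Constant entries of the comparison map can only occur between equal multidegrees, so the
  cone is minimal as soon as the multidegrees of source and target are disjoint.\<close>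

lemma iterated_cone_step:
  fixes F G :: "('n \<Rightarrow>\<^sub>0 nat, 'n, 'k::field) free_complex" and I I' :: "('n, 'k) mpoly set"
  assumes gs: "gs \<noteq> []" and gens: "minimal_monomial_generators I (gs @ [g])"
    and I': "I' = ideal_gen (monomial ` set gs)"
    and F: "iterated_mapping_cone I' F" "minimal_free_resolution (\<lambda>a. a) F (ideal_module I')"
    and G: "iterated_mapping_cone (I' \<inter> ideal_gen {monomial g}) G"
      "minimal_free_resolution (\<lambda>a. a) G (ideal_module (I' \<inter> ideal_gen {monomial g}))"
    and disj: "\<And>i. set (shifts F i) \<inter> set (shifts G i) = {}" "g \<notin> set (shifts G 0)"
  shows "\<exists>H. iterated_mapping_cone I H \<and> minimal_free_resolution (\<lambda>a. a) H (ideal_module I) \<and>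
    (\<forall>i. shifts H i = shifts F i @ (case i of 0 \<Rightarrow> [g] | Suc j \<Rightarrow> shifts G j))"
proof -
  let ?P = "principal_resolution g :: (_, 'n, 'k) free_complex"
  let ?V = "ideal_gen {monomial g} :: ('n, 'k) mpoly set"
  let ?A = "direct_sum F ?P"
  have rF: "graded_free_resolution (\<lambda>a. a) F (ideal_module I')"
    and rG: "graded_free_resolution (\<lambda>a. a) G (ideal_module (I' \<inter> ?V))"
    and rP: "graded_free_resolution (\<lambda>a. a) ?P (ideal_module ?V)"
    using F(2) G(2) principal_resolution_minimal unfolding minimal_free_resolution_def by blast+
  note FD = resolutionD[OF rF] and GD = resolutionD[OF rG] and PD = resolutionD[OF rP]
  have A: "exact_complex (\<lambda>a. a) ?A" by (rule exact_direct_sum[OF FD(1) PD(1)])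
  have augA: "homogeneous_mat (\<lambda>a. a) [0, 0] (shifts ?A 0) (aug ?A)"
    using homogeneous_diag_block_mat[OF FD(2) PD(2)] by (simp add: direct_sum_def del: diag_block_mat.simps)
  have aug: "aug ?A *\<^sub>v (x @\<^sub>v y) = vec_of_list [(aug F *\<^sub>v x) $ 0, (aug ?P *\<^sub>v y) $ 0]"
    if xy: "x \<in> carrier_vec (frank F 0)" "y \<in> carrier_vec (frank ?P 0)" for x y
  proof -
    have "aug ?A *\<^sub>v (x @\<^sub>v y) = (aug F *\<^sub>v x) @\<^sub>v (aug ?P *\<^sub>v y)"
      using diag_block_mat_mult_vec[OF FD(3) PD(3) xy]
      by (simp add: direct_sum_def del: diag_block_mat.simps)
    also have "\<dots> = vec_of_list [(aug F *\<^sub>v x) $ 0, (aug ?P *\<^sub>v y) $ 0]"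
    proof (rule eq_vecI)
      fix i assume "i < dim_vec (vec_of_list [(aug F *\<^sub>v x) $ 0, (aug ?P *\<^sub>v y) $ 0])"
      then have "i = 0 \<or> i = 1" by auto
      then show "((aug F *\<^sub>v x) @\<^sub>v (aug ?P *\<^sub>v y)) $ i = vec_of_list [(aug F *\<^sub>v x) $ 0, (aug ?P *\<^sub>v y) $ 0] $ i"
        using FD(3) PD(3) by (auto simp del: index_mult_mat_vec)
    qed (use FD(3) PD(3) in simp)
    finally show ?thesis .
  qed
  have bdA: "bd ?A 0 *\<^sub>v (x @\<^sub>v y) = (bd F 0 *\<^sub>v x) @\<^sub>v (bd ?P 0 *\<^sub>v y)"
    if "x \<in> carrier_vec (frank F 1)" "y \<in> carrier_vec (frank ?P 1)" for x y
    using diag_block_mat_mult_vec[OF exact_complexD(2)[OF FD(1)] exact_complexD(2)[OF PD(1)], of x 0 y 0] that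
    by (simp add: direct_sum_def del: diag_block_mat.simps frank_principal)
  have split: "\<exists>x\<in>carrier_vec (frank F i). \<exists>y\<in>carrier_vec (frank ?P i). v = x @\<^sub>v y"
    if "v \<in> carrier_vec (frank ?A i)" for v i
    using that carrier_vec_append_cases unfolding frank_direct_sum by blast
  have app: "x @\<^sub>v y \<in> carrier_vec (frank ?A i)"
    if "x \<in> carrier_vec (frank F i)" "y \<in> carrier_vec (frank ?P i)" for x y i
    using that unfolding frank_direct_sum by (rule append_carrier_vec)
  have kerA: "\<exists>w\<in>carrier_vec (frank ?A 1). v = bd ?A 0 *\<^sub>v w"
    if v: "v \<in> carrier_vec (frank ?A 0)" and v0: "aug ?A *\<^sub>v v = 0\<^sub>v 2" for v
  proof -
    obtain x y where xy: "x \<in> carrier_vec (frank F 0)" "y \<in> carrier_vec (frank ?P 0)" "v = x @\<^sub>v y"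
      using split[OF v] by blast
    have "vec_of_list [(aug F *\<^sub>v x) $ 0, (aug ?P *\<^sub>v y) $ 0] = 0\<^sub>v 2"
      using v0 aug[OF xy(1,2)] xy(3) by simp
    then have "vec_of_list [(aug F *\<^sub>v x) $ 0, (aug ?P *\<^sub>v y) $ 0] $ i = 0" if "i < 2" for i
      using that by simp
    from this[of 0] this[of 1] have "(aug F *\<^sub>v x) $ 0 \<in> {0}" "(aug ?P *\<^sub>v y) $ 0 \<in> {0}"
      by (simp_all del: index_mult_mat_vec)
    then obtain z w where zw: "z \<in> carrier_vec (frank F 1)" "x = bd F 0 *\<^sub>v z"
      "w \<in> carrier_vec (frank ?P 1)" "y = bd ?P 0 *\<^sub>v w"
      using FD(6)[OF xy(1)] PD(6)[OF xy(2)] by blast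
    then show ?thesis
      by (intro bexI[OF _ app[OF zw(1,3)]]) (simp only: xy(3) bdA[OF zw(1,3)])
  qed
  have compA: "aug ?A *\<^sub>v (bd ?A 0 *\<^sub>v w) = 0\<^sub>v 2" if w: "w \<in> carrier_vec (frank ?A 1)" for w
  proof -
    obtain x y where xy: "x \<in> carrier_vec (frank F 1)" "y \<in> carrier_vec (frank ?P 1)" "w = x @\<^sub>v y"
      using split[OF w] by blast
    have "bd F 0 *\<^sub>v x \<in> carrier_vec (frank F 0)" "bd ?P 0 *\<^sub>v y \<in> carrier_vec (frank ?P 0)"
      using exact_complexD(2)[OF FD(1), of 0] exact_complexD(2)[OF PD(1), of 0] xy by auto
    from aug[OF this] FD(7)[OF xy(1)] PD(7)[OF xy(2)] show ?thesis
      unfolding xy(3) bdA[OF xy(1,2)] by (auto simp: numeral_2_eq_2 zero_vec_Suc simp del: index_mult_mat_vec)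
  qed
  have imA: "\<exists>v\<in>carrier_vec (frank ?A 0). aug ?A *\<^sub>v v = vec_of_list [a, b]"
    if ab: "a \<in> I'" "b \<in> ?V" for a b
  proof -
    obtain x y where xy: "x \<in> carrier_vec (frank F 0)" "a = (aug F *\<^sub>v x) $ 0"
      "y \<in> carrier_vec (frank ?P 0)" "b = (aug ?P *\<^sub>v y) $ 0"
      using FD(4)[OF ab(1)] PD(4)[OF ab(2)] by auto
    show ?thesis using aug[OF xy(1,3)] app[OF xy(1,3)] xy(2,4) by blast
  qed
  have imA': "\<exists>a\<in>I'. \<exists>b\<in>?V. aug ?A *\<^sub>v v = vec_of_list [a, b]"
    if v: "v \<in> carrier_vec (frank ?A 0)" for v
  proof -
    obtain x y where xy: "x \<in> carrier_vec (frank F 0)" "y \<in> carrier_vec (frank ?P 0)" "v = x @\<^sub>v y"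
      using split[OF v] by blast
    show ?thesis
      using FD(5)[OF xy(1), of 0] PD(5)[OF xy(2), of 0] aug[OF xy(1,2)] xy(3) by auto
  qed
  have V: "- a \<in> ?V" if "a \<in> ?V" for a
    using ideal_gen_mult[OF that, of "- 1"] by simp
  obtain \<phi> where \<phi>: "chain_map (\<lambda>a. a) G ?A \<phi>"
    and \<phi>0: "aug ?A * \<phi> 0 = mat_of_rows_list 1 [[1], [- 1]] * aug G"
    using cone_chain_map[OF refl refl A augA kerA imA V rG] by blast
  let ?H = "mapping_cone (mat_of_rows_list 2 [[1, 1]] * aug ?A) G ?A \<phi>"
  have "I = ideal_gen (monomial ` set gs \<union> {monomial g})"
    using gens by (simp add: minimal_monomial_generators_def)
  then have I: "{a + b | a b. a \<in> I' \<and> b \<in> ?V} = I"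
    unfolding ideal_gen_Un I' by simp
  have "iterated_mapping_cone I ?H"
    by (rule iterated_mapping_cone.cone[OF gs gens I' F(1) G(1) refl \<phi> \<phi>0])
  moreover have "graded_free_resolution (\<lambda>a. a) ?H (ideal_module I)"
    using cone_resolution[OF refl refl A augA kerA compA imA imA' V rG \<phi> \<phi>0] unfolding I .
  moreover have "elements_mat (bd ?H i) \<subseteq> max_homogeneous_ideal" for i
  proof (rule cone_minimal)
    have h\<phi>: "homogeneous_mat (\<lambda>a. a) (shifts ?A i) (shifts G i) (\<phi> i)" for i
      using \<phi> by (simp add: chain_map_def)
    show "\<phi> i \<in> carrier_mat (frank ?A i) (frank G i)" for i
      using homogeneous_mat_carrier[OF h\<phi>] by (simp add: frank_def)
    show "bd ?A i \<in> carrier_mat (frank ?A i) (frank ?A (Suc i))" for i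
      by (rule exact_complexD(2)[OF A])
    show "bd G i \<in> carrier_mat (frank G i) (frank G (Suc i))" for i
      by (rule exact_complexD(2)[OF GD(1)])
    show "elements_mat (bd G i) \<subseteq> max_homogeneous_ideal" for i
      using G(2) by (simp add: minimal_free_resolution_def)
    \<comment> \<open>The principal summand contributes only \<open>g\<close>, and only in degree 0;
      this is what the separate condition on \<open>g\<close> in \<open>disj\<close> is for.\<close>
    have "set (shifts ?A i) \<inter> set (shifts G i) = {}" for i
      using disj(1)[of i] disj(2) by (cases i) (simp_all add: direct_sum_def principal_resolution_def)
    then show "elements_mat (\<phi> i) \<subseteq> max_homogeneous_ideal" for i
      using elements_homogeneous_mat[OF h\<phi>] by blast
    show "elements_mat (bd ?A i) \<subseteq> max_homogeneous_ideal" for i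
    proof -
      have "elements_mat (bd F i) \<subseteq> max_homogeneous_ideal" "elements_mat (bd ?P i) \<subseteq> max_homogeneous_ideal"
        using F(2) principal_resolution_minimal unfolding minimal_free_resolution_def by blast+
      then have "{0} \<union> \<Union> (set (map elements_mat [bd F i, bd ?P i])) \<subseteq> max_homogeneous_ideal"
        by simp
      then have "elements_mat (diag_block_mat [bd F i, bd ?P i]) \<subseteq> max_homogeneous_ideal"
        by (rule subset_trans[OF elements_diag_block_mat])
      then show ?thesis by (simp add: direct_sum_def del: diag_block_mat.simps)
    qed
  qed
  moreover have "shifts ?H i = shifts F i @ (case i of 0 \<Rightarrow> [g] | Suc j \<Rightarrow> shifts G j)" for i
    by (cases i) (simp_all add: mapping_cone_def direct_sum_def principal_resolution_def)
  ultimately show ?thesis unfolding minimal_free_resolution_def by blast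
qed

subsection \<open>Monomial ideals with linear quotients by pure powers\<close>

abbreviation xpow :: "'n \<Rightarrow> nat \<Rightarrow> ('n \<Rightarrow>\<^sub>0 nat)" where
  "xpow x e \<equiv> Poly_Mapping.single x e"

lemma lookup_xpow: "Poly_Mapping.lookup (xpow x e) y = (if x = y then e else 0)"
  by (simp add: lookup_single when_def)

lemma total_degree_add: "total_degree (a + b) = total_degree a + total_degree b"
  by (simp add: total_degree_def lookup_add sum.distrib)

lemma total_degree_0 [simp]: "total_degree 0 = 0"
  by (simp add: total_degree_def)

lemma total_degree_xpow [simp]: "total_degree (xpow x e) = int e"
  by (simp add: total_degree_def lookup_xpow)

text \<open>Multidegrees of the iterated mapping cone resolving \<open>g\<close> times the ideal generated by
  the powers \<open>x\<^sup>e\<close> with \<open>(x, e)\<close> in the list.\<close>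

fun koszul_shifts :: "('n \<Rightarrow>\<^sub>0 nat) \<Rightarrow> ('n \<times> nat) list \<Rightarrow> nat \<Rightarrow> ('n \<Rightarrow>\<^sub>0 nat) list" where
  "koszul_shifts g [] i = []"
| "koszul_shifts g ((x, e) # ps) i = koszul_shifts g ps i @
     (case i of 0 \<Rightarrow> [g + xpow x e] | Suc j \<Rightarrow> koszul_shifts (g + xpow x e) ps j)"

lemma set_koszul_shifts_0: "set (koszul_shifts g ps 0) = (\<lambda>(x, e). g + xpow x e) ` set ps"
  by (induction ps) auto

text \<open>The recursion is Pascal's rule. The lower index is \<open>Suc i\<close> because the
  ideal is resolved rather than its quotient ring, so degree i carries the subsets of size i +
  1.\<close>

lemma length_koszul_shifts: "length (koszul_shifts g ps i) = length ps choose Suc i"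
  by (induction g ps i rule: koszul_shifts.induct) (auto split: nat.split)

lemma lookup_koszul_shifts_eq:
  "x \<notin> fst ` set ps \<Longrightarrow> s \<in> set (koszul_shifts g ps i) \<Longrightarrow>
    Poly_Mapping.lookup s x = Poly_Mapping.lookup g x"
  by (induction g ps i rule: koszul_shifts.induct)
    (auto simp: lookup_add lookup_xpow split: nat.splits)

text \<open>Each multidegree is \<open>g\<close> times a product of listed powers taken at distinct
  positions, and a variable listed once contributes at most one of them.\<close>

lemma lookup_koszul_shifts_le:
  assumes "distinct (map fst ps)" and "\<And>e. (x, e) \<in> set ps \<Longrightarrow> e \<le> K"
    and "s \<in> set (koszul_shifts g ps i)"
  shows "Poly_Mapping.lookup s x \<le> Poly_Mapping.lookup g x + K"
  using assms
proof (induction g ps i rule: koszul_shifts.induct)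
  case (2 g y e ps i)
  consider "s \<in> set (koszul_shifts g ps i)" | "s = g + xpow y e"
    | j where "i = Suc j" "s \<in> set (koszul_shifts (g + xpow y e) ps j)"
    using "2.prems"(3) by (auto split: nat.splits)
  then show ?case
  proof cases
    case 1
    then show ?thesis using 2 by auto
  next
    case 2
    then show ?thesis using "2.prems"(2) by (auto simp: lookup_add lookup_xpow)
  next
    case 3
    show ?thesis
    proof (cases "x = y")
      case True
      then have "Poly_Mapping.lookup s x = Poly_Mapping.lookup (g + xpow y e) x"
        using "2.prems"(1) 3 by (intro lookup_koszul_shifts_eq[of x ps]) auto
      then show ?thesis using True "2.prems"(2) by (auto simp: lookup_add lookup_xpow)
    next
      case False
      then show ?thesis using "2.IH"(2)[OF 3(1)] 3 "2.prems" by (auto simp: lookup_add lookup_xpow)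
    qed
  qed
qed simp

text \<open>A subset T of size i + 1 gives degree deg g plus the sum of e over T. Subtracting i
  leaves deg g + 1 plus the sum of e - 1 over T, which is largest for the full list.\<close>

lemma total_degree_koszul_shifts:
  fixes g :: "'n::finite \<Rightarrow>\<^sub>0 nat"
  assumes "\<And>x e. (x, e) \<in> set ps \<Longrightarrow> e \<ge> 1" and "s \<in> set (koszul_shifts g ps i)"
  shows "total_degree s > total_degree g"
    and "total_degree s - int i \<le> total_degree g + 1 + (\<Sum>(x, e)\<leftarrow>ps. int e - 1)"
proof -
  have "total_degree s > total_degree g \<and>
    total_degree s - int i \<le> total_degree g + 1 + (\<Sum>(x, e)\<leftarrow>ps. int e - 1)"
    using assms
  proof (induction g ps i rule: koszul_shifts.induct)
    case (2 g y e ps i)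
    have e: "e \<ge> 1" and ps: "\<And>x e. (x, e) \<in> set ps \<Longrightarrow> e \<ge> 1" using "2.prems"(1) by auto
    have nonneg: "(\<Sum>(x, e)\<leftarrow>ps. int e - 1) \<ge> 0"
      using ps by (intro sum_list_nonneg) force
    consider "s \<in> set (koszul_shifts g ps i)" | "i = 0" "s = g + xpow y e"
      | j where "i = Suc j" "s \<in> set (koszul_shifts (g + xpow y e) ps j)"
      using "2.prems"(2) by (auto split: nat.splits)
    then show ?case
    proof cases
      case 1
      with "2.IH"(1) ps have "total_degree s > total_degree g \<and>
        total_degree s - int i \<le> total_degree g + 1 + (\<Sum>(x, e)\<leftarrow>ps. int e - 1)" by blast
      then show ?thesis using e by simp
    next
      case 2
      then show ?thesis using e nonneg by (simp add: total_degree_add)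
    next
      case 3
      with "2.IH"(2) ps have "total_degree s > total_degree (g + xpow y e) \<and> total_degree s - int j
        \<le> total_degree (g + xpow y e) + 1 + (\<Sum>(x, e)\<leftarrow>ps. int e - 1)" by blast
      then show ?thesis using 3(1) e by (simp add: total_degree_add)
    qed
  qed simp
  then show "total_degree s > total_degree g"
    "total_degree s - int i \<le> total_degree g + 1 + (\<Sum>(x, e)\<leftarrow>ps. int e - 1)" by auto
qed

text \<open>The full list is the subset belonging to the last homological degree, and it attains the
  bound of \<open>total_degree_koszul_shifts\<close>.\<close>

lemma top_koszul_shift:
  "ps \<noteq> [] \<Longrightarrow> \<exists>s\<in>set (koszul_shifts g ps (length ps - 1)).
    total_degree s = total_degree g + (\<Sum>(x, e)\<leftarrow>ps. int e)"
proof (induction ps arbitrary: g)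
  case (Cons p ps)
  obtain x e where p: "p = (x, e)" by fastforce
  show ?case
  proof (cases "ps = []")
    case False
    then obtain s where "s \<in> set (koszul_shifts (g + xpow x e) ps (length ps - 1))"
      "total_degree s = total_degree (g + xpow x e) + (\<Sum>(x, e)\<leftarrow>ps. int e)"
      using Cons.IH by blast
    moreover obtain k where "length ps = Suc k" using False by (cases ps) auto
    ultimately show ?thesis
      by (intro bexI[of _ s]) (auto simp: p total_degree_add)
  qed (simp add: p total_degree_add)
qed simp

section \<open>Iterated cones controlled by their multidegrees\<close>

definition antichain :: "('n \<Rightarrow>\<^sub>0 nat) set \<Rightarrow> bool" where
  "antichain S \<longleftrightarrow> (\<forall>g\<in>S. \<forall>h\<in>S. mdvd h g \<longrightarrow> h = g)"

lemma minimal_monomial_generatorsI: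
  assumes "distinct gs" and "antichain (set gs)"
  shows "minimal_monomial_generators (ideal_gen (monomial ` set gs) :: ('n, 'k::field) mpoly set) gs"
  unfolding minimal_monomial_generators_def
proof (intro conjI ballI)
  fix g assume g: "g \<in> set gs"
  have "(monomial g :: ('n, 'k) mpoly) \<notin> ideal_gen (monomial ` (set gs - {g}))"
    using assms(2) g by (auto simp: ideal_gen_monomials antichain_def)
  then show "(monomial g :: ('n, 'k) mpoly) \<notin> ideal_gen (monomial ` (set gs - {g}))" .
qed (use assms in simp_all)

text \<open>The multidegrees \<open>sh 0\<close> are those of the minimal generators, so \<open>sh\<close> determines the ideal.\<close>

definition resolved :: "'k::field itself \<Rightarrow> (nat \<Rightarrow> ('n \<Rightarrow>\<^sub>0 nat) list) \<Rightarrow> bool" where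
  "resolved _ sh \<longleftrightarrow> distinct (sh 0) \<and> antichain (set (sh 0)) \<and>
     (\<exists>F. iterated_mapping_cone (ideal_gen (monomial ` set (sh 0)) :: ('n, 'k) mpoly set) F \<and>
       minimal_free_resolution (\<lambda>a. a) F (ideal_module (ideal_gen (monomial ` set (sh 0)))) \<and>
       shifts F = sh)"

lemma resolved_principal:
  fixes g :: "'n \<Rightarrow>\<^sub>0 nat"
  shows "resolved TYPE('k::field) (\<lambda>i. case i of 0 \<Rightarrow> [g] | Suc j \<Rightarrow> [])"
proof -
  have "shifts (principal_resolution g :: (_, 'n, 'k) free_complex) = (\<lambda>i. case i of 0 \<Rightarrow> [g] | Suc j \<Rightarrow> [])"
    by (auto simp: principal_resolution_def split: nat.split)
  then show ?thesis
    unfolding resolved_def antichain_def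
    using iterated_mapping_cone.principal[of g] principal_resolution_minimal[of g] by auto
qed

text \<open>The hypothesis on \<open>x\<close> keeps the multidegrees of the two resolutions apart, whence
  the cone is minimal.\<close>

lemma resolved_add_generator:
  fixes g :: "'n::finite \<Rightarrow>\<^sub>0 nat"
  assumes F: "resolved TYPE('k::field) sh" and G: "resolved TYPE('k) (koszul_shifts g ps)"
    and ne: "sh 0 \<noteq> []" and ps: "\<And>x e. (x, e) \<in> set ps \<Longrightarrow> e \<ge> 1"
    and x: "x \<notin> fst ` set ps"
    and lt: "\<And>i s. s \<in> set (sh i) \<Longrightarrow> Poly_Mapping.lookup s x < Poly_Mapping.lookup g x"
    and ndvd: "\<And>h. h \<in> set (sh 0) \<Longrightarrow> \<not> mdvd h g"
    and colon: "\<And>a. (\<exists>h\<in>set (sh 0). mdvd h a) \<and> mdvd g a \<longleftrightarrow> (\<exists>(y, e)\<in>set ps. mdvd (g + xpow y e) a)"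
  shows "resolved TYPE('k) (\<lambda>i. sh i @ (case i of 0 \<Rightarrow> [g] | Suc j \<Rightarrow> koszul_shifts g ps j))"
proof -
  let ?I' = "ideal_gen (monomial ` set (sh 0)) :: ('n, 'k) mpoly set"
  have int: "?I' \<inter> ideal_gen {monomial g} = ideal_gen (monomial ` set (koszul_shifts g ps 0))"
    by (intro ideal_gen_monomial_Int) (simp add: colon set_koszul_shifts_0 case_prod_beta)
  obtain F where F': "iterated_mapping_cone ?I' F" "minimal_free_resolution (\<lambda>a. a) F (ideal_module ?I')"
    "shifts F = sh" using F unfolding resolved_def by blast
  obtain G where G': "iterated_mapping_cone (?I' \<inter> ideal_gen {monomial g}) G"
    "minimal_free_resolution (\<lambda>a. a) G (ideal_module (?I' \<inter> ideal_gen {monomial g}))"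
    "shifts G = koszul_shifts g ps" using G unfolding resolved_def int by blast
  have "\<not> mdvd g h" if "h \<in> set (sh 0)" for h
    using lt[OF that] unfolding mdvd_def by (metis leD)
  moreover have "g \<notin> set (sh 0)" using ndvd[of g] by auto
  ultimately have gens: "distinct (sh 0 @ [g])" "antichain (set (sh 0 @ [g]))"
    using F ndvd unfolding resolved_def antichain_def by auto
  have disj: "set (shifts F i) \<inter> set (shifts G i) = {}" for i
    using lt lookup_koszul_shifts_eq[OF x] unfolding F'(3) G'(3) by fastforce
  \<comment> \<open>All multidegrees of \<open>G\<close> have larger total degree than
    \<open>g\<close>, because the exponents in \<open>ps\<close> are positive.\<close>
  have "g \<notin> set (shifts G 0)"
    using total_degree_koszul_shifts(1)[of ps g g 0] ps unfolding G'(3) by blast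
  from iterated_cone_step[OF ne minimal_monomial_generatorsI[OF gens] refl F'(1,2) G'(1,2) disj this]
  obtain H where H: "iterated_mapping_cone (ideal_gen (monomial ` set (sh 0 @ [g])) :: ('n, 'k) mpoly set) H"
    "minimal_free_resolution (\<lambda>a. a) H (ideal_module (ideal_gen (monomial ` set (sh 0 @ [g]))))"
    and "\<And>i. shifts H i = shifts F i @ (case i of 0 \<Rightarrow> [g] | Suc j \<Rightarrow> shifts G j)"
    by blast
  then have "shifts H = (\<lambda>i. sh i @ (case i of 0 \<Rightarrow> [g] | Suc j \<Rightarrow> koszul_shifts g ps j))"
    unfolding F'(3) G'(3) by blast
  then show ?thesis using H gens unfolding resolved_def by auto
qed

text \<open>For distinct variables the least common multiple of g y^f and g x^e is g x^e y^f, so the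
  colon by g x^e of an ideal generated by such g y^f is generated by the powers y^f.\<close>

lemma mdvd_add_xpow:
  "y \<noteq> x \<Longrightarrow> mdvd (g + xpow y f) a \<and> mdvd (g + xpow x e) a \<longleftrightarrow> mdvd (g + xpow x e + xpow y f) a"
proof -
  assume "y \<noteq> x"
  then have "Poly_Mapping.lookup (g + xpow y f) z \<le> c \<and> Poly_Mapping.lookup (g + xpow x e) z \<le> c
    \<longleftrightarrow> Poly_Mapping.lookup (g + xpow x e + xpow y f) z \<le> c" for z c
    by (auto simp: lookup_add lookup_xpow)
  then show ?thesis unfolding mdvd_def by blast
qed

text \<open>The head of the list is the generator added last. By \<open>mdvd_add_xpow\<close> its
  colon ideal is generated by the powers in the tail, so both complexes entering the cone are of
  Koszul type for the tail, and the variable of the head separates their multidegrees.\<close>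

lemma resolved_koszul:
  fixes g :: "'n::finite \<Rightarrow>\<^sub>0 nat"
  assumes "ps \<noteq> []" and "distinct (map fst ps)" and "\<And>x e. (x, e) \<in> set ps \<Longrightarrow> e \<ge> 1"
  shows "resolved TYPE('k::field) (koszul_shifts g ps)"
  using assms
proof (induction ps arbitrary: g)
  case (Cons p ps)
  obtain x e where p: "p = (x, e)" by fastforce
  let ?g = "g + xpow x e"
  have ps: "distinct (map fst ps)" "\<And>x e. (x, e) \<in> set ps \<Longrightarrow> e \<ge> 1" and x: "x \<notin> fst ` set ps" and e: "e \<ge> 1"
    using Cons.prems by (auto simp: p)
  have eq: "koszul_shifts g (p # ps)
      = (\<lambda>i. koszul_shifts g ps i @ (case i of 0 \<Rightarrow> [?g] | Suc j \<Rightarrow> koszul_shifts ?g ps j))"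
    by (auto simp: p)
  show ?case
  proof (cases "ps = []")
    case True
    then show ?thesis unfolding eq using resolved_principal[of ?g] by (simp cong: nat.case_cong)
  next
    case False
    show ?thesis
      unfolding eq
    proof (rule resolved_add_generator[where x = x])
      show "resolved TYPE('k) (koszul_shifts g ps)" "resolved TYPE('k) (koszul_shifts ?g ps)"
        using Cons.IH[OF False ps(1)] ps(2) by blast+
      show "koszul_shifts g ps 0 \<noteq> []"
        using False set_koszul_shifts_0[of g ps] by (metis image_is_empty set_empty)
      show "Poly_Mapping.lookup s x < Poly_Mapping.lookup ?g x" if "s \<in> set (koszul_shifts g ps i)" for s i
        using lookup_koszul_shifts_eq[OF x that] e by (simp add: lookup_add)
      show "\<not> mdvd h ?g" if h: "h \<in> set (koszul_shifts g ps 0)" for h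
      proof -
        obtain y f where "(y, f) \<in> set ps" "h = g + xpow y f"
          using h by (auto simp: set_koszul_shifts_0)
        then have "Poly_Mapping.lookup h y > Poly_Mapping.lookup ?g y"
          using x ps(2)[of y f] by (force simp: lookup_add lookup_xpow)
        then show ?thesis unfolding mdvd_def by (metis leD)
      qed
      show "(\<exists>h\<in>set (koszul_shifts g ps 0). mdvd h a) \<and> mdvd ?g a
          \<longleftrightarrow> (\<exists>(y, f)\<in>set ps. mdvd (?g + xpow y f) a)" for a
      proof -
        have "mdvd (g + xpow y f) a \<and> mdvd ?g a \<longleftrightarrow> mdvd (?g + xpow y f) a" if "(y, f) \<in> set ps" for y f
          using that x by (intro mdvd_add_xpow) force
        then show ?thesis unfolding set_koszul_shifts_0 by fastforce
      qed
    qed (use ps x in auto)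
  qed
qed simp

subsection \<open>Reading off the invariants\<close>

definition coarsen :: "('n::finite \<Rightarrow>\<^sub>0 nat, 'n, 'k::field) free_complex \<Rightarrow> (int, 'n, 'k) free_complex" where
  "coarsen F = \<lparr>shifts = \<lambda>i. map total_degree (shifts F i), aug = aug F, bd = bd F\<rparr>"

lemma homogeneous_mat_coarsen:
  assumes "homogeneous_mat (\<lambda>a. a) rs cs A"
  shows "homogeneous_mat total_degree (map total_degree rs) (map total_degree cs) A"
  using assms unfolding homogeneous_mat_def
  by (auto simp: total_degree_add[symmetric])

lemma minimal_coarsen:
  assumes "minimal_free_resolution (\<lambda>a. a) F M"
  shows "minimal_free_resolution total_degree (coarsen F) M"
proof -
  have "frank (coarsen F) i = frank F i" for i by (simp add: frank_def coarsen_def)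
  then show ?thesis
    using assms homogeneous_mat_coarsen[of "[0]" "shifts F 0" "aug F"]
      homogeneous_mat_coarsen[of "shifts F i" "shifts F (Suc i)" "bd F i" for i]
    unfolding minimal_free_resolution_def graded_free_resolution_def
    by (simp add: coarsen_def)
qed

text \<open>The resolution of an ideal is spliced with the ring: the old augmentation becomes the
  first differential, and every homological degree rises by one.\<close>

definition quotient_complex :: "('d::zero, 'n, 'k::field) free_complex \<Rightarrow> ('d, 'n, 'k) free_complex" where
  "quotient_complex F = \<lparr>shifts = \<lambda>i. case i of 0 \<Rightarrow> [0] | Suc j \<Rightarrow> shifts F j, aug = 1\<^sub>m 1,
     bd = \<lambda>i. case i of 0 \<Rightarrow> aug F | Suc j \<Rightarrow> bd F j\<rparr>"

text \<open>The entries of the new first differential lie in \<open>I\<close>, so minimality there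
  comes from \<open>I\<close> being inside the maximal ideal.\<close>

lemma minimal_quotient_complex:
  fixes F :: "('d::monoid_add, 'n, 'k::field) free_complex"
  assumes wt0: "wt 0 = 0" and F: "minimal_free_resolution wt F (ideal_module I)"
    and I: "I \<subseteq> max_homogeneous_ideal"
  shows "minimal_free_resolution wt (quotient_complex F) (quotient_ring I)"
proof -
  let ?Q = "quotient_complex F"
  have rF: "graded_free_resolution wt F (ideal_module I)"
    using F by (simp add: minimal_free_resolution_def)
  note FD = resolutionD[OF rF]
  have fr: "frank ?Q 0 = 1" "frank ?Q (Suc i) = frank F i" for i
    by (simp_all add: frank_def quotient_complex_def)
  have augQ: "(aug ?Q *\<^sub>v v) $ 0 = v $ 0" if "v \<in> carrier_vec 1" for v
    using that by (simp add: quotient_complex_def)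
  have "homogeneous_mat wt [0] (shifts ?Q 0) (aug ?Q)"
    by (auto simp: homogeneous_mat_def quotient_complex_def wt0)
  moreover have "homogeneous_mat wt (shifts ?Q i) (shifts ?Q (Suc i)) (bd ?Q i)" for i
    using FD(2) exact_complexD(1)[OF FD(1)] by (cases i) (simp_all add: quotient_complex_def)
  moreover have "UNIV = {(aug ?Q *\<^sub>v v) $ 0 + d | v d. v \<in> carrier_vec (frank ?Q 0) \<and> d \<in> I}"
  proof -
    have "0 \<in> I" using FD(5)[OF zero_carrier_vec, of 0] FD(3) by simp
    moreover have "a = (aug ?Q *\<^sub>v vec 1 (\<lambda>_. a)) $ 0 + 0" for a
      by (simp add: augQ del: index_mult_mat_vec)
    ultimately show ?thesis unfolding fr using vec_carrier by blast
  qed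
  moreover have "{v \<in> carrier_vec (frank ?Q 0). (aug ?Q *\<^sub>v v) $ 0 \<in> I}
      = {bd ?Q 0 *\<^sub>v w | w. w \<in> carrier_vec (frank ?Q 1)}" (is "?L = ?R")
  proof (intro subset_antisym subsetI)
    fix v assume "v \<in> ?L"
    then have v: "v \<in> carrier_vec 1" "v $ 0 \<in> I" by (auto simp: fr augQ simp del: index_mult_mat_vec)
    obtain x where x: "x \<in> carrier_vec (frank F 0)" "v $ 0 = (aug F *\<^sub>v x) $ 0"
      using FD(4)[OF v(2)] by auto
    then have "v = aug F *\<^sub>v x"
      using v FD(3) by (intro eq_vecI) (auto simp del: index_mult_mat_vec)
    then show "v \<in> ?R" using x(1) fr(2)[of 0] by (auto simp: quotient_complex_def)
  next
    fix v assume "v \<in> ?R"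
    then obtain x where x: "x \<in> carrier_vec (frank F 0)" "v = aug F *\<^sub>v x"
      using fr(2)[of 0] by (auto simp: quotient_complex_def)
    have "v \<in> carrier_vec 1" unfolding x(2) by (rule mult_mat_vec_carrier[OF FD(3) x(1)])
    moreover have "v $ 0 \<in> I" using FD(5)[OF x(1), of 0] x(2) by simp
    ultimately show "v \<in> ?L" by (simp add: fr augQ del: index_mult_mat_vec)
  qed
  moreover have "{v \<in> carrier_vec (frank ?Q (Suc i)). bd ?Q i *\<^sub>v v = 0\<^sub>v (frank ?Q i)}
      = {bd ?Q (Suc i) *\<^sub>v w | w. w \<in> carrier_vec (frank ?Q (Suc (Suc i)))}" for i
  proof (cases i)
    case 0
    have "aug F *\<^sub>v v = 0\<^sub>v 1 \<longleftrightarrow> (aug F *\<^sub>v v) $ 0 \<in> {0}" if "v \<in> carrier_vec (frank F 0)" for v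
    proof
      assume "(aug F *\<^sub>v v) $ 0 \<in> {0}"
      then show "aug F *\<^sub>v v = 0\<^sub>v 1"
        using FD(3) by (intro eq_vecI) (auto simp del: index_mult_mat_vec)
    qed (simp del: index_mult_mat_vec)
    then have "{v \<in> carrier_vec (frank F 0). aug F *\<^sub>v v = 0\<^sub>v 1}
        = {v \<in> carrier_vec (frank F 0). (aug F *\<^sub>v v) $ 0 \<in> {0}}" by blast
    also have "\<dots> = {bd F 0 *\<^sub>v w | w. w \<in> carrier_vec (frank F 1)}"
      using rF unfolding graded_free_resolution_def by simp
    finally show ?thesis using fr(2)[of 0] fr(2)[of 1] by (simp add: 0 fr(1)) (simp add: quotient_complex_def)
  next
    case (Suc j)
    show ?thesis
      using rF fr unfolding graded_free_resolution_def by (simp add: Suc) (simp add: quotient_complex_def)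
  qed
  moreover have "elements_mat (bd ?Q i) \<subseteq> max_homogeneous_ideal" for i
  proof (cases i)
    case 0
    have "aug F $$ (0, q) \<in> I" if q: "q < frank F 0" for q
    proof -
      have "aug F $$ (0, q) = (aug F *\<^sub>v unit_vec (frank F 0) q) $ 0"
        unfolding mult_mat_vec_unit_vec[OF FD(3) q] using FD(3) q by simp
      then show ?thesis using FD(5)[OF unit_vec_carrier, of 0 q] by simp
    qed
    then show ?thesis using FD(3) I by (auto simp: elements_mat_iff 0 quotient_complex_def)
  next
    case (Suc j)
    then show ?thesis using F by (simp add: quotient_complex_def minimal_free_resolution_def)
  qed
  ultimately show ?thesis
    unfolding minimal_free_resolution_def graded_free_resolution_def fst_conv snd_conv by blast
qed

text \<open>The conditions on \<open>D\<close> in the comparison theorem. Closure under all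
  restrictions, not just under homogeneous components, holds for the zero ideal and for monomial
  ideals and refers to no grading.\<close>

definition homogeneous_relations :: "('n, 'k::field) gmodule \<Rightarrow> bool" where
  "homogeneous_relations M \<longleftrightarrow> ring_as_module.subspace (snd M) \<and>
     (\<forall>P. \<forall>d\<in>snd M. restrict_keys P d \<in> snd M)"

lemma homogeneous_relations_ideal_module: "homogeneous_relations (ideal_module I)"
  by (simp add: homogeneous_relations_def ring_as_module.subspace_single_0)

lemma homogeneous_relations_quotient_ring:
  "homogeneous_relations (quotient_ring (ideal_gen (monomial ` S)))"
  unfolding homogeneous_relations_def snd_conv
proof (intro conjI allI ballI)
  show "ring_as_module.subspace (ideal_gen (monomial ` S) :: ('a, 'b) mpoly set)"
    unfolding ideal_gen_def by (rule ring_as_module.subspace_span)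
  show "restrict_keys P d \<in> ideal_gen (monomial ` S)" if "d \<in> ideal_gen (monomial ` S)"
    for P and d :: "('a, 'b) mpoly"
    using that by (auto simp: ideal_gen_monomials keys_restrict_keys)
qed

section \<open>Invariants determined by one minimal resolution\<close>

context
  fixes F :: "(int, 'n::finite, 'k::field) free_complex" and M :: "('n, 'k) gmodule"
  assumes F: "minimal_free_resolution total_degree F M" and M: "homogeneous_relations M"
begin

lemma count_shifts_le:
  assumes "graded_free_resolution total_degree F' M"
  shows "count_list (shifts F i) d \<le> count_list (shifts F' i) d"
proof (rule minimal_resolution_count_le)
  show "minimal_free_resolution total_degree F (fst M, snd M)"
    "graded_free_resolution total_degree F' (fst M, snd M)"
    using F assms by simp_all
qed (use M in \<open>auto simp: homogeneous_relations_def total_degree_add\<close>)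

lemma count_shifts_eq:
  assumes F': "minimal_free_resolution total_degree F' M"
  shows "count_list (shifts F' i) d = count_list (shifts F i) d"
proof (rule antisym)
  show "count_list (shifts F i) d \<le> count_list (shifts F' i) d"
    using F' by (intro count_shifts_le) (simp add: minimal_free_resolution_def)
  show "count_list (shifts F' i) d \<le> count_list (shifts F i) d"
  proof (rule minimal_resolution_count_le)
    show "minimal_free_resolution total_degree F' (fst M, snd M)"
      "graded_free_resolution total_degree F (fst M, snd M)"
      using F F' by (simp_all add: minimal_free_resolution_def)
  qed (use M in \<open>auto simp: homogeneous_relations_def total_degree_add\<close>)
qed

text \<open>Equal multiplicities of all degrees make the shift lists of two minimal resolutions
  permutations of each other, so their ranks agree.\<close>

lemma betti_eq: "betti M i = frank F i"
  unfolding betti_def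
proof (rule the_equality)
  fix b assume "\<exists>F'. minimal_free_resolution total_degree F' M \<and> b = frank F' i"
  then obtain F' where F': "minimal_free_resolution total_degree F' M" "b = frank F' i" by blast
  have "mset (shifts F' i) = mset (shifts F i)"
    using count_shifts_eq[OF F'(1)] by (intro multiset_eqI) (simp add: count_mset)
  then show "b = frank F i" unfolding F'(2) frank_def by (rule mset_eq_length)
qed (use F in blast)

lemma graded_betti_eq: "graded_betti M i d = count_list (shifts F i) d"
  unfolding graded_betti_def
  using F count_shifts_eq by (intro the_equality) blast+

text \<open>A degree occurring in position l of the minimal resolution must occur in position l of
  every resolution, minimal or not.\<close>

lemma projdim_eq:
  assumes "shifts F l \<noteq> []" and "\<And>i. i > l \<Longrightarrow> shifts F i = []"
  shows "projdim M = l"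
  unfolding projdim_def
proof (rule Least_equality)
  show "\<exists>F. graded_free_resolution total_degree F M \<and> (\<forall>i>l. shifts F i = [])"
    using F assms(2) unfolding minimal_free_resolution_def by blast
next
  fix r assume "\<exists>F'. graded_free_resolution total_degree F' M \<and> (\<forall>i>r. shifts F' i = [])"
  then obtain F' where F': "graded_free_resolution total_degree F' M" "\<forall>i>r. shifts F' i = []" by blast
  show "l \<le> r"
  proof (rule ccontr)
    assume "\<not> l \<le> r"
    then have "count_list (shifts F l) d = 0" for d
      using F'(2) count_shifts_le[OF F'(1), of l d] by simp
    then show False using assms(1) by (metis count_list_0_iff list.set_intros(1) neq_Nil_conv)
  qed
qed

text \<open>The vanishing beyond l makes the set of values d - i finite, as is required for
  \<open>Max\<close> to be meaningful.\<close>

lemma regularity_eq: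
  assumes fin: "\<And>i. i > l \<Longrightarrow> shifts F i = []"
    and le: "\<And>i d. d \<in> set (shifts F i) \<Longrightarrow> d - int i \<le> R"
    and R: "\<exists>i. \<exists>d\<in>set (shifts F i). d - int i = R"
  shows "regularity M = R"
proof -
  have "{d - int i | i d. graded_betti M i d \<noteq> 0} = {d - int i | i d. d \<in> set (shifts F i)}"
    by (simp add: graded_betti_eq count_list_0_iff)
  also have "\<dots> = (\<Union>i\<in>{..l}. (\<lambda>d. d - int i) ` set (shifts F i))"
  proof (intro subset_antisym subsetI)
    fix c assume "c \<in> {d - int i | i d. d \<in> set (shifts F i)}"
    then obtain i d where "c = d - int i" "d \<in> set (shifts F i)" by blast
    moreover from this have "i \<le> l" using fin[of i] by (cases "i \<le> l") auto
    ultimately show "c \<in> (\<Union>i\<in>{..l}. (\<lambda>d. d - int i) ` set (shifts F i))" by blast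
  qed blast
  finally have eq: "{d - int i | i d. graded_betti M i d \<noteq> 0}
      = (\<Union>i\<in>{..l}. (\<lambda>d. d - int i) ` set (shifts F i))" .
  show ?thesis
    unfolding regularity_def
  proof (rule Max_eqI)
    show "finite {d - int i | i d. graded_betti M i d \<noteq> 0}" unfolding eq by blast
    show "c \<le> R" if "c \<in> {d - int i | i d. graded_betti M i d \<noteq> 0}" for c
      using that le unfolding eq by blast
    show "R \<in> {d - int i | i d. graded_betti M i d \<noteq> 0}"
      using R by (auto simp: graded_betti_eq count_list_0_iff)
  qed
qed

end

subsection \<open>The ideals \<open>J\<^sub>n\<^sub>,\<^sub>m\<close>\<close>

lemma monomial_power: "variable x ^ k = monomial (xpow x k)"
proof (induction k)
  case 0
  show ?case by (simp add: monomial_def)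
next
  case (Suc k)
  have "xpow x (Suc 0) + xpow x k = xpow x (Suc k)" by (simp add: single_add[symmetric])
  then show ?case unfolding power_Suc Suc.IH by (simp add: variable_def monomial_def mult_single)
qed

lemma monomial_mult: "monomial a * monomial b = monomial (a + b)"
  by (simp add: monomial_def mult_single)

context
  fixes v :: "nat \<Rightarrow> 'n::finite" and n m :: nat
  assumes n: "n \<ge> 1" and m: "m \<ge> 1" and inj: "inj_on v {1..n}"
begin

text \<open>For a = m this is the pure power of y_t. Letting a run through 1, ..., m therefore
  covers every generator except y_1^m.\<close>

definition gen :: "nat \<Rightarrow> nat \<Rightarrow> ('n \<Rightarrow>\<^sub>0 nat)" where
  "gen a t = xpow (v 1) (m - a) + xpow (v t) a"

text \<open>The colon ideal of the generators preceding \<open>gen a t\<close> is generated by \<open>y\<^sub>1\<close> and the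
  powers \<open>y\<^sub>j\<^sup>a\<close> with \<open>2 \<le> j < t\<close>.\<close>

definition colon_powers :: "nat \<Rightarrow> nat \<Rightarrow> ('n \<times> nat) list" where
  "colon_powers a t = (v 1, 1) # map (\<lambda>j. (v j, a)) [2..<t]"

definition layer :: "nat \<Rightarrow> nat \<times> nat \<Rightarrow> ('n \<Rightarrow>\<^sub>0 nat) list" where
  "layer i = (\<lambda>(a, t). case i of 0 \<Rightarrow> [gen a t] | Suc j \<Rightarrow> koszul_shifts (gen a t) (colon_powers a t) j)"

text \<open>Index pairs of the generators preceding \<open>gen a t\<close>, other than y_1^m, in the
  order in which they are added.\<close>

definition stages :: "nat \<Rightarrow> nat \<Rightarrow> (nat \<times> nat) list" where
  "stages a t = concat (map (\<lambda>b. map (Pair b) [2..<Suc n]) [1..<a]) @ map (Pair a) [2..<t]"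

definition J_shifts :: "nat \<Rightarrow> nat \<Rightarrow> nat \<Rightarrow> ('n \<Rightarrow>\<^sub>0 nat) list" where
  "J_shifts a t i = (case i of 0 \<Rightarrow> [xpow (v 1) m] | Suc j \<Rightarrow> []) @ concat (map (layer i) (stages a t))"

lemma v_eq_iff: "i \<in> {1..n} \<Longrightarrow> j \<in> {1..n} \<Longrightarrow> v i = v j \<longleftrightarrow> i = j"
  using inj by (rule inj_on_eq_iff)

lemma set_stages:
  "set (stages a t) = {(b, s). 1 \<le> b \<and> b < a \<and> 2 \<le> s \<and> s \<le> n \<or> b = a \<and> 2 \<le> s \<and> s < t}"
proof -
  have "set [2..<k] = {2..<k}" "set [1..<k] = {1..<k}" for k :: nat by (rule set_upt)+
  then show ?thesis unfolding stages_def set_append set_concat set_map by force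
qed

lemma stages_Suc: "2 \<le> t \<Longrightarrow> stages a (Suc t) = stages a t @ [(a, t)]"
  by (simp add: stages_def)

lemma stages_next: "1 \<le> a \<Longrightarrow> stages (Suc a) 2 = stages a (Suc n)"
proof -
  assume "1 \<le> a"
  then have "[1..<Suc a] = [1..<a] @ [a]" by (rule upt_Suc_append)
  then show ?thesis by (simp only: stages_def map_append concat_append) simp
qed

lemma J_shifts_Suc: "2 \<le> t \<Longrightarrow> J_shifts a (Suc t) = (\<lambda>i. J_shifts a t i @ layer i (a, t))"
  by (simp add: J_shifts_def stages_Suc fun_eq_iff)

lemma set_J_shifts_0: "set (J_shifts a t 0) = insert (xpow (v 1) m) ((\<lambda>(b, s). gen b s) ` set (stages a t))"
  by (auto simp: J_shifts_def layer_def)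

section \<open>Separation of multidegrees and colon ideals\<close>

lemma distinct_colon_powers:
  "t \<le> n \<Longrightarrow> distinct (map fst (colon_powers a t))"
  using n by (auto simp: colon_powers_def v_eq_iff distinct_map o_def intro!: inj_onI)

lemma colon_powers_pos: "1 \<le> a \<Longrightarrow> (x, e) \<in> set (colon_powers a t) \<Longrightarrow> 1 \<le> e"
  by (auto simp: colon_powers_def)

lemma v_notin_colon_powers: "2 \<le> t \<Longrightarrow> t \<le> n \<Longrightarrow> s \<le> t \<Longrightarrow> v t \<notin> fst ` set (colon_powers a s)"
  by (auto simp: colon_powers_def v_eq_iff)

text \<open>If s = t, then b < a and the colon powers do not involve y_t, so the exponent stays b.
  If s differs from t and b < a, the generator has exponent 0 and the Koszul part adds at most b. In
  the same layer s < t, and y_t does not occur.\<close>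

lemma lookup_layer_lt:
  assumes t: "2 \<le> t" "t \<le> n" and a: "1 \<le> a" "a \<le> m" and bs: "(b, s) \<in> set (stages a t)" and h: "h \<in> set (layer i (b, s))"
  shows "Poly_Mapping.lookup h (v t) < a"
proof -
  have v1: "v 1 \<noteq> v t" using t v_eq_iff[of 1 t] by auto
  have b: "b \<le> a" "2 \<le> s" "s \<le> n" using bs t by (auto simp: set_stages)
  have g: "Poly_Mapping.lookup (gen b s) (v t) = (if s = t then b else 0)"
    using v1 t b v_eq_iff[of s t] by (auto simp: gen_def lookup_add lookup_xpow)
  consider "s = t" "b < a" | "s \<noteq> t" "b < a" | "b = a" "s < t"
    using bs by (fastforce simp: set_stages)
  then show ?thesis
  proof cases
    case 1
    then have "Poly_Mapping.lookup h (v t) = Poly_Mapping.lookup (gen b s) (v t)"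
      using h lookup_koszul_shifts_eq[OF v_notin_colon_powers[OF t, of s b], of h "gen b s"]
      by (auto simp: layer_def split: nat.splits)
    then show ?thesis using 1 g by simp
  next
    case 2
    have "Poly_Mapping.lookup h (v t) \<le> Poly_Mapping.lookup (gen b s) (v t) + b"
    proof (cases i)
      case (Suc j)
      then show ?thesis
        using h b t v1 by (intro lookup_koszul_shifts_le[OF distinct_colon_powers[of s b]])
          (auto simp: layer_def colon_powers_def)
    qed (use h in \<open>simp add: layer_def\<close>)
    then show ?thesis using 2 g by simp
  next
    case 3
    then have "Poly_Mapping.lookup h (v t) = Poly_Mapping.lookup (gen b s) (v t)"
      using h lookup_koszul_shifts_eq[OF v_notin_colon_powers[OF t, of s b], of h "gen b s"]
      by (auto simp: layer_def split: nat.splits)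
    then show ?thesis using 3 g a by simp
  qed
qed

lemma lookup_J_shifts_lt:
  assumes t: "2 \<le> t" "t \<le> n" and a: "1 \<le> a" "a \<le> m" and h: "h \<in> set (J_shifts a t i)"
  shows "Poly_Mapping.lookup h (v t) < a"
proof -
  have v1: "v 1 \<noteq> v t" using t v_eq_iff[of 1 t] by auto
  consider "h = xpow (v 1) m" | b s where "(b, s) \<in> set (stages a t)" "h \<in> set (layer i (b, s))"
    using h by (auto simp: J_shifts_def split: nat.splits)
  then show ?thesis
  proof cases
    case 1
    then show ?thesis using v1 a by (simp add: lookup_xpow)
  next
    case 2
    then show ?thesis using lookup_layer_lt[OF t a] by blast
  qed
qed

text \<open>The exponent of y_1 excludes y_1^m and all smaller layers; an earlier generator of the
  same layer contains some y_s with s < t, which \<open>gen a t\<close> lacks.\<close>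

lemma not_mdvd_gen:
  assumes t: "2 \<le> t" "t \<le> n" and a: "1 \<le> a" "a \<le> m" and h: "h \<in> set (J_shifts a t 0)"
  shows "\<not> mdvd h (gen a t)"
proof
  assume dvd: "mdvd h (gen a t)"
  have v1: "v 1 \<noteq> v s" if "2 \<le> s" "s \<le> n" for s using that v_eq_iff[of 1 s] by auto
  have 1: "Poly_Mapping.lookup (gen a t) (v 1) = m - a"
    using v1[of t] t by (simp add: gen_def lookup_add lookup_xpow)
  consider "h = xpow (v 1) m" | b s where "(b, s) \<in> set (stages a t)" "h = gen b s"
    using h by (auto simp: set_J_shifts_0)
  then show False
  proof cases
    case 1
    then have "m \<le> m - a" using dvd \<open>Poly_Mapping.lookup (gen a t) (v 1) = m - a\<close>
      by (metis lookup_single_eq mdvd_def)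
    then show False using a m by simp
  next
    case 2
    have b: "2 \<le> s" "s \<le> n" "b \<le> a" using 2(1) t by (auto simp: set_stages)
    have "Poly_Mapping.lookup h (v 1) \<le> m - a" using dvd 1 by (metis mdvd_def)
    then have "m - b \<le> m - a"
      using v1[of s] b by (simp add: 2(2) gen_def lookup_add lookup_xpow)
    then have "b = a" using b a by simp
    then have s: "s < t" using 2(1) by (auto simp: set_stages)
    have "Poly_Mapping.lookup h (v s) \<le> Poly_Mapping.lookup (gen a t) (v s)" using dvd by (simp add: mdvd_def)
    then show False
      using v1[of s] b s t a v_eq_iff[of s t] \<open>b = a\<close>
      by (auto simp: 2(2) gen_def lookup_add lookup_xpow)
  qed
qed

lemma mdvd_add_xpow_iff:
  "mdvd (g + xpow x e) a \<longleftrightarrow> mdvd g a \<and> Poly_Mapping.lookup g x + e \<le> Poly_Mapping.lookup a x"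
proof -
  have "Poly_Mapping.lookup (g + xpow x e) z \<le> c z \<longleftrightarrow>
      Poly_Mapping.lookup g z \<le> c z \<and> (z = x \<longrightarrow> Poly_Mapping.lookup g x + e \<le> c x)" for z c
    by (auto simp: lookup_add lookup_xpow)
  then show ?thesis unfolding mdvd_def by blast
qed

text \<open>On multiples of \<open>gen a t\<close>, divisibility by y_1^m or by a generator of a
  smaller layer forces at least one extra factor y_1, while an earlier generator of layer a forces
  y_s^a. For the converse, y_1 times \<open>gen a t\<close> is a multiple of
  \<open>gen (a - 1) t\<close>, or of y_1^m if a = 1.\<close>

lemma colon_gen:
  assumes t: "2 \<le> t" "t \<le> n" and a: "1 \<le> a" "a \<le> m"
  shows "(\<exists>h\<in>set (J_shifts a t 0). mdvd h c) \<and> mdvd (gen a t) c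
    \<longleftrightarrow> (\<exists>(y, e)\<in>set (colon_powers a t). mdvd (gen a t + xpow y e) c)"
proof -
  have v1: "v 1 \<noteq> v s" "v s \<noteq> v 1" if "2 \<le> s" "s \<le> n" for s using that v_eq_iff[of 1 s] by auto
  define l where "l = Poly_Mapping.lookup c"
  have gen: "mdvd (gen b s) c \<longleftrightarrow> m - b \<le> l (v 1) \<and> b \<le> l (v s)" if "2 \<le> s" "s \<le> n" for b s
  proof -
    have "mdvd (xpow (v 1) (m - b)) c \<longleftrightarrow> m - b \<le> l (v 1)"
      by (auto simp: mdvd_def lookup_xpow l_def)
    then show ?thesis
      unfolding gen_def mdvd_add_xpow_iff using v1[OF that] by (simp add: lookup_xpow l_def)
  qed
  have base: "mdvd (xpow (v 1) m) c \<longleftrightarrow> m \<le> l (v 1)"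
    by (auto simp: mdvd_def lookup_xpow l_def)
  have L: "(\<exists>h\<in>set (J_shifts a t 0). mdvd h c) \<longleftrightarrow> m \<le> l (v 1) \<or>
      (\<exists>b s. (b, s) \<in> set (stages a t) \<and> m - b \<le> l (v 1) \<and> b \<le> l (v s))"
  proof -
    have "mdvd (gen b s) c \<longleftrightarrow> m - b \<le> l (v 1) \<and> b \<le> l (v s)" if "(b, s) \<in> set (stages a t)" for b s
      using that t by (intro gen) (auto simp: set_stages)
    then show ?thesis unfolding set_J_shifts_0 using base by fastforce
  qed
  have g1: "Poly_Mapping.lookup (gen a t) (v 1) = m - a"
    using v1 t by (simp add: gen_def lookup_add lookup_xpow)
  have gs: "Poly_Mapping.lookup (gen a t) (v s) = 0" if "2 \<le> s" "s < t" for s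
    using v1[of s] t that v_eq_iff[of s t] by (auto simp: gen_def lookup_add lookup_xpow)
  have R: "(\<exists>(y, e)\<in>set (colon_powers a t). mdvd (gen a t + xpow y e) c) \<longleftrightarrow>
      mdvd (gen a t) c \<and> (m - a + 1 \<le> l (v 1) \<or> (\<exists>s. 2 \<le> s \<and> s < t \<and> a \<le> l (v s)))"
    unfolding mdvd_add_xpow_iff colon_powers_def using g1 gs by (fastforce simp: l_def)
  have "(m \<le> l (v 1) \<or> (\<exists>b s. (b, s) \<in> set (stages a t) \<and> m - b \<le> l (v 1) \<and> b \<le> l (v s)))
      \<longleftrightarrow> (m - a + 1 \<le> l (v 1) \<or> (\<exists>s. 2 \<le> s \<and> s < t \<and> a \<le> l (v s)))" (is "?A \<longleftrightarrow> ?B")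
    if "mdvd (gen a t) c"
  proof -
    have c: "m - a \<le> l (v 1)" "a \<le> l (v t)" using that gen[OF t] by auto
    show ?thesis
    proof
      assume ?A
      then show ?B
      proof (elim disjE exE conjE)
        assume "m \<le> l (v 1)"
        then have "m - a + 1 \<le> l (v 1)" using a by linarith
        then show ?B ..
      next
        fix b s assume "(b, s) \<in> set (stages a t)" "m - b \<le> l (v 1)" "b \<le> l (v s)"
        then show ?B using a by (fastforce simp: set_stages)
      qed
    next
      assume ?B
      then show ?A
      proof (elim disjE exE conjE)
        assume *: "m - a + 1 \<le> l (v 1)"
        show ?A
        proof (cases "a = 1")
          case False
          \<comment> \<open>The witness for the extra factor y_1 is the generator with the same y_t
            in the previous layer.\<close>
          then have "(a - 1, t) \<in> set (stages a t)" "m - (a - 1) \<le> l (v 1)" "a - 1 \<le> l (v t)"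
            using t a * c by (auto simp: set_stages)
          then show ?A by blast
        qed (use * a in simp)
      next
        fix s assume "2 \<le> s" "s < t" "a \<le> l (v s)"
        then have "(a, s) \<in> set (stages a t)" "m - a \<le> l (v 1)" "a \<le> l (v s)"
          using c by (auto simp: set_stages)
        then show ?A by blast
      qed
    qed
  qed
  then show ?thesis unfolding L R by blast
qed

section \<open>Assembling the resolution and identifying the ideal\<close>

lemma resolved_J_step:
  assumes "2 \<le> t" "t \<le> n" "1 \<le> a" "a \<le> m" and "resolved TYPE('k::field) (J_shifts a t)"
  shows "resolved TYPE('k) (J_shifts a (Suc t))"
proof -
  have eq: "J_shifts a (Suc t) = (\<lambda>i. J_shifts a t i @
      (case i of 0 \<Rightarrow> [gen a t] | Suc j \<Rightarrow> koszul_shifts (gen a t) (colon_powers a t) j))"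
    unfolding J_shifts_Suc[OF assms(1)] by (simp add: layer_def)
  have "Poly_Mapping.lookup (gen a t) (v t) \<ge> a"
    by (simp add: gen_def lookup_add lookup_xpow)
  then have lt: "Poly_Mapping.lookup h (v t) < Poly_Mapping.lookup (gen a t) (v t)"
    if "h \<in> set (J_shifts a t i)" for h i
    using lookup_J_shifts_lt[OF assms(1-4) that] by simp
  have ne: "J_shifts a t 0 \<noteq> []" by (simp add: J_shifts_def)
  have "resolved TYPE('k) (koszul_shifts (gen a t) (colon_powers a t))"
    using distinct_colon_powers[OF assms(2)] colon_powers_pos[OF assms(3)]
    by (intro resolved_koszul) (auto simp: colon_powers_def)
  with assms(5) show ?thesis
    unfolding eq
    by (rule resolved_add_generator[where sh = "J_shifts a t", OF _ _ ne colon_powers_pos[OF assms(3)]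
          v_notin_colon_powers[OF assms(1,2) order_refl] lt not_mdvd_gen[OF assms(1-4)] colon_gen[OF assms(1-4)]])
qed

lemma resolved_J_shifts:
  assumes "1 \<le> a" "a \<le> m" and "2 \<le> t" "t \<le> Suc n"
  shows "resolved TYPE('k::field) (J_shifts a t)"
proof -
  have row: "resolved TYPE('k) (J_shifts a t)"
    if "1 \<le> a" "a \<le> m" "resolved TYPE('k) (J_shifts a 2)" "2 \<le> t" "t \<le> Suc n" for a t
    using that(4,5)
  proof (induction t rule: nat_induct_at_least)
    case (Suc t)
    then show ?case using resolved_J_step[of t a] that(1,2) by simp
  qed (rule that(3))
  have "resolved TYPE('k) (J_shifts a 2)"
    using assms(1,2)
  proof (induction a rule: nat_induct_at_least)
    case base
    have "J_shifts 1 2 = (\<lambda>i. case i of 0 \<Rightarrow> [xpow (v 1) m] | Suc j \<Rightarrow> [])"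
      by (simp add: J_shifts_def stages_def fun_eq_iff)
    then show ?case by (simp only: resolved_principal)
  next
    case (Suc a)
    \<comment> \<open>A finished layer is the same state as the next layer before its first
      generator; this links the induction along a layer with the induction over layers.\<close>
    have "J_shifts (Suc a) 2 = J_shifts a (Suc n)"
      by (simp add: J_shifts_def stages_next[OF Suc.hyps] fun_eq_iff)
    then show ?case
      using row[of a "Suc n"] Suc n by (cases "n = 1") (simp_all add: numeral_2_eq_2)
  qed
  then show ?thesis using row assms by blast
qed

lemma J_eq: "J v n m = (ideal_gen (monomial ` set (J_shifts m (Suc n) 0)) :: ('n, 'k::field) mpoly set)"
proof -
  have "{variable (v i) ^ m | i. i \<in> {1..n}} \<union>
      {variable (v 1) ^ (m - a) * variable (v j) ^ a | a j. a \<in> {1..m - 1} \<and> j \<in> {2..n}}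
    = (monomial ` ({xpow (v i) m | i. i \<in> {1..n}} \<union> {gen a j | a j. a \<in> {1..m - 1} \<and> j \<in> {2..n}})
      :: ('n, 'k) mpoly set)"
    unfolding monomial_power monomial_mult gen_def by blast
  also have "{xpow (v i) m | i. i \<in> {1..n}} \<union> {gen a j | a j. a \<in> {1..m - 1} \<and> j \<in> {2..n}}
    = set (J_shifts m (Suc n) 0)"
  proof -
    have gm: "gen m j = xpow (v j) m" for j by (simp add: gen_def)
    have "{1..n} = insert 1 {2..n}" using n by auto
    then have pure: "{xpow (v i) m | i. i \<in> {1..n}} = insert (xpow (v 1) m) (gen m ` {2..n})"
      unfolding gm by auto
    have stages: "set (stages m (Suc n)) = {1..m - 1} \<times> {2..n} \<union> {m} \<times> {2..n}"
      by (auto simp: set_stages)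
    have image: "(\<lambda>(b, s). gen b s) ` (A \<times> B \<union> {m} \<times> B) = {gen a j | a j. a \<in> A \<and> j \<in> B} \<union> gen m ` B"
      for A B by force
    show ?thesis unfolding set_J_shifts_0 pure stages image by blast
  qed
  finally show ?thesis unfolding J_def by simp
qed

text \<open>The generator itself fills the place of the empty subset, so a layer has the ranks of
  the full Koszul complex on t - 1 elements.\<close>

lemma length_layer:
  assumes "2 \<le> t"
  shows "length (layer i (a, t)) = (t - 1) choose i"
proof -
  have "length (colon_powers a t) = t - 1" using assms by (simp add: colon_powers_def)
  then show ?thesis by (simp add: layer_def length_koszul_shifts split: nat.split)
qed

lemma sum_list_concat: "sum_list (concat xss) = sum_list (map sum_list xss)"
  by (induction xss) simp_all

lemma length_J_shifts:
  "length (J_shifts m (Suc n) i) = (if i = 0 then 1 else 0) + m * (\<Sum>t=2..n. (t - 1) choose i)"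
proof -
  let ?S = "\<Sum>t=2..n. (t - 1) choose i"
  have row: "(\<Sum>t\<leftarrow>[2..<Suc n]. length (layer i (a, t))) = ?S" for a
  proof -
    have "(\<Sum>t\<leftarrow>[2..<Suc n]. length (layer i (a, t))) = (\<Sum>t\<leftarrow>[2..<Suc n]. (t - 1) choose i)"
      by (intro arg_cong[where f = sum_list] map_cong) (auto simp: length_layer)
    also have "\<dots> = (\<Sum>t\<in>{2..<Suc n}. (t - 1) choose i)"
      by (simp only: sum_list_distinct_conv_sum_set[OF distinct_upt] set_upt)
    also have "{2..<Suc n} = {2..n}" by auto
    finally show ?thesis .
  qed
  have "[1..<Suc m] = [1..<m] @ [m]" using m by (rule upt_Suc_append)
  then have "stages m (Suc n) = concat (map (\<lambda>b. map (Pair b) [2..<Suc n]) [1..<Suc m])"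
    by (simp only: stages_def) (simp del: upt_Suc)
  then have "(\<Sum>p\<leftarrow>stages m (Suc n). length (layer i p)) = (\<Sum>b\<leftarrow>[1..<Suc m]. ?S)"
    by (simp only: map_concat sum_list_concat map_map o_def row)
  also have "\<dots> = m * ?S" by (simp add: sum_list_triv del: upt_Suc)
  finally show ?thesis
    by (simp add: J_shifts_def length_concat o_def split: nat.split)
qed

text \<open>The regularity of the ideal. For n >= 2 it is m + (n - 2)(m - 1), coming from y_n^m with
  colon generators y_1, y_2^m, ..., y_(n-1)^m. The principal ideal of y_1^m has regularity m, where
  the general formula would give 1.\<close>

definition J_reg :: nat where
  "J_reg = (if n = 1 then m else (n - 1) * (m - 1) + 1)"

lemma total_degree_gen: "a \<le> m \<Longrightarrow> total_degree (gen a t) = int m"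
  by (simp add: gen_def total_degree_add)

lemma total_degree_J_shifts:
  assumes "h \<in> set (J_shifts m (Suc n) i)"
  shows "total_degree h - int i \<le> int J_reg"
proof -
  have mr: "m \<le> J_reg"
  proof (cases "n = 1")
    case False
    then have "n = Suc (Suc (n - 2))" "m = Suc (m - 1)" using n m by auto
    then obtain n' m' where "n = Suc (Suc n')" "m = Suc m'" by blast
    then show ?thesis unfolding J_reg_def by simp
  qed (unfold J_reg_def, simp)
  consider "h = xpow (v 1) m" | b s where "(b, s) \<in> set (stages m (Suc n))" "h \<in> set (layer i (b, s))"
    using assms by (auto simp: J_shifts_def split: nat.splits)
  then show ?thesis
  proof cases
    case 1
    then show ?thesis using mr by simp
  next
    case 2
    then have b: "1 \<le> b" "b \<le> m" "2 \<le> s" "s \<le> n" using m by (auto simp: set_stages)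
    show ?thesis
    proof (cases i)
      case 0
      then show ?thesis using 2 mr total_degree_gen b by (simp add: layer_def)
    next
      case (Suc j)
      then have "h \<in> set (koszul_shifts (gen b s) (colon_powers b s) j)" using 2 by (simp add: layer_def)
      then have "total_degree h - int j \<le> total_degree (gen b s) + 1 + (\<Sum>(x, e)\<leftarrow>colon_powers b s. int e - 1)"
        by (rule total_degree_koszul_shifts(2)[rotated]) (rule colon_powers_pos[OF b(1)])
      then have "total_degree h - int i \<le> int m + (\<Sum>(x, e)\<leftarrow>colon_powers b s. int e - 1)"
        by (simp add: Suc total_degree_gen[OF b(2)])
      \<comment> \<open>The entry y_1 contributes 1 - 1 = 0, and each of the s - 2 powers y_j^b
        contributes b - 1. The maximum is thus at b = m and s = n, the last generator added.\<close>
      also have "(\<Sum>(x, e)\<leftarrow>colon_powers b s. int e - 1) = int ((s - 2) * (b - 1))"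
        using b by (simp add: colon_powers_def o_def sum_list_triv of_nat_diff)
      also have "(s - 2) * (b - 1) \<le> (n - 2) * (m - 1)" using b by (intro mult_mono) auto
      also have "int m + int ((n - 2) * (m - 1)) = int J_reg"
      proof -
        have "n = Suc (Suc (n - 2))" "m = Suc (m - 1)" using b m by auto
        then obtain n' m' where "n = Suc (Suc n')" "m = Suc m'" by blast
        then show ?thesis unfolding J_reg_def by (simp add: algebra_simps)
      qed
      finally show ?thesis by simp
    qed
  qed
qed

text \<open>For n >= 2 the last cone attains the bound, in its highest homological degree.\<close>

lemma top_J_shift: "\<exists>h\<in>set (J_shifts m (Suc n) (n - 1)). total_degree h - int (n - 1) = int J_reg"
proof (cases "n = 1")
  case True
  moreover have "xpow (v 1) m \<in> set (J_shifts m (Suc n) 0)" by (simp add: set_J_shifts_0)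
  moreover have "J_reg = m" using True unfolding J_reg_def by simp
  ultimately show ?thesis by (intro bexI[of _ "xpow (v 1) m"]) simp_all
next
  case False
  then have "n = Suc (Suc (n - 2))" using n by auto
  then obtain n' where n': "n = Suc (Suc n')" by blast
  have "length (colon_powers m n) = Suc n'" unfolding colon_powers_def n' by (simp del: upt_Suc)
  with top_koszul_shift[of "colon_powers m n" "gen m n"]
  obtain h where h: "h \<in> set (koszul_shifts (gen m n) (colon_powers m n) n')"
    "total_degree h = total_degree (gen m n) + (\<Sum>(x, e)\<leftarrow>colon_powers m n. int e)"
    by fastforce
  have "(m, n) \<in> set (stages m (Suc n))" unfolding set_stages using n' by simp
  \<comment> \<open>The n - 1 colon generators have their top Koszul degree at n - 2; the cone
    raises it to n - 1.\<close>
  moreover have "h \<in> set (layer (n - 1) (m, n))" using h(1) by (simp add: layer_def n')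
  ultimately have "h \<in> set (J_shifts m (Suc n) (n - 1))" by (auto simp: J_shifts_def)
  moreover have sum: "(\<Sum>(x, e)\<leftarrow>colon_powers m n. int e) = 1 + int n' * int m"
    by (simp add: colon_powers_def o_def sum_list_triv n' del: upt_Suc)
  have "m = Suc (m - 1)" using m by simp
  then obtain m' where m': "m = Suc m'" by blast
  have "total_degree h - int (n - 1) = int J_reg"
    unfolding h(2) sum total_degree_gen[OF order_refl] J_reg_def
    unfolding m' n' by (simp add: algebra_simps)
  ultimately show ?thesis by blast
qed

lemma J_shifts_empty: "i > n - 1 \<Longrightarrow> J_shifts m (Suc n) i = []"
proof -
  assume "i > n - 1"
  then have "(\<Sum>t=2..n. (t - 1) choose i) = 0" by (intro sum.neutral) auto
  then have "length (J_shifts m (Suc n) i) = 0"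
    unfolding length_J_shifts using \<open>i > n - 1\<close> by simp
  then show ?thesis by simp
qed

lemma J_subset_max: "(J v n m :: ('n, 'k::field) mpoly set) \<subseteq> max_homogeneous_ideal"
proof
  fix p :: "('n, 'k) mpoly" assume p: "p \<in> J v n m"
  have "0 \<notin> Poly_Mapping.keys p"
  proof
    assume "0 \<in> Poly_Mapping.keys p"
    then obtain h where h: "h \<in> set (J_shifts m (Suc n) 0)" "mdvd h 0"
      using p unfolding J_eq ideal_gen_monomials by blast
    then have "h = 0" by (intro poly_mapping_eqI) (simp add: mdvd_def)
    moreover have "total_degree h = int m"
      using h(1) m by (auto simp: set_J_shifts_0 set_stages total_degree_gen)
    ultimately show False using m by simp
  qed
  then show "p \<in> max_homogeneous_ideal" by (simp add: max_homogeneous_ideal_iff in_keys_iff)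
qed

end

text \<open>The hockey-stick identity: the absent term for t = 1 is \<open>0 choose i\<close>, which
  vanishes precisely because i is positive.\<close>

lemma sum_choose_lower: "1 \<le> i \<Longrightarrow> (\<Sum>t=2..n. (t - 1) choose i) = n choose Suc i"
proof (induction n)
  case (Suc n)
  show ?case
  proof (cases "n = 0")
    case False
    then have "(\<Sum>t=2..Suc n. (t - 1) choose i) = (\<Sum>t=2..n. (t - 1) choose i) + (n choose i)" by simp
    then show ?thesis using Suc by simp
  qed (use Suc in simp)
qed simp

lemma sum_choose_reverse: "(\<Sum>j=2..n. (1 + n - j) choose i) = (\<Sum>t=2..n. (t - 1) choose i)"
  by (rule sum.reindex_bij_witness[of _ "\<lambda>t. n + 2 - t" "\<lambda>j. n + 2 - j"]) auto

text \<open>For n >= 2 the value (n - 1)(m - 1) is the regularity of the quotient ring, and that of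
  the ideal is larger by one. For n = 1 the ideal is generated by y_1^m, which gives m - 1 and m
  instead. Both conventions are therefore stated, with n = 1 apart.\<close>

theorem proposition3p3:
  fixes v :: "nat \<Rightarrow> 'n::finite" and n m :: nat
    and Jnm :: "('n, 'k::field) mpoly set"
  assumes "n \<ge> 1" and "m \<ge> 1"
    and "bij_betw v {1..n} (UNIV :: 'n set)"
    and "Jnm = J v n m"
  shows "betti (ideal_module Jnm) 0 = n + (n - 1) * (m - 1) \<and>
    (\<forall>i. 1 \<le> i \<and> i \<le> n - 1 \<longrightarrow>
       betti (ideal_module Jnm) i =
         ((n - 1) choose i) + (\<Sum>j=2..n. (m - 1) * ((1 + n - j) choose i)) + ((n - 1) choose (i + 1))) \<and>
    projdim (ideal_module Jnm) = n - 1 \<and>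
    (n \<ge> 2 \<longrightarrow>
       regularity (quotient_ring Jnm) = int ((n - 1) * (m - 1)) \<and>
       regularity (ideal_module Jnm) = int ((n - 1) * (m - 1)) + 1) \<and>
    (n = 1 \<longrightarrow>
       regularity (quotient_ring Jnm) = int (m - 1) \<and>
       regularity (ideal_module Jnm) = int m) \<and>
    (\<exists>F. iterated_mapping_cone Jnm F \<and> minimal_free_resolution (\<lambda>a. a) F (ideal_module Jnm))"
proof -
  have inj: "inj_on v {1..n}" using assms(3) by (rule bij_betw_imp_inj_on)
  note ctx = assms(1,2) inj
  let ?sh = "J_shifts v n m m (Suc n)"
  have J: "Jnm = ideal_gen (monomial ` set (?sh 0))" unfolding assms(4) by (rule J_eq[OF ctx])
  have "resolved TYPE('k) ?sh" using assms(1,2) by (intro resolved_J_shifts[OF ctx]) auto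
  then obtain F where F: "iterated_mapping_cone Jnm F" "minimal_free_resolution (\<lambda>a. a) F (ideal_module Jnm)"
    and sh: "shifts F = ?sh" unfolding resolved_def J by blast
  let ?C = "coarsen F"
  have C: "minimal_free_resolution total_degree ?C (ideal_module Jnm)" by (rule minimal_coarsen[OF F(2)])
  have shC: "shifts ?C i = map total_degree (?sh i)" for i by (simp add: coarsen_def sh)
  note hC = homogeneous_relations_ideal_module[of Jnm]
  have betti: "betti (ideal_module Jnm) i = (if i = 0 then 1 else 0) + m * (\<Sum>t=2..n. (t - 1) choose i)" for i
    using betti_eq[OF C hC] length_J_shifts[OF ctx] by (simp add: frank_def shC)
  have top: "\<exists>d\<in>set (shifts ?C (n - 1)). d - int (n - 1) = int (J_reg n m)"
    using top_J_shift[OF ctx] by (auto simp: shC)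
  have empty: "shifts ?C i = []" if "i > n - 1" for i
    using J_shifts_empty[OF ctx that] by (simp add: shC)
  have le: "d - int i \<le> int (J_reg n m)" if "d \<in> set (shifts ?C i)" for i d
    using that total_degree_J_shifts[OF ctx] by (auto simp: shC)
  have pd: "projdim (ideal_module Jnm) = n - 1"
    using projdim_eq[OF C hC _ empty] top by force
  have reg: "regularity (ideal_module Jnm) = int (J_reg n m)"
    using regularity_eq[OF C hC empty le] top by blast
  let ?Q = "quotient_complex ?C"
  have "minimal_free_resolution total_degree ?Q (quotient_ring Jnm)"
    using minimal_quotient_complex[OF total_degree_0 C] J_subset_max[OF ctx] assms(4) by blast
  moreover have "homogeneous_relations (quotient_ring Jnm)"
    unfolding J by (rule homogeneous_relations_quotient_ring)
  moreover have "shifts ?Q i = []" if "i > n" for i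
    using that assms(1) empty[of "i - 1"] by (cases i) (simp_all add: quotient_complex_def)
  \<comment> \<open>The ring in degree 0 of the quotient resolution contributes the value 0, which
    stays below the claimed maximum because \<open>J_reg\<close> is positive.\<close>
  moreover have R1: "J_reg n m \<ge> 1" using assms(1,2) by (simp add: J_reg_def[OF ctx])
  have "d - int i \<le> int (J_reg n m) - 1" if "d \<in> set (shifts ?Q i)" for i d
  proof (cases i)
    case 0
    then show ?thesis using that R1 by (simp add: quotient_complex_def)
  next
    case (Suc j)
    then show ?thesis using that le[of d j] by (simp add: quotient_complex_def)
  qed
  \<comment> \<open>The extremal degree moves from position n - 1 to position n, so its value drops
    by one.\<close>
  moreover have "\<exists>i. \<exists>d\<in>set (shifts ?Q i). d - int i = int (J_reg n m) - 1"
    using top by (intro exI[of _ "Suc (n - 1)"]) (fastforce simp: quotient_complex_def)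
  ultimately have regQ: "regularity (quotient_ring Jnm) = int (J_reg n m) - 1"
    by (rule regularity_eq)
  have b0: "betti (ideal_module Jnm) 0 = n + (n - 1) * (m - 1)"
  proof -
    have "n = Suc (n - 1)" "m = Suc (m - 1)" using assms(1,2) by auto
    then obtain n' m' where "n = Suc n'" "m = Suc m'" by blast
    then show ?thesis by (simp add: betti algebra_simps)
  qed
  \<comment> \<open>Both sides equal m times \<open>n choose Suc i\<close>: the sum accounts for m -
    1 copies, and Pascal's rule turns the two remaining binomials into the last one.\<close>
  have bi: "betti (ideal_module Jnm) i =
      ((n - 1) choose i) + (\<Sum>j=2..n. (m - 1) * ((1 + n - j) choose i)) + ((n - 1) choose (i + 1))"
    if i: "1 \<le> i" for i
  proof -
    have "n = Suc (n - 1)" "m = Suc (m - 1)" using assms(1,2) by auto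
    then obtain n' m' where nm: "n = Suc n'" "m = Suc m'" by blast
    have "(\<Sum>j=2..n. (m - 1) * ((1 + n - j) choose i)) = m' * (n choose Suc i)"
      unfolding sum_distrib_left[symmetric] sum_choose_reverse sum_choose_lower[OF i] by (simp add: nm)
    moreover have "betti (ideal_module Jnm) i = m * (n choose Suc i)"
      unfolding betti sum_choose_lower[OF i] using i by simp
    moreover have "n choose Suc i = (n' choose i) + (n' choose Suc i)" by (simp add: nm)
    ultimately show ?thesis by (simp add: nm)
  qed
  show ?thesis
    using b0 bi pd reg regQ F assms(1,2) by (auto simp: J_reg_def[OF ctx] of_nat_diff)
qed

end
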